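(* Let $\gamma>0$ and let $\mu$ be a finite positive Borel measure on $[0,1)$. Assume that the exponents $p,q$ satisfy one of the following: (a) $0<p<q<\infty$; (b) $0<p=q<1$; (c) $0<p\le 1$ and $q=\infty$. Put $s=\gamma+\frac1p-\frac1q$ (with $1/\infty=0$). Then $\mathcal C_{\mu,\gamma}:H^p\to H^q$ is bounded if and only if $\mu$ is an $s$-Carleson measure. Moreover, $$\|\mathcal C_{\mu,\gamma}\|_{H^p\to H^q}\asymp \sup_{0\le t<1}\frac{\mu([t,1))}{(1-t)^s},$$ where the comparison constants depend only on $p$, $q$ and $\gamma$.
   Context: $\mathbb D$ is the open unit disc in $\mathbb C$. For $0<p<\infty$, $H^p$ is the Hardy space of analytic functions $f$ on $\mathbb D$ with $\|f\|_{H^p}=\sup_{0\le\rho<1}\left(\frac1{2\pi}\int_0^{2\pi}|f(\rho e^{i\theta})|^p\,d\theta\right)^{1/p}<\infty$; $H^\infty$ is the space of bounded analytic functions with the supremum norm. For a finite positive Borel measure $\mu$ on $[0,1)$ put $\mu_n=\int_{[0,1)}t^n\,d\mu(t)$, $n\ge0$. For $\gamma>0$ and $f(z)=\sum_{k\ge0}a_kz^k$ analytic in $\mathbb D$, the generalized Cesàro operator is $$\mathcal C_{\mu,\gamma}f(z)=\sum_{n=0}^\infty\mu_n\left(\sum_{k=0}^n\frac{\Gamma(n-k+\gamma)}{\Gamma(\gamma)(n-k)!}a_k\right)z^n=\int_{[0,1)}\frac{f(tz)}{(1-tz)^\gamma}\,d\mu(t),\qquad z\in\mathbb D.$$ $\mathcal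 C_{\mu,\gamma}:H^p\to H^q$ bounded means that it maps $H^p$ into $H^q$ with $\|\mathcal C_{\mu,\gamma}f\|_{H^q}\le C\|f\|_{H^p}$; $\|\mathcal C_{\mu,\gamma}\|_{H^p\to H^q}$ is the least such constant $C$ ($=\infty$ if there is none). For $s>0$, $\mu$ is an $s$-Carleson measure if there is a constant $C$ with $\mu([t,1))\le C(1-t)^s$ for all $0\le t<1$. $X\asymp Y$ means $C^{-1}Y\le X\le CY$ with a constant $C>0$ independent of the functions, measures and indices under consideration. *)

theory Defs
  imports "HOL-Complex_Analysis.Complex_Analysis"
begin

text \<open>
  Exponents \<open>p \<in> (0,\<infinity>]\<close> have type \<^typ>\<open>ennreal\<close>. The integral mean over each circle of radius
  \<open>\<rho> < 1\<close> is a real number when \<open>f\<close> is holomorphic (the integrand is continuous); the supremum is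
  taken in \<^typ>\<open>ennreal\<close> and is \<open>\<infinity>\<close> when the means are unbounded.
\<close>

definition hardy_norm :: "ennreal \<Rightarrow> (complex \<Rightarrow> complex) \<Rightarrow> ennreal" where
  "hardy_norm p f =
     (if p = \<infinity> then (SUP z\<in>ball 0 1. ennreal (norm (f z)))
      else (SUP \<rho>\<in>{0..<1}. ennreal
             ((1 / (2 * pi) *
                integral {0..2 * pi} (\<lambda>\<theta>. norm (f (of_real \<rho> * cis \<theta>)) powr enn2real p))
              powr (1 / enn2real p))))"

definition hardy_space :: "ennreal \<Rightarrow> (complex \<Rightarrow> complex) set" where
  "hardy_space p = {f. f holomorphic_on ball 0 1 \<and> hardy_norm p f < \<infinity>}"

definition finite_measure_01 :: "real measure \<Rightarrow> bool" where
  "finite_measure_01 \<mu> \<longleftrightarrow>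
     finite_measure \<mu> \<and> sets \<mu> = sets (restrict_space borel {0..<1})"

definition moment :: "real measure \<Rightarrow> nat \<Rightarrow> real" where
  "moment \<mu> n = (LINT t|\<mu>. t ^ n)"

definition taylor_coeff :: "(complex \<Rightarrow> complex) \<Rightarrow> nat \<Rightarrow> complex" where
  "taylor_coeff f k = (deriv ^^ k) f 0 / fact k"

definition cesaro_op ::
  "real measure \<Rightarrow> real \<Rightarrow> (complex \<Rightarrow> complex) \<Rightarrow> complex \<Rightarrow> complex" where
  "cesaro_op \<mu> \<gamma> f z =
     (\<Sum>n. of_real (moment \<mu> n) *
          (\<Sum>k\<le>n. of_real (Gamma (real (n - k) + \<gamma>) / (Gamma \<gamma> * fact (n - k))) * taylor_coeff f k) *
          z ^ n)"

definition hardy_bound ::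
  "((complex \<Rightarrow> complex) \<Rightarrow> complex \<Rightarrow> complex) \<Rightarrow> ennreal \<Rightarrow> ennreal \<Rightarrow> real \<Rightarrow> bool" where
  "hardy_bound T p q C \<longleftrightarrow> 0 \<le> C \<and>
     (\<forall>f\<in>hardy_space p. T f \<in> hardy_space q \<and> hardy_norm q (T f) \<le> ennreal C * hardy_norm p f)"

definition hardy_bounded ::
  "((complex \<Rightarrow> complex) \<Rightarrow> complex \<Rightarrow> complex) \<Rightarrow> ennreal \<Rightarrow> ennreal \<Rightarrow> bool" where
  "hardy_bounded T p q \<longleftrightarrow> (\<exists>C. hardy_bound T p q C)"

text \<open>The infimum is in \<^typ>\<open>ennreal\<close>, hence \<open>\<infinity>\<close> when \<open>T\<close> is not bounded.\<close>

definition hardy_opnorm ::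
  "((complex \<Rightarrow> complex) \<Rightarrow> complex \<Rightarrow> complex) \<Rightarrow> ennreal \<Rightarrow> ennreal \<Rightarrow> ennreal" where
  "hardy_opnorm T p q = Inf {ennreal C | C. hardy_bound T p q C}"

definition carleson_measure :: "real \<Rightarrow> real measure \<Rightarrow> bool" where
  "carleson_measure s \<mu> \<longleftrightarrow>
     (\<exists>C. \<forall>t\<in>{0..<1}. measure \<mu> {t..<1} \<le> C * (1 - t) powr s)"

definition carleson_const :: "real \<Rightarrow> real measure \<Rightarrow> ennreal" where
  "carleson_const s \<mu> = (SUP t\<in>{0..<1}. ennreal (measure \<mu> {t..<1} / (1 - t) powr s))"

end

theory Submission
  imports Defs "HOL-Computational_Algebra.Fundamental_Theorem_Algebra"
begin

text \<open>
  Upper bound. After a dilation, \<open>|f|\<^sup>p\<^sup>/\<^sup>2\<close> is dominated in the disc by the Poisson integral of its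
  boundary values \<open>u \<in> L\<^sup>2\<close>, hence at distance about \<open>2^(-j)\<close> from the circle by a mean \<open>v j\<close>
  of \<open>u\<close> against the kernel \<open>h / (h\<^sup>2 + |e\<^sup>i\<^sup>s - e\<^sup>i\<^sup>t|\<^sup>2)\<close> with \<open>h = 2^(-j)\<close>. Cutting \<open>\<mu>\<close> dyadically, the
  Carleson condition bounds the Cesaro operator pointwise by
  \<open>\<Sum>j. 2^(-j s) min (2^(j \<gamma>)) (|1 - e\<^sup>i\<^sup>x|^(-\<gamma>)) (v j x)^(2/p)\<close>, up to a constant. Everything then
  follows from the \<open>L\<^sup>2\<close> boundedness of \<open>max\<^sub>j v j\<close>, which the \<open>TT\<^sup>*\<close> method yields because the
  composition of two of the kernels is dominated by their sum. For \<open>p < q\<close> the maximal function is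
  combined, up to constants, with the growth bound \<open>v j \<le> 2^(j/2) \<parallel>u\<parallel>\<close>; for \<open>q = p < 1\<close> and \<open>q = \<infinity>\<close> with
  \<open>\<Sum>j. 2^(-j) (v j x)\<^sup>2 \<le> \<parallel>u\<parallel>\<^sup>2\<close>.

  Lower bound. Test on \<open>(1 - a z)^(-2/p)\<close>, evaluate the image at \<open>z = a\<close>, where the integrand is
  positive, and compare with the growth of functions in \<open>H\<^sup>q\<close>.
\<close>

section \<open>Poisson domination of \<open>|f|\<^sup>p\<close>\<close>

text \<open>The exponent \<open>p / 2\<close> is dictated by the maximal function, which is bounded
  on L^2 but not on L^1: an \<open>H^p\<close> bound on \<open>f\<close> becomes an L^2 bound on
  \<open>u\<close> for every \<open>p > 0\<close>. The dilation gives continuous boundary values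
  without any theory of radial limits; the estimates depend neither on the dilation nor on the
  number \<open>J\<close> of scales that it leaves. The cases differ in how the sum over scales is
  controlled. For \<open>p < q\<close> the weight \<open>2^(-j (s - \<gamma>))\<close> decays while
  the means may grow, and two bounds on the means are interpolated. For
  \<open>q = \<infinity>\<close> and \<open>p \<le> 1\<close> the summands are powers with exponent
  \<open>1 / p \<ge> 1\<close>. For \<open>p = q\<close> one has \<open>s = \<gamma>\<close>, and
  bounding the singular factor by a multiple of \<open>2^(j \<gamma>)\<close> leaves no decay at
  all. What helps is that the singularity sits at the single boundary point 1: away from it the
  factor is smaller by a power of \<open>2^(-j) / |1 - e^(i x)|\<close>, and close to it only an arc
  of length about \<open>2^(-j)\<close> is concerned.\<close>

definition poisson_kernel :: "complex \<Rightarrow> real \<Rightarrow> real" where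
  "poisson_kernel z t = (1 - (norm z)\<^sup>2) / (norm (cis t - z))\<^sup>2"

lemma cis_neq_of_norm_less: "norm z < 1 \<Longrightarrow> cis t \<noteq> z"
  using norm_cis[of t] by auto

lemma poisson_kernel_nonneg: "norm z < 1 \<Longrightarrow> 0 \<le> poisson_kernel z t"
  unfolding poisson_kernel_def by (intro divide_nonneg_nonneg) (auto simp: power_le_one)

lemma continuous_on_poisson_kernel: "norm z < 1 \<Longrightarrow> continuous_on S (poisson_kernel z)"
  unfolding poisson_kernel_def
  by (intro continuous_intros) (auto simp: cis_neq_of_norm_less)

text \<open>Cauchy's formula is applied to \<open>w \<mapsto> f w (1 - |z|\<^sup>2) / (1 - cnj z w)\<close>, which agrees with
  \<open>f\<close> at \<open>w = z\<close>; on the unit circle the resulting kernel is the Poisson kernel.\<close>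

lemma poisson_formula:
  assumes f: "f holomorphic_on ball 0 R" and R: "1 < R" and z: "norm z < 1"
  shows "((\<lambda>t. of_real (poisson_kernel z t) * f (cis t)) has_integral 2 * of_real pi * f z) {0..2 * pi}"
proof -
  have nz: "1 - cnj z * w \<noteq> 0" if "norm w \<le> 1" for w
  proof
    assume "1 - cnj z * w = 0"
    then have "norm (cnj z * w) = 1" by (metis eq_iff_diff_eq_0 norm_one)
    moreover have "norm (cnj z * w) < 1"
      using z that mult_left_le[of "norm w" "norm z"] by (simp add: norm_mult)
    ultimately show False by simp
  qed
  define g where "g w = f w * of_real (1 - (norm z)\<^sup>2) / (1 - cnj z * w)" for w
  have f': "f holomorphic_on cball 0 1"
    using f R by (rule_tac holomorphic_on_subset) auto
  have "g holomorphic_on cball 0 1"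
    unfolding g_def using f' nz by (intro holomorphic_intros) auto
  from Cauchy_integral_circlepath_simple[OF this, of z] z
  have "((\<lambda>u. g u/(u-z)) has_contour_integral (2 * of_real pi * \<i> * g z)) (circlepath 0 1)" by simp
  moreover have "g z = f z"
    using nz[of z] z unfolding g_def by (simp add: complex_norm_square mult.commute del: of_real_power)
  ultimately have "((\<lambda>t. g (cis t) / (cis t - z) * \<i> * cis t) has_integral (2 * of_real pi * \<i> * f z)) {0..2*pi}"
    unfolding circlepath_def by (subst (asm) has_contour_integral_part_circlepath_iff) auto
  from has_integral_mult_right[OF this, of "-\<i>"]
  have "((\<lambda>t. -\<i> * (g (cis t) / (cis t - z) * \<i> * cis t)) has_integral (2 * of_real pi * f z)) {0..2*pi}"
    by (simp add: mult_ac)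
  moreover have "-\<i> * (g (cis t) / (cis t - z) * \<i> * cis t) = of_real (poisson_kernel z t) * f (cis t)" for t
  proof -
    define N where "N = complex_of_real ((norm (cis t - z))\<^sup>2)"
    define c where "c = complex_of_real (1 - (norm z)\<^sup>2)"
    have "N = (cis t - z) * (cnj (cis t) - cnj z)"
      unfolding N_def by (simp add: complex_norm_square del: of_real_power)
    moreover have "(cnj (cis t) - cnj z) * cis t = 1 - cnj z * cis t"
      by (simp add: algebra_simps cis_cnj cis_mult)
    ultimately have N: "N * cis t = (cis t - z) * (1 - cnj z * cis t)"
      by (metis mult.assoc)
    have "N \<noteq> 0" using cis_neq_of_norm_less[OF z, of t] by (simp add: N_def)
    have "-\<i> * (g (cis t) / (cis t - z) * \<i> * cis t) = f (cis t) * c * cis t / (N * cis t)"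
      unfolding N g_def c_def[symmetric] by (simp add: mult_ac)
    also have "\<dots> = c / N * f (cis t)" using \<open>N \<noteq> 0\<close> by simp
    finally show ?thesis by (simp only: N_def c_def poisson_kernel_def of_real_divide)
  qed
  ultimately show ?thesis by simp
qed

lemma integral_poisson_kernel:
  assumes "norm z < 1"
  shows "integral {0..2*pi} (poisson_kernel z) = 2 * pi"
proof -
  have "((\<lambda>t. complex_of_real (poisson_kernel z t)) has_integral of_real (2 * pi)) {0..2*pi}"
    using poisson_formula[of "\<lambda>_. 1" 2 z] assms by simp
  from has_integral_Re[OF this] show ?thesis
    by (simp add: integral_unique)
qed

text \<open>Subharmonicity of \<open>|f|^p\<close> in integrated form. The boundary values
  \<open>f (cis t)\<close> are taken literally, so a function on the open disc is dilated before
  this is applied.\<close>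

definition poisson_dominated :: "real \<Rightarrow> (complex \<Rightarrow> complex) \<Rightarrow> bool" where
  "poisson_dominated p f \<longleftrightarrow> (\<forall>z. norm z < 1 \<longrightarrow>
     2 * pi * norm (f z) powr p \<le> integral {0..2*pi} (\<lambda>t. poisson_kernel z t * norm (f (cis t)) powr p))"

text \<open>Without zeros, \<open>f\<close> has a holomorphic logarithm \<open>g\<close> on the
  larger disc, and \<open>|f|^p\<close> is the modulus of \<open>exp (p g)\<close>. The triangle
  inequality in the Poisson formula of the latter gives the claim.\<close>

lemma poisson_dominated_zero_free:
  assumes f: "f holomorphic_on ball 0 R" and R: "1 < R"
    and nz: "\<And>z. z \<in> ball 0 R \<Longrightarrow> f z \<noteq> 0"
  shows "poisson_dominated p f"
  unfolding poisson_dominated_def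
proof (intro allI impI)
  fix z :: complex assume z: "norm z < 1"
  have con: "contractible (ball (0::complex) R)" by (simp add: convex_imp_contractible)
  have "\<exists>g. g holomorphic_on ball 0 R \<and> (\<forall>z\<in>ball 0 R. f z = exp (g z))"
    by (rule contractible_imp_holomorphic_log[OF f con nz]) auto
  then obtain g where g: "g holomorphic_on ball 0 R" "\<And>z. z \<in> ball 0 R \<Longrightarrow> f z = exp (g z)"
    by blast
  define h where "h w = exp (of_real p * g w)" for w
  have h: "h holomorphic_on ball 0 R" unfolding h_def by (intro holomorphic_intros g)
  have nh: "norm (h w) = norm (f w) powr p" if "w \<in> ball 0 R" for w
    using g(2)[OF that] by (simp add: h_def powr_def)
  have *: "((\<lambda>t. of_real (poisson_kernel z t) * h (cis t)) has_integral 2 * of_real pi * h z) {0..2 * pi}"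
    by (rule poisson_formula[OF h R z])
  have ch: "continuous_on {0..2*pi} (\<lambda>t. h (cis t))"
    by (rule continuous_on_compose2[OF holomorphic_on_imp_continuous_on[OF h]])
      (use R in \<open>auto intro!: continuous_on_cis continuous_on_id\<close>)
  have "norm (2 * of_real pi * h z) \<le> integral {0..2*pi} (\<lambda>t. poisson_kernel z t * norm (h (cis t)))"
    unfolding integral_unique[OF *, symmetric]
  proof (rule integral_norm_bound_integral)
    show "(\<lambda>t. of_real (poisson_kernel z t) * h (cis t)) integrable_on {0..2*pi}"
      by (rule has_integral_integrable[OF *])
    show "(\<lambda>t. poisson_kernel z t * norm (h (cis t))) integrable_on {0..2*pi}"
      by (intro integrable_continuous_interval continuous_intros continuous_on_poisson_kernel z ch)
  qed (use poisson_kernel_nonneg[OF z] in \<open>simp add: norm_mult\<close>)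
  then show "2 * pi * norm (f z) powr p \<le> integral {0..2*pi} (\<lambda>t. poisson_kernel z t * norm (f (cis t)) powr p)"
    using nh R z by (simp add: norm_mult)
qed

text \<open>For fixed \<open>z\<close> in the disc the Poisson kernel is integrable on the circle,
  so dominated convergence applies to the right-hand side. The lemma serves twice: for dilations and
  for Taylor polynomials.\<close>

lemma poisson_dominated_limit:
  assumes p: "0 < p" and dom: "\<And>n. poisson_dominated p (F n)"
    and cont: "\<And>n. continuous_on (cball 0 1) (F n)"
    and bd: "\<And>n z. norm z \<le> 1 \<Longrightarrow> norm (F n z) \<le> B"
    and lim: "\<And>z. norm z \<le> 1 \<Longrightarrow> (\<lambda>n. F n z) \<longlonglongrightarrow> f z"
  shows "poisson_dominated p f"
  unfolding poisson_dominated_def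
proof (intro allI impI)
  fix z :: complex assume z: "norm z < 1"
  have lim': "(\<lambda>n. norm (F n w) powr p) \<longlonglongrightarrow> norm (f w) powr p" if "norm w \<le> 1" for w
    using p by (intro tendsto_powr' tendsto_norm lim[OF that] tendsto_const) auto
  have cF: "continuous_on {0..2*pi} (\<lambda>t. poisson_kernel z t * norm (F n (cis t)) powr p)" for n
    using p by (intro continuous_intros continuous_on_poisson_kernel z continuous_on_powr'
        continuous_on_compose2[OF cont]) auto
  have "(\<lambda>n. integral {0..2*pi} (\<lambda>t. poisson_kernel z t * norm (F n (cis t)) powr p))
      \<longlonglongrightarrow> integral {0..2*pi} (\<lambda>t. poisson_kernel z t * norm (f (cis t)) powr p)"
  proof (rule dominated_convergence(2))
    show "(\<lambda>t. poisson_kernel z t * norm (F n (cis t)) powr p) integrable_on {0..2*pi}" for n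
      by (rule integrable_continuous_interval[OF cF])
    show "(\<lambda>t. poisson_kernel z t * B powr p) integrable_on {0..2*pi}"
      by (intro integrable_continuous_interval continuous_intros continuous_on_poisson_kernel z)
    show "norm (poisson_kernel z t * norm (F n (cis t)) powr p) \<le> poisson_kernel z t * B powr p" for n t
      using poisson_kernel_nonneg[OF z, of t] bd[of "cis t" n] p
      by (auto simp: abs_mult intro!: mult_left_mono powr_mono2)
    show "(\<lambda>n. poisson_kernel z t * norm (F n (cis t)) powr p)
        \<longlonglongrightarrow> poisson_kernel z t * norm (f (cis t)) powr p" for t
      by (intro tendsto_mult tendsto_const lim') auto
  qed
  moreover have "(\<lambda>n. 2 * pi * norm (F n z) powr p) \<longlonglongrightarrow> 2 * pi * norm (f z) powr p"
    using z by (intro tendsto_mult tendsto_const lim') auto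
  ultimately show "2 * pi * norm (f z) powr p \<le> integral {0..2*pi} (\<lambda>t. poisson_kernel z t * norm (f (cis t)) powr p)"
    using dom z unfolding poisson_dominated_def by (elim LIMSEQ_le) auto
qed

text \<open>A function with zeros on the unit circle but none inside escapes the zero-free case,
  whereas its dilations have no zeros in a larger disc. Letting the dilation factor tend to 1
  recovers the function.\<close>

lemma poisson_dominated_dilations:
  assumes p: "0 < p" and f: "continuous_on (cball 0 1) f"
    and dom: "\<And>r. 0 < r \<Longrightarrow> r < 1 \<Longrightarrow> poisson_dominated p (\<lambda>z. f (of_real r * z))"
  shows "poisson_dominated p f"
proof -
  define r where "r n = 1 - 1 / real (n + 2)" for n
  have r: "0 < r n" "r n < 1" for n by (auto simp: r_def field_simps)
  have in01: "of_real (r n) * z \<in> cball 0 1" if "norm z \<le> 1" for n and z :: complex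
    using r[of n] that mult_le_one[of "r n" "norm z"] by (auto simp: norm_mult)
  obtain B where B: "\<And>z. z \<in> cball 0 1 \<Longrightarrow> norm (f z) \<le> B"
    using compact_continuous_image[OF f compact_cball] compact_imp_bounded bounded_iff
    by (metis image_eqI)
  have "r \<longlonglongrightarrow> 1 - 0" unfolding r_def
    by (intro tendsto_diff tendsto_const LIMSEQ_ignore_initial_segment[OF lim_1_over_n])
  then have rl: "r \<longlonglongrightarrow> 1" by simp
  show ?thesis
  proof (rule poisson_dominated_limit[OF p, of "\<lambda>n z. f (of_real (r n) * z)"])
    show "poisson_dominated p (\<lambda>z. f (of_real (r n) * z))" for n by (rule dom) (auto simp: r)
    show "continuous_on (cball 0 1) (\<lambda>z. f (of_real (r n) * z))" for n
      using in01 by (intro continuous_on_compose2[OF f] continuous_intros) auto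
    show "norm (f (of_real (r n) * z)) \<le> B" if "norm z \<le> 1" for n z
      using B in01[OF that] by blast
    show "(\<lambda>n. f (of_real (r n) * z)) \<longlonglongrightarrow> f z" if "norm z \<le> 1" for z
    proof -
      have "(\<lambda>n. of_real (r n) * z) \<longlonglongrightarrow> of_real 1 * z"
        by (intro tendsto_mult tendsto_of_real rl tendsto_const)
      then show ?thesis
        using in01[OF that] that by (intro continuous_on_tendsto_compose[OF f]) auto
    qed
  qed
qed

text \<open>Reflecting the zeros of the polynomial in the unit circle does not change its modulus on the
  circle, increases it inside, and produces a function without zeros in the disc.\<close>

lemma poisson_dominated_poly:
  fixes P :: "complex poly"
  assumes p: "0 < p"
  shows "poisson_dominated p (poly P)"
proof (cases "P = 0")
  case True
  then show ?thesis using p by (simp add: poisson_dominated_def)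
next
  case False
  obtain a where a: "smult (lead_coeff P) (\<Prod>i<degree P. [:-a i, 1:]) = P"
    using complex_poly_decompose' by blast
  define b where "b i z = (if norm (a i) < 1 then 1 - cnj (a i) * z else z - a i)" for i z
  define f where "f z = lead_coeff P * (\<Prod>i<degree P. b i z)" for z
  have P: "poly P z = lead_coeff P * (\<Prod>i<degree P. z - a i)" for z
    by (subst (1) a[symmetric]) (simp add: poly_prod)
  \<comment> \<open>For \<open>norm c < 1\<close> the right side is nonnegative in the closed disc,
    and it vanishes for \<open>norm z = 1\<close>: one identity yields both \<open>ble\<close> and
    \<open>beq\<close>.\<close>
  have refl: "(norm (1 - cnj c * z))\<^sup>2 - (norm (z - c))\<^sup>2 = (1 - (norm c)\<^sup>2) * (1 - (norm z)\<^sup>2)" for c z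
    unfolding cmod_power2 by (simp add: algebra_simps power2_eq_square)
  have ble: "norm (z - a i) \<le> norm (b i z)" if "norm z \<le> 1" for i z
  proof (cases "norm (a i) < 1")
    case True
    have "0 \<le> (1 - (norm (a i))\<^sup>2) * (1 - (norm z)\<^sup>2)"
      using True that by (intro mult_nonneg_nonneg) (auto simp: power_le_one)
    then have "(norm (z - a i))\<^sup>2 \<le> (norm (1 - cnj (a i) * z))\<^sup>2" using refl[of "a i" z] by linarith
    then show ?thesis using True by (auto simp: b_def intro: power2_le_imp_le)
  qed (simp add: b_def)
  have beq: "norm (b i z) = norm (z - a i)" if "norm z = 1" for i z
  proof (cases "norm (a i) < 1")
    case True
    have "(norm (z - a i))\<^sup>2 = (norm (1 - cnj (a i) * z))\<^sup>2" using refl[of "a i" z] that by simp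
    then show ?thesis using True by (simp add: b_def)
  qed (simp add: b_def)
  have bnz: "b i z \<noteq> 0" if "norm z < 1" for i z
  proof (cases "norm (a i) < 1")
    case True
    then have "norm (cnj (a i) * z) < 1"
      using that mult_strict_mono'[of "norm (a i)" 1 "norm z" 1] by (simp add: norm_mult)
    then show ?thesis using True by (auto simp: b_def)
  next
    case False
    then show ?thesis using that by (auto simp: b_def)
  qed
  have bhol: "b i holomorphic_on S" for i S
    by (cases "norm (a i) < 1") (auto simp: b_def[abs_def] intro!: holomorphic_intros)
  have fhol: "f holomorphic_on S" for S
    unfolding f_def by (intro holomorphic_intros bhol)
  have dom: "poisson_dominated p f"
  proof (rule poisson_dominated_dilations[OF p])
    show "continuous_on (cball 0 1) f" by (rule holomorphic_on_imp_continuous_on[OF fhol])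
    fix r :: real assume r: "0 < r" "r < 1"
    show "poisson_dominated p (\<lambda>z. f (of_real r * z))"
    proof (rule poisson_dominated_zero_free)
      show "(\<lambda>z. f (of_real r * z)) holomorphic_on ball 0 (1 / r)"
        by (rule holomorphic_on_compose_gen[OF _ fhol, of _ _ UNIV, unfolded o_def]) (auto intro!: holomorphic_intros)
      show "1 < 1 / r" using r by simp
      show "f (of_real r * z) \<noteq> 0" if "z \<in> ball 0 (1 / r)" for z
        using that r bnz[of "of_real r * z"] False by (auto simp: f_def norm_mult field_simps)
    qed
  qed
  have le: "norm (poly P z) \<le> norm (f z)" if "norm z \<le> 1" for z
    unfolding P f_def norm_mult using ble[OF that]
    by (auto simp: prod_norm[symmetric] intro!: mult_left_mono prod_mono)
  have eq: "norm (f (cis t)) = norm (poly P (cis t))" for t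
    unfolding P f_def norm_mult prod_norm[symmetric] using beq[of "cis t"] by simp
  show ?thesis
    unfolding poisson_dominated_def
  proof (intro allI impI)
    fix z :: complex assume z: "norm z < 1"
    have "2 * pi * norm (poly P z) powr p \<le> 2 * pi * norm (f z) powr p"
      using le[of z] z p by (intro mult_left_mono powr_mono2) auto
    also have "\<dots> \<le> integral {0..2*pi} (\<lambda>t. poisson_kernel z t * norm (poly P (cis t)) powr p)"
      using dom z eq by (simp add: poisson_dominated_def)
    finally show "2 * pi * norm (poly P z) powr p
      \<le> integral {0..2*pi} (\<lambda>t. poisson_kernel z t * norm (poly P (cis t)) powr p)" .
  qed
qed

text \<open>Since \<open>R > 1\<close>, the Taylor polynomials converge on the closed unit disc
  under the common bound given by the sum of \<open>norm (a k)\<close>. Finite products of linear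
  factors thus do the work of Blaschke products.\<close>

lemma poisson_dominated_holomorphic:
  assumes p: "0 < p" and f: "f holomorphic_on ball 0 R" and R: "1 < R"
  shows "poisson_dominated p f"
proof -
  define a where "a n = (deriv ^^ n) f 0 / fact n" for n
  have sums: "(\<lambda>n. a n * z ^ n) sums f z" if "norm z < R" for z
    using holomorphic_power_series[OF f, of z] that by (simp add: a_def)
  define P where "P n = (\<Sum>k<n. monom (a k) k)" for n
  have P: "poly (P n) z = (\<Sum>k<n. a k * z ^ k)" for n z
    by (simp add: P_def poly_sum poly_monom)
  obtain R' where R': "1 < R'" "R' < R" using dense[OF R] by auto
  have "summable (\<lambda>n. a n * of_real R' ^ n)"
    using sums[of "of_real R'"] R' by (auto simp: sums_iff)
  from powser_insidea[OF this, of 1] R' have sn: "summable (\<lambda>n. norm (a n))" by simp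
  have bd: "norm (poly (P n) z) \<le> (\<Sum>k. norm (a k))" if "norm z \<le> 1" for n z
  proof -
    have "norm (poly (P n) z) \<le> (\<Sum>k<n. norm (a k * z ^ k))"
      by (subst P) (rule norm_sum)
    also have "\<dots> \<le> (\<Sum>k<n. norm (a k))"
      using that by (intro sum_mono) (auto simp: norm_mult norm_power intro!: mult_left_le power_le_one)
    also have "\<dots> \<le> (\<Sum>k. norm (a k))" using sn by (intro sum_le_suminf) auto
    finally show ?thesis .
  qed
  show ?thesis
  proof (rule poisson_dominated_limit[where F = "\<lambda>n. poly (P n)" and B = "\<Sum>k. norm (a k)", OF p _ _ bd])
    show "poisson_dominated p (poly (P n))" for n by (rule poisson_dominated_poly[OF p])
    show "continuous_on (cball 0 1) (poly (P n))" for n by (intro continuous_at_imp_continuous_on ballI poly_isCont)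
    show "(\<lambda>n. poly (P n) z) \<longlonglongrightarrow> f z" if "norm z \<le> 1" for z
    proof -
      have "norm z < R" using that R by linarith
      from sums[OF this] show ?thesis by (simp only: P sums_def)
    qed
  qed
qed

section \<open>A maximal inequality by the \<open>TT\<^sup>*\<close> method\<close>

lemma ennreal_AM_GM:
  fixes a b :: ennreal
  assumes "0 < c"
  shows "2 * (a * b) \<le> ennreal c * a\<^sup>2 + ennreal (1 / c) * b\<^sup>2"
proof (cases "a = top \<or> b = top")
  case True
  then show ?thesis using assms
    by (cases "a = 0 \<or> b = 0") (auto simp: power2_eq_square ennreal_mult_top ennreal_top_mult)
next
  case False
  then obtain x y where xy: "a = ennreal x" "b = ennreal y" "0 \<le> x" "0 \<le> y"
    by (metis ennreal_cases infinity_ennreal_def)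
  have "0 \<le> (c * x - y)\<^sup>2 / c" using assms by simp
  also have "\<dots> = c * x\<^sup>2 + 1 / c * y\<^sup>2 - 2 * (x * y)"
    using assms by (simp add: field_simps power2_eq_square)
  finally have "2 * (x * y) \<le> c * x\<^sup>2 + 1 / c * y\<^sup>2" by simp
  then have "ennreal (2 * (x * y)) \<le> ennreal (c * x\<^sup>2 + 1 / c * y\<^sup>2)"
    by (rule ennreal_leI)
  moreover have "ennreal (2 * (x * y)) = 2 * (a * b)"
    using xy by (simp add: ennreal_mult)
  moreover have "ennreal (c * x\<^sup>2 + 1 / c * y\<^sup>2) = ennreal c * a\<^sup>2 + ennreal (1 / c) * b\<^sup>2"
    using xy assms ennreal_plus[of "c * x\<^sup>2" "1 / c * y\<^sup>2"] ennreal_mult[of c "x\<^sup>2"] ennreal_mult[of "1 / c" "y\<^sup>2"]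
    by (simp only: ennreal_power) simp
  ultimately show ?thesis by simp
qed

lemma nn_integral_AM_GM:
  assumes [measurable]: "f \<in> borel_measurable M" "g \<in> borel_measurable M" and c: "0 < c"
  shows "2 * (\<integral>\<^sup>+x. f x * g x \<partial>M) \<le> ennreal c * (\<integral>\<^sup>+x. (f x)\<^sup>2 \<partial>M) + ennreal (1 / c) * (\<integral>\<^sup>+x. (g x)\<^sup>2 \<partial>M)"
proof -
  have "2 * (\<integral>\<^sup>+x. f x * g x \<partial>M) = (\<integral>\<^sup>+x. 2 * (f x * g x) \<partial>M)"
    by (simp add: nn_integral_cmult)
  also have "\<dots> \<le> (\<integral>\<^sup>+x. ennreal c * (f x)\<^sup>2 + ennreal (1 / c) * (g x)\<^sup>2 \<partial>M)"
    by (intro nn_integral_mono ennreal_AM_GM c)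
  also have "\<dots> = ennreal c * (\<integral>\<^sup>+x. (f x)\<^sup>2 \<partial>M) + ennreal (1 / c) * (\<integral>\<^sup>+x. (g x)\<^sup>2 \<partial>M)"
    by (simp add: nn_integral_add nn_integral_cmult)
  finally show ?thesis .
qed

lemma nn_integral_Cauchy_Schwarz:
  assumes f[measurable]: "f \<in> borel_measurable M" and g[measurable]: "g \<in> borel_measurable M"
  shows "(\<integral>\<^sup>+x. f x * g x \<partial>M)\<^sup>2 \<le> (\<integral>\<^sup>+x. (f x)\<^sup>2 \<partial>M) * (\<integral>\<^sup>+x. (g x)\<^sup>2 \<partial>M)"
proof -
  let ?A = "\<integral>\<^sup>+x. (f x)\<^sup>2 \<partial>M" and ?B = "\<integral>\<^sup>+x. (g x)\<^sup>2 \<partial>M"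
  have zero: "(\<integral>\<^sup>+x. f x * g x \<partial>M) = 0" if "?A = 0 \<or> ?B = 0"
    using that
  proof
    assume "?A = 0"
    then have "AE x in M. f x = 0" by (simp add: nn_integral_0_iff_AE)
    then show ?thesis by (subst nn_integral_0_iff_AE) (auto elim: eventually_mono)
  next
    assume "?B = 0"
    then have "AE x in M. g x = 0" by (simp add: nn_integral_0_iff_AE)
    then show ?thesis by (subst nn_integral_0_iff_AE) (auto elim: eventually_mono)
  qed
  consider "?A = 0 \<or> ?B = 0" | "?A \<noteq> 0" "?B \<noteq> 0" "?A = top \<or> ?B = top"
    | "?A \<noteq> 0" "?B \<noteq> 0" "?A \<noteq> top" "?B \<noteq> top" by blast
  then show ?thesis
  proof cases
    case 1
    then show ?thesis by (simp add: zero)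
  next
    case 2
    then have "?A * ?B = top" by (auto simp: ennreal_mult_eq_top_iff)
    then show ?thesis by simp
  next
    case 3
    then obtain a b where ab: "?A = ennreal a" "?B = ennreal b" "0 \<le> a" "0 \<le> b"
      by (metis ennreal_cases infinity_ennreal_def)
    then have pos: "0 < a" "0 < b" using 3 by (metis ennreal_0 le_less)+
    \<comment> \<open>The weight that makes both terms of the bound equal to
      \<open>sqrt a * sqrt b\<close>.\<close>
    define c where "c = sqrt b / sqrt a"
    have c: "0 < c" using pos by (simp add: c_def)
    have "2 * (\<integral>\<^sup>+x. f x * g x \<partial>M) \<le> ennreal c * ?A + ennreal (1 / c) * ?B"
      by (rule nn_integral_AM_GM[OF f g c])
    also have "\<dots> = ennreal (c * a + 1 / c * b)"
      using ab c ennreal_plus[of "c * a" "1 / c * b"] ennreal_mult[of c a] ennreal_mult[of "1 / c" b] by simp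
    also have "c * a + 1 / c * b = 2 * sqrt (a * b)"
    proof -
      have "sqrt a * sqrt a = a" "sqrt b * sqrt b = b" using pos by auto
      then have "c * a = sqrt a * sqrt b" "1 / c * b = sqrt a * sqrt b"
        using pos unfolding c_def by (simp_all add: field_simps)
      then show ?thesis by (simp add: real_sqrt_mult)
    qed
    also have "ennreal \<dots> = 2 * ennreal (sqrt (a * b))"
      using ab by (simp add: ennreal_mult)
    finally have "(\<integral>\<^sup>+x. f x * g x \<partial>M) \<le> ennreal (sqrt (a * b))"
      by (simp add: ennreal_mult_le_mult_iff)
    then have "(\<integral>\<^sup>+x. f x * g x \<partial>M)\<^sup>2 \<le> (ennreal (sqrt (a * b)))\<^sup>2"
      by (intro power_mono) auto
    also have "\<dots> = ?A * ?B"
      using ab by (simp add: ennreal_power ennreal_mult)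
    finally show ?thesis .
  qed
qed

text \<open>The \<open>TT\<^sup>*\<close> method: \<open>\<parallel>T\<parallel>\<^sup>2 = \<parallel>TT\<^sup>*\<parallel> \<le> D \<parallel>T + T\<^sup>*\<parallel> \<le> 2D \<parallel>T\<parallel>\<close> when the kernel of
  \<open>TT\<^sup>*\<close> is dominated by that of \<open>T + T\<^sup>*\<close>.\<close>

lemma TT_star_improve:
  fixes k :: "'a \<Rightarrow> 'a \<Rightarrow> ennreal"
  assumes M: "sigma_finite_measure M"
    and k[measurable]: "(\<lambda>(x, y). k x y) \<in> borel_measurable (M \<Otimes>\<^sub>M M)"
    and D: "0 < D"
    and quasi: "\<And>x x'. x \<in> space M \<Longrightarrow> x' \<in> space M \<Longrightarrow>
      (\<integral>\<^sup>+y. k x y * k x' y \<partial>M) \<le> ennreal D * (k x x' + k x' x)"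
    and Q: "0 < Q"
    and bound: "\<And>u. u \<in> borel_measurable M \<Longrightarrow>
      (\<integral>\<^sup>+x. (\<integral>\<^sup>+y. k x y * u y \<partial>M)\<^sup>2 \<partial>M) \<le> ennreal Q * (\<integral>\<^sup>+x. (u x)\<^sup>2 \<partial>M)"
    and u[measurable]: "u \<in> borel_measurable M"
  shows "(\<integral>\<^sup>+x. (\<integral>\<^sup>+y. k x y * u y \<partial>M)\<^sup>2 \<partial>M) \<le> ennreal (2 * D * sqrt Q) * (\<integral>\<^sup>+x. (u x)\<^sup>2 \<partial>M)"
proof (cases "(\<integral>\<^sup>+x. (u x)\<^sup>2 \<partial>M) = top")
  case True
  then show ?thesis using D Q by (simp add: ennreal_mult_top)
next
  case False
  interpret sigma_finite_measure M by fact
  interpret pair_sigma_finite M M ..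
  \<comment> \<open>With \<open>T\<close> the operator of kernel \<open>k\<close>, these functions
    are \<open>h = T u\<close>, \<open>h2 = T h\<close>, and \<open>g\<close>, the adjoint of
    \<open>T\<close> applied to \<open>h\<close>.\<close>
  define h where "h x = (\<integral>\<^sup>+y. k x y * u y \<partial>M)" for x
  have h[measurable]: "h \<in> borel_measurable M" unfolding h_def by measurable
  define h2 where "h2 x = (\<integral>\<^sup>+y. k x y * h y \<partial>M)" for x
  have h2[measurable]: "h2 \<in> borel_measurable M" unfolding h2_def by measurable
  define g where "g y = (\<integral>\<^sup>+x. h x * k x y \<partial>M)" for y
  have g[measurable]: "g \<in> borel_measurable M" unfolding g_def by measurable
  let ?N = "\<lambda>f. (\<integral>\<^sup>+x. (f x)\<^sup>2 \<partial>M)"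
  define c where "c = 2 * D * sqrt Q"
  have c: "0 < c" using D Q by (simp add: c_def)
  have "?N h \<le> ennreal Q * ?N u" unfolding h_def by (rule bound[OF u])
  also have "\<dots> < top" using False by (simp add: ennreal_mult_less_top top.not_eq_extremum)
  finally have fin: "?N h < top" .
  have Nh: "?N h = (\<integral>\<^sup>+y. u y * g y \<partial>M)"
  proof -
    have "?N h = (\<integral>\<^sup>+x. \<integral>\<^sup>+y. h x * (k x y * u y) \<partial>M \<partial>M)"
      by (intro nn_integral_cong) (subst nn_integral_cmult, measurable, simp add: power2_eq_square h_def[symmetric])
    also have "\<dots> = (\<integral>\<^sup>+y. \<integral>\<^sup>+x. h x * (k x y * u y) \<partial>M \<partial>M)"
      by (rule Fubini'[symmetric]) measurable
    also have "\<dots> = (\<integral>\<^sup>+y. \<integral>\<^sup>+x. u y * (h x * k x y) \<partial>M \<partial>M)"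
      by (simp add: mult_ac)
    also have "\<dots> = (\<integral>\<^sup>+y. u y * g y \<partial>M)"
      unfolding g_def by (intro nn_integral_cong nn_integral_cmult) measurable
    finally show ?thesis .
  qed
  have hh2: "(\<integral>\<^sup>+x. \<integral>\<^sup>+x'. h x * h x' * k x x' \<partial>M \<partial>M) = (\<integral>\<^sup>+x. h x * h2 x \<partial>M)"
    by (intro nn_integral_cong) (simp add: nn_integral_cmult h2_def mult_ac)
  have hh2': "(\<integral>\<^sup>+x. \<integral>\<^sup>+x'. h x * h x' * k x' x \<partial>M \<partial>M) = (\<integral>\<^sup>+x. h x * h2 x \<partial>M)"
    unfolding hh2[symmetric] by (subst Fubini') (simp_all add: mult_ac)
  have "?N g = (\<integral>\<^sup>+y. \<integral>\<^sup>+x. \<integral>\<^sup>+x'. (h x * k x y) * (h x' * k x' y) \<partial>M \<partial>M \<partial>M)"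
    by (intro nn_integral_cong) (simp add: nn_integral_cmult nn_integral_multc power2_eq_square g_def)
  also have "\<dots> = (\<integral>\<^sup>+x. \<integral>\<^sup>+y. \<integral>\<^sup>+x'. (h x * k x y) * (h x' * k x' y) \<partial>M \<partial>M \<partial>M)"
    by (rule Fubini') measurable
  also have "\<dots> = (\<integral>\<^sup>+x. \<integral>\<^sup>+x'. \<integral>\<^sup>+y. (h x * k x y) * (h x' * k x' y) \<partial>M \<partial>M \<partial>M)"
    by (intro nn_integral_cong Fubini') measurable
  also have "\<dots> = (\<integral>\<^sup>+x. \<integral>\<^sup>+x'. h x * h x' * (\<integral>\<^sup>+y. k x y * k x' y \<partial>M) \<partial>M \<partial>M)"
    by (intro nn_integral_cong) (simp add: nn_integral_cmult[symmetric] mult_ac)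
  also have "\<dots> \<le> (\<integral>\<^sup>+x. \<integral>\<^sup>+x'. h x * h x' * (ennreal D * (k x x' + k x' x)) \<partial>M \<partial>M)"
    by (intro nn_integral_mono mult_left_mono quasi) auto
  also have "\<dots> = (\<integral>\<^sup>+x. ennreal D * (\<integral>\<^sup>+x'. h x * h x' * k x x' \<partial>M)
      + ennreal D * (\<integral>\<^sup>+x'. h x * h x' * k x' x \<partial>M) \<partial>M)"
  proof (intro nn_integral_cong)
    fix x assume [measurable]: "x \<in> space M"
    show "(\<integral>\<^sup>+x'. h x * h x' * (ennreal D * (k x x' + k x' x)) \<partial>M)
      = ennreal D * (\<integral>\<^sup>+x'. h x * h x' * k x x' \<partial>M) + ennreal D * (\<integral>\<^sup>+x'. h x * h x' * k x' x \<partial>M)"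
      by (subst (1 2) nn_integral_cmult[symmetric], measurable, subst nn_integral_add[symmetric], measurable)
        (simp add: distrib_left mult_ac)
  qed
  also have "\<dots> = ennreal D * ((\<integral>\<^sup>+x. \<integral>\<^sup>+x'. h x * h x' * k x x' \<partial>M \<partial>M)
      + (\<integral>\<^sup>+x. \<integral>\<^sup>+x'. h x * h x' * k x' x \<partial>M \<partial>M))"
    by (simp add: nn_integral_cmult nn_integral_add distrib_left)
  also have "\<dots> = ennreal D * (2 * (\<integral>\<^sup>+x. h x * h2 x \<partial>M))"
    unfolding hh2 hh2' by (simp add: mult_2)
  \<comment> \<open>The weight \<open>sqrt Q\<close> balances \<open>?N h\<close> against
    \<open>?N h2\<close>, which is at most \<open>Q\<close> times \<open>?N h\<close>.\<close>
  also have "\<dots> \<le> ennreal D * (ennreal (sqrt Q) * ?N h + ennreal (1 / sqrt Q) * ?N h2)"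
    using Q by (intro mult_left_mono nn_integral_AM_GM) auto
  also have "\<dots> \<le> ennreal D * (ennreal (sqrt Q) * ?N h + ennreal (1 / sqrt Q) * (ennreal Q * ?N h))"
    unfolding h2_def by (intro mult_left_mono add_left_mono bound) auto
  also have "\<dots> = ennreal c * ?N h"
  proof -
    have "ennreal (1 / sqrt Q) * (ennreal Q * ?N h) = ennreal (sqrt Q) * ?N h"
      using Q by (simp add: mult.assoc[symmetric] ennreal_mult[symmetric] real_div_sqrt)
    then have "ennreal D * (ennreal (sqrt Q) * ?N h + ennreal (1 / sqrt Q) * (ennreal Q * ?N h))
       = (ennreal D * ennreal (sqrt Q) * 2) * ?N h" by (simp add: mult_2 mult_2_right distrib_left distrib_right mult_ac)
    also have "ennreal D * ennreal (sqrt Q) * 2 = ennreal c"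
      using D Q by (simp add: c_def ennreal_mult mult_ac)
    finally show ?thesis .
  qed
  finally have Ng: "?N g \<le> ennreal c * ?N h" .
  \<comment> \<open>By \<open>Ng\<close> the second term becomes a single copy of
    \<open>?N h\<close>, which is absorbed on the left. The absorption needs \<open>?N h\<close>
    finite, which is what the a priori bound with \<open>Q\<close> supplies.\<close>
  have "?N h + ?N h = 2 * (\<integral>\<^sup>+y. u y * g y \<partial>M)" unfolding Nh by (simp add: mult_2)
  also have "\<dots> \<le> ennreal c * ?N u + ennreal (1 / c) * ?N g"
    by (intro nn_integral_AM_GM c) auto
  also have "\<dots> \<le> ennreal c * ?N u + ennreal (1 / c) * (ennreal c * ?N h)"
    by (intro add_left_mono mult_left_mono Ng) auto
  also have "\<dots> = ?N h + ennreal c * ?N u"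
    using c by (simp add: mult.assoc[symmetric] ennreal_mult[symmetric] add.commute)
  finally have "?N h \<le> ennreal c * ?N u"
    using fin by (subst (asm) ennreal_add_left_cancel_le) auto
  then show ?thesis by (simp add: h_def c_def)
qed

text \<open>The admissible constants are stable under \<open>Q \<mapsto> 2 * D * sqrt Q\<close>,
  whose positive fixed point is \<open>4 * D^2\<close>; picking an admissible \<open>Q\<close> below
  twice the infimum costs the further factor 2. The bound \<open>B\<close> and the finite mass only
  ensure that some constant is admissible. They do not enter the result, so the kernel may be as
  rough as that of a linearised maximal operator.\<close>

lemma TT_star:
  fixes k :: "'a \<Rightarrow> 'a \<Rightarrow> ennreal"
  assumes M: "finite_measure M"
    and k[measurable]: "(\<lambda>(x, y). k x y) \<in> borel_measurable (M \<Otimes>\<^sub>M M)"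
    and D: "0 < D"
    and quasi: "\<And>x x'. x \<in> space M \<Longrightarrow> x' \<in> space M \<Longrightarrow>
      (\<integral>\<^sup>+y. k x y * k x' y \<partial>M) \<le> ennreal D * (k x x' + k x' x)"
    and bdd: "\<And>x y. x \<in> space M \<Longrightarrow> y \<in> space M \<Longrightarrow> k x y \<le> ennreal B"
    and u[measurable]: "u \<in> borel_measurable M"
  shows "(\<integral>\<^sup>+x. (\<integral>\<^sup>+y. k x y * u y \<partial>M)\<^sup>2 \<partial>M) \<le> ennreal (8 * D\<^sup>2) * (\<integral>\<^sup>+x. (u x)\<^sup>2 \<partial>M)"
proof -
  interpret finite_measure M by fact
  define S where "S = {Q. 0 < Q \<and> (\<forall>u\<in>borel_measurable M.
      (\<integral>\<^sup>+x. (\<integral>\<^sup>+y. k x y * u y \<partial>M)\<^sup>2 \<partial>M) \<le> ennreal Q * (\<integral>\<^sup>+x. (u x)\<^sup>2 \<partial>M))}"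
  define m where "m = measure M (space M)"
  have em: "emeasure M (space M) = ennreal m" by (simp add: emeasure_eq_measure m_def)
  have ne: "(max B 0)\<^sup>2 * m\<^sup>2 + 1 \<in> S"
    unfolding S_def
  proof (intro CollectI conjI ballI)
    show "0 < (max B 0)\<^sup>2 * m\<^sup>2 + 1" by (rule add_nonneg_pos) auto
    fix u :: "'a \<Rightarrow> ennreal" assume u[measurable]: "u \<in> borel_measurable M"
    have "(\<integral>\<^sup>+x. (\<integral>\<^sup>+y. k x y * u y \<partial>M)\<^sup>2 \<partial>M) \<le> (\<integral>\<^sup>+x. (\<integral>\<^sup>+y. (k x y)\<^sup>2 \<partial>M) * (\<integral>\<^sup>+y. (u y)\<^sup>2 \<partial>M) \<partial>M)"
      by (intro nn_integral_mono nn_integral_Cauchy_Schwarz) measurable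
    also have "\<dots> \<le> (\<integral>\<^sup>+x. (\<integral>\<^sup>+y. (ennreal (max B 0))\<^sup>2 \<partial>M) * (\<integral>\<^sup>+y. (u y)\<^sup>2 \<partial>M) \<partial>M)"
      by (intro nn_integral_mono mult_right_mono power_mono order_trans[OF bdd ennreal_leI]) auto
    also have "\<dots> = ennreal ((max B 0)\<^sup>2 * m\<^sup>2) * (\<integral>\<^sup>+y. (u y)\<^sup>2 \<partial>M)"
      by (simp add: em ennreal_power ennreal_mult power2_eq_square mult_ac m_def)
    also have "\<dots> \<le> ennreal ((max B 0)\<^sup>2 * m\<^sup>2 + 1) * (\<integral>\<^sup>+y. (u y)\<^sup>2 \<partial>M)"
      by (intro mult_right_mono ennreal_leI) auto
    finally show "(\<integral>\<^sup>+x. (\<integral>\<^sup>+y. k x y * u y \<partial>M)\<^sup>2 \<partial>M)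
      \<le> ennreal ((max B 0)\<^sup>2 * m\<^sup>2 + 1) * (\<integral>\<^sup>+x. (u x)\<^sup>2 \<partial>M)" .
  qed
  have step: "2 * D * sqrt Q \<in> S" if "Q \<in> S" for Q
    using that D TT_star_improve[OF sigma_finite_measure_axioms k D quasi, of Q] by (simp add: S_def)
  have "\<exists>Q\<in>S. Q < 8 * D\<^sup>2"
  proof (rule ccontr)
    assume "\<not> ?thesis"
    then have ge: "8 * D\<^sup>2 \<le> Q" if "Q \<in> S" for Q using that by force
    then have I: "8 * D\<^sup>2 \<le> Inf S" using ne by (intro cInf_greatest) auto
    have "0 < 8 * D\<^sup>2" using D by simp
    then have Ipos: "0 < Inf S" using I by linarith
    have bb: "bdd_below S" using ge by (intro bdd_belowI)
    obtain Q where Q: "Q \<in> S" "Q < 2 * Inf S"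
      using cInf_lessD[of S "2 * Inf S"] ne Ipos by auto
    have "Inf S \<le> 2 * D * sqrt Q" by (rule cInf_lower[OF step[OF Q(1)] bb])
    then have "(Inf S)\<^sup>2 \<le> (2 * D * sqrt Q)\<^sup>2" using Ipos by (intro power_mono) auto
    also have "\<dots> = 4 * D\<^sup>2 * Q" using Q(1) by (simp add: S_def power_mult_distrib)
    also have "\<dots> < 4 * D\<^sup>2 * (2 * Inf S)" using D Q by simp
    also have "\<dots> = 8 * D\<^sup>2 * Inf S" by simp
    finally have "Inf S < 8 * D\<^sup>2" using Ipos by (simp add: power2_eq_square)
    then show False using I by simp
  qed
  then obtain Q where Q: "Q \<in> S" "Q < 8 * D\<^sup>2" by blast
  have "(\<integral>\<^sup>+x. (\<integral>\<^sup>+y. k x y * u y \<partial>M)\<^sup>2 \<partial>M) \<le> ennreal Q * (\<integral>\<^sup>+x. (u x)\<^sup>2 \<partial>M)"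
    using Q u by (auto simp: S_def)
  also have "\<dots> \<le> ennreal (8 * D\<^sup>2) * (\<integral>\<^sup>+x. (u x)\<^sup>2 \<partial>M)"
    using Q by (intro mult_right_mono ennreal_leI) auto
  finally show ?thesis .
qed

text \<open>Linearisation of the maximum: the least maximising index \<open>\<sigma> x\<close> is
  measurable and gives the single kernel \<open>k (\<sigma> x) x y\<close>. The hypothesis
  \<open>quasi\<close> speaks of two indices because \<open>\<sigma> x\<close> and
  \<open>\<sigma> x'\<close> are unrelated.\<close>

lemma maximal_kernel_bound:
  fixes k :: "nat \<Rightarrow> 'a \<Rightarrow> 'a \<Rightarrow> ennreal"
  assumes M: "finite_measure M"
    and k[measurable]: "\<And>i. (\<lambda>(x, y). k i x y) \<in> borel_measurable (M \<Otimes>\<^sub>M M)"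
    and D: "0 < D"
    and quasi: "\<And>i j x x'. x \<in> space M \<Longrightarrow> x' \<in> space M \<Longrightarrow>
      (\<integral>\<^sup>+y. k i x y * k j x' y \<partial>M) \<le> ennreal D * (k i x x' + k j x' x)"
    and bdd: "\<And>i x y. i \<le> J \<Longrightarrow> x \<in> space M \<Longrightarrow> y \<in> space M \<Longrightarrow> k i x y \<le> ennreal B"
    and u[measurable]: "u \<in> borel_measurable M"
    and V: "\<And>x. x \<in> space M \<Longrightarrow> \<exists>i\<le>J. V x \<le> (\<integral>\<^sup>+y. k i x y * u y \<partial>M)"
  shows "(\<integral>\<^sup>+x. (V x)\<^sup>2 \<partial>M) \<le> ennreal (8 * D\<^sup>2) * (\<integral>\<^sup>+x. (u x)\<^sup>2 \<partial>M)"
proof -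
  interpret finite_measure M by fact
  define v where "v i x = (\<integral>\<^sup>+y. k i x y * u y \<partial>M)" for i x
  have v[measurable]: "v i \<in> borel_measurable M" for i unfolding v_def by measurable
  define \<sigma> where "\<sigma> x = (LEAST i. i \<le> J \<and> (\<forall>j\<in>{..J}. v j x \<le> v i x))" for x
  have \<sigma>[measurable]: "\<sigma> \<in> measurable M (count_space UNIV)"
    unfolding \<sigma>_def by measurable
  have \<sigma>_max: "\<sigma> x \<le> J \<and> (\<forall>j\<in>{..J}. v j x \<le> v (\<sigma> x) x)" for x
  proof -
    have "Max ((\<lambda>i. v i x) ` {..J}) \<in> (\<lambda>i. v i x) ` {..J}" by (intro Max_in) auto
    then obtain i where "Max ((\<lambda>i. v i x) ` {..J}) = v i x" "i \<in> {..J}" by (rule imageE)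
    moreover have "v j x \<le> Max ((\<lambda>i. v i x) ` {..J})" if "j \<in> {..J}" for j
      using that by (intro Max_ge) auto
    ultimately have "i \<le> J \<and> (\<forall>j\<in>{..J}. v j x \<le> v i x)" by auto
    then show ?thesis unfolding \<sigma>_def by (rule LeastI)
  qed
  have meas: "(\<lambda>(x, y). k (\<sigma> x) x y) \<in> borel_measurable (M \<Otimes>\<^sub>M M)"
  proof -
    have "(\<lambda>z. (\<lambda>(x, y). k (\<sigma> (fst z)) x y) z) \<in> borel_measurable (M \<Otimes>\<^sub>M M)"
      by (rule measurable_compose_countable[OF k]) measurable
    then show ?thesis by (simp add: case_prod_beta')
  qed
  have "(\<integral>\<^sup>+x. (V x)\<^sup>2 \<partial>M) \<le> (\<integral>\<^sup>+x. (v (\<sigma> x) x)\<^sup>2 \<partial>M)"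
  proof (intro nn_integral_mono power_mono)
    fix x assume "x \<in> space M"
    then obtain i where "i \<le> J" "V x \<le> v i x" using V unfolding v_def by blast
    then show "V x \<le> v (\<sigma> x) x" using \<sigma>_max[of x] by (auto intro: order_trans)
  qed auto
  also have "\<dots> \<le> ennreal (8 * D\<^sup>2) * (\<integral>\<^sup>+x. (u x)\<^sup>2 \<partial>M)"
    unfolding v_def using \<sigma>_max by (intro TT_star[OF M meas D quasi, where B = B] bdd u) auto
  finally show ?thesis .
qed

section \<open>Dyadic means on the circle\<close>

definition circle_measure :: "real measure" where
  "circle_measure = restrict_space lborel {0..2*pi}"

lemma space_circle_measure [simp]: "space circle_measure = {0..2*pi}"
  by (simp add: circle_measure_def space_restrict_space)

lemma finite_measure_circle_measure: "finite_measure circle_measure"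
  unfolding circle_measure_def
  by (intro finite_measureI) (simp add: emeasure_restrict_space)

lemma measurable_circle_measure:
  fixes f :: "real \<Rightarrow> 'b::topological_space"
  assumes "continuous_on {0..2*pi} f"
  shows "f \<in> borel_measurable circle_measure"
  using borel_measurable_continuous_on_restrict[OF assms]
  unfolding circle_measure_def by (simp cong: measurable_cong_sets)

lemma nn_integral_circle_measure:
  fixes f :: "real \<Rightarrow> real"
  assumes f: "continuous_on {0..2*pi} f" and nonneg: "\<And>t. t \<in> {0..2*pi} \<Longrightarrow> 0 \<le> f t"
  shows "(\<integral>\<^sup>+t. ennreal (f t) \<partial>circle_measure) = ennreal (integral {0..2*pi} f)"
proof -
  have "(f has_integral integral {0..2*pi} f) {0..2*pi}"
    using integrable_continuous_interval[OF f] by (rule integrable_integral)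
  from nn_integral_has_integral_lebesgue'[OF nonneg this]
  show ?thesis unfolding circle_measure_def by (subst nn_integral_restrict_space) auto
qed

text \<open>Comparable with the Poisson kernel at distance \<open>h\<close> from the circle. The
  chord \<open>norm (cis s - cis t)\<close> respects periodicity and makes the kernel symmetric in
  \<open>s\<close> and \<open>t\<close>.\<close>

definition arc_kernel :: "real \<Rightarrow> real \<Rightarrow> real \<Rightarrow> real" where
  "arc_kernel h s t = h / (h\<^sup>2 + (norm (cis s - cis t))\<^sup>2)"

lemma arc_kernel_denominator_pos: "0 < h \<Longrightarrow> 0 < h\<^sup>2 + (norm (cis s - cis t))\<^sup>2"
  by (intro add_pos_nonneg) auto

lemma arc_kernel_nonneg: "0 < h \<Longrightarrow> 0 \<le> arc_kernel h s t"
  unfolding arc_kernel_def using arc_kernel_denominator_pos[of h s t] by simp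

lemma arc_kernel_le: "0 < h \<Longrightarrow> arc_kernel h s t \<le> 1 / h"
  unfolding arc_kernel_def using arc_kernel_denominator_pos[of h s t]
  by (simp add: divide_simps power2_eq_square)

lemma arc_kernel_compare:
  assumes "0 < h" "0 < h'" "0 \<le> c" "h * (h'\<^sup>2 + (norm (cis s' - cis t'))\<^sup>2) \<le> c * h' * (h\<^sup>2 + (norm (cis s - cis t))\<^sup>2)"
  shows "arc_kernel h s t \<le> c * arc_kernel h' s' t'"
  unfolding arc_kernel_def
  using arc_kernel_denominator_pos[OF assms(1), of s t] arc_kernel_denominator_pos[OF assms(2), of s' t'] assms(4)
  by (simp add: divide_simps mult_ac)

lemma continuous_on_arc_kernel: "0 < h \<Longrightarrow> continuous_on S (arc_kernel h s)"
  unfolding arc_kernel_def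
  by (intro continuous_intros) (use arc_kernel_denominator_pos[of h s] in \<open>auto simp: less_le\<close>)

lemma measurable_arc_kernel [measurable]: "case_prod (arc_kernel h) \<in> borel_measurable (borel \<Otimes>\<^sub>M borel)"
proof -
  have [measurable]: "cis \<in> borel_measurable borel"
    by (intro borel_measurable_continuous_onI continuous_intros)
  show ?thesis unfolding arc_kernel_def case_prod_beta' by measurable
qed

lemma measurable_arc_kernel_circle:
  "(\<lambda>(x, y). ennreal (arc_kernel h x y)) \<in> borel_measurable (circle_measure \<Otimes>\<^sub>M circle_measure)"
proof -
  have id: "(\<lambda>x. x) \<in> borel_measurable circle_measure"
    by (intro measurable_circle_measure continuous_intros)
  have "(\<lambda>p. (fst p, snd p)) \<in> measurable (circle_measure \<Otimes>\<^sub>M circle_measure) (borel \<Otimes>\<^sub>M borel)"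
    using measurable_compose[OF measurable_fst id] measurable_compose[OF measurable_snd id] by measurable
  from measurable_compose[OF this measurable_arc_kernel[of h]]
  show ?thesis by (simp add: case_prod_beta')
qed

lemma power2_double: "(2 * x)\<^sup>2 = 4 * (x\<^sup>2 :: real)"
  by (simp add: power_mult_distrib)

lemma norm_add_square_le: "(norm (a + b :: complex))\<^sup>2 \<le> 2 * (norm a)\<^sup>2 + 2 * (norm b)\<^sup>2"
proof -
  have "(norm (a + b))\<^sup>2 \<le> (norm a + norm b)\<^sup>2" by (intro power_mono norm_triangle_ineq) auto
  also have "\<dots> \<le> 2 * (norm a)\<^sup>2 + 2 * (norm b)\<^sup>2"
    using zero_le_power2[of "norm a - norm b"] by (simp add: power2_eq_square algebra_simps)
  finally show ?thesis .
qed

text \<open>With \<open>d\<close> the chord, \<open>norm (cis t - z)\<close> squared is at most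
  \<open>2 * (h^2 + d^2)\<close>, and \<open>h \<le> 1 - (1 - h)^2\<close> for
  \<open>h \<le> 1\<close>. The normalisation of the Poisson kernel then yields the mass bound
  \<open>4 * pi\<close> for the arc kernel.\<close>

lemma arc_kernel_le_poisson_kernel:
  assumes h: "0 < h" "h \<le> 1"
  shows "arc_kernel h s t \<le> 2 * poisson_kernel (of_real (1 - h) * cis s) t"
proof -
  define z where "z = of_real (1 - h) * cis s"
  have nz: "norm z = 1 - h" unfolding z_def norm_mult norm_of_real using h by simp
  have pos: "0 < (norm (cis t - z))\<^sup>2"
    using cis_neq_of_norm_less[of z t] nz h by simp
  have "cis t - z = (cis t - cis s) + of_real h * cis s" by (simp add: z_def algebra_simps)
  then have "(norm (cis t - z))\<^sup>2 \<le> 2 * (norm (cis t - cis s))\<^sup>2 + 2 * (norm (of_real h * cis s))\<^sup>2"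
    by (simp only: norm_add_square_le)
  also have "\<dots> = 2 * (h\<^sup>2 + (norm (cis s - cis t))\<^sup>2)"
    using h by (simp add: norm_mult norm_minus_commute)
  finally have le: "(norm (cis t - z))\<^sup>2 \<le> 2 * (h\<^sup>2 + (norm (cis s - cis t))\<^sup>2)" .
  have "arc_kernel h s t = 2 * (h / (2 * (h\<^sup>2 + (norm (cis s - cis t))\<^sup>2)))"
    unfolding arc_kernel_def times_divide_eq_right by (rule mult_divide_mult_cancel_left[symmetric]) simp
  also have "\<dots> \<le> 2 * (h / (norm (cis t - z))\<^sup>2)"
    by (intro mult_left_mono frac_le pos le) (use h in auto)
  also have "\<dots> \<le> 2 * ((1 - (norm z)\<^sup>2) / (norm (cis t - z))\<^sup>2)"
    using h by (intro mult_left_mono divide_right_mono) (auto simp: nz power2_eq_square algebra_simps mult_left_le)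
  finally show ?thesis unfolding poisson_kernel_def z_def .
qed

lemma nn_integral_arc_kernel:
  assumes h: "0 < h" "h \<le> 1"
  shows "(\<integral>\<^sup>+t. ennreal (arc_kernel h s t) \<partial>circle_measure) \<le> ennreal (4 * pi)"
proof -
  define z where "z = of_real (1 - h) * cis s"
  have nz: "norm z < 1" unfolding z_def norm_mult norm_of_real using h by simp
  have "(\<integral>\<^sup>+t. ennreal (arc_kernel h s t) \<partial>circle_measure) \<le> (\<integral>\<^sup>+t. ennreal (2 * poisson_kernel z t) \<partial>circle_measure)"
    unfolding z_def by (intro nn_integral_mono ennreal_leI arc_kernel_le_poisson_kernel h)
  also have "\<dots> = ennreal (integral {0..2*pi} (\<lambda>t. 2 * poisson_kernel z t))"
    using poisson_kernel_nonneg[OF nz]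
    by (intro nn_integral_circle_measure continuous_intros continuous_on_poisson_kernel nz) auto
  also have "integral {0..2*pi} (\<lambda>t. 2 * poisson_kernel z t) = 4 * pi"
    by (simp add: integral_poisson_kernel[OF nz])
  finally show ?thesis .
qed

text \<open>\<open>H\<close> is only comparable with \<open>1 - r\<close>, so that one dyadic kernel
  serves a whole annulus. With \<open>h = 1 - r\<close> the bounds
  \<open>1 - r^2 \<le> 2 * h\<close> and \<open>H^2 + d^2 \<le> 20 * N^2\<close> give the constant
  40, rounded up to 64.\<close>

lemma poisson_kernel_le_arc_kernel:
  assumes r: "0 \<le> r" "r < 1" and H: "1 - r \<le> H" "H \<le> 2 * (1 - r)"
  shows "poisson_kernel (of_real r * cis s) t \<le> 64 * arc_kernel H s t"
proof -
  define h where "h = 1 - r"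
  have h: "0 < h" "h \<le> 1" "h \<le> H" "H \<le> 2 * h" using r H by (auto simp: h_def)
  define d where "d = norm (cis s - cis t)"
  define N where "N = norm (cis t - of_real r * cis s)"
  have "1 - r \<le> N"
    using norm_triangle_ineq2[of "cis t" "of_real r * cis s"] r by (simp add: N_def norm_mult)
  then have hN: "h \<le> N" by (simp add: h_def)
  have "cis s - cis t = of_real h * cis s + (of_real r * cis s - cis t)" by (simp add: h_def algebra_simps)
  then have "d \<le> norm (of_real h * cis s) + norm (of_real r * cis s - cis t)"
    unfolding d_def by (metis norm_triangle_ineq)
  then have "d \<le> h + N" using h by (simp add: norm_mult N_def norm_minus_commute)
  then have dN: "d \<le> 2 * N" using hN by simp
  have d0: "0 \<le> d" by (simp add: d_def)
  have "h\<^sup>2 \<le> N\<^sup>2" "d\<^sup>2 \<le> (2 * N)\<^sup>2"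
    using power_mono[OF hN, of 2] power_mono[OF dN d0, of 2] h by auto
  then have N2: "h\<^sup>2 + d\<^sup>2 \<le> 5 * N\<^sup>2" by (simp add: power_mult_distrib)
  have "H\<^sup>2 \<le> 4 * h\<^sup>2"
    unfolding power2_double[symmetric] using h by (intro power_mono) auto
  moreover have "d\<^sup>2 \<le> 4 * d\<^sup>2" by simp
  ultimately have "H\<^sup>2 + d\<^sup>2 \<le> 4 * h\<^sup>2 + 4 * d\<^sup>2" by (rule add_mono)
  then have H2: "H\<^sup>2 + d\<^sup>2 \<le> 4 * (h\<^sup>2 + d\<^sup>2)" by (simp only: distrib_left)
  have pos: "0 < H\<^sup>2 + d\<^sup>2" "0 < N\<^sup>2" using h hN by (auto intro!: add_pos_nonneg)
  have "poisson_kernel (of_real r * cis s) t = (1 - r\<^sup>2) / N\<^sup>2"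
    using r by (simp add: poisson_kernel_def N_def norm_mult)
  also have "\<dots> \<le> 2 * h / N\<^sup>2"
    using r zero_le_power2[of "1 - r"] by (intro divide_right_mono) (auto simp: h_def power2_eq_square algebra_simps)
  also have "\<dots> \<le> 64 * (H / (H\<^sup>2 + d\<^sup>2))"
  proof -
    have "2 * h * (H\<^sup>2 + d\<^sup>2) \<le> 2 * H * (20 * N\<^sup>2)"
      using h N2 H2 pos by (intro mult_mono) auto
    also have "\<dots> \<le> 64 * H * N\<^sup>2" using h pos by simp
    finally show ?thesis using pos by (simp add: divide_simps mult_ac)
  qed
  finally show ?thesis by (simp add: arc_kernel_def d_def)
qed

text \<open>Either \<open>y\<close> is far from \<open>x\<close> or far from \<open>x'\<close>, so one factor of the product is
  comparable with its value at \<open>(x, x')\<close>.\<close>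

lemma nn_integral_arc_kernel_mult:
  assumes h: "0 < h" "h \<le> 1" and h': "0 < h'" "h' \<le> 1"
  shows "(\<integral>\<^sup>+y. ennreal (arc_kernel h x y) * ennreal (arc_kernel h' x' y) \<partial>circle_measure)
    \<le> ennreal (16 * pi) * (ennreal (arc_kernel h x x') + ennreal (arc_kernel h' x' x))"
proof -
  \<comment> \<open>The factor 2 between the chords is squared, hence 4; together with the mass
    \<open>4 * pi\<close> it produces the \<open>16 * pi\<close> of the lemma.\<close>
  have far: "arc_kernel h x y \<le> 4 * arc_kernel h x x'"
    if "0 < h" "norm (cis x - cis x') \<le> 2 * norm (cis x - cis y)" for h x y x'
  proof (rule arc_kernel_compare)
    have "(norm (cis x - cis x'))\<^sup>2 \<le> (2 * norm (cis x - cis y))\<^sup>2"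
      using that by (intro power_mono) auto
    then have "h\<^sup>2 + (norm (cis x - cis x'))\<^sup>2 \<le> 4 * h\<^sup>2 + 4 * (norm (cis x - cis y))\<^sup>2"
      using zero_le_power2[of h] power2_double[of "norm (cis x - cis y)"] by linarith
    then have "h * (h\<^sup>2 + (norm (cis x - cis x'))\<^sup>2) \<le> h * (4 * h\<^sup>2 + 4 * (norm (cis x - cis y))\<^sup>2)"
      using that by (intro mult_left_mono) auto
    then show "h * (h\<^sup>2 + (norm (cis x - cis x'))\<^sup>2) \<le> 4 * h * (h\<^sup>2 + (norm (cis x - cis y))\<^sup>2)"
      by (simp add: algebra_simps)
  qed (use that in auto)
  have pt: "arc_kernel h x y * arc_kernel h' x' y
      \<le> 4 * arc_kernel h x x' * arc_kernel h' x' y + 4 * arc_kernel h' x' x * arc_kernel h x y" for y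
  proof -
    note nn = arc_kernel_nonneg[OF h(1)] arc_kernel_nonneg[OF h'(1)]
    have "norm (cis x - cis x') \<le> norm (cis x - cis y) + norm (cis x' - cis y)"
      using norm_triangle_ineq4[of "cis x - cis y" "cis x' - cis y"] by simp
    then consider "norm (cis x - cis x') \<le> 2 * norm (cis x - cis y)"
      | "norm (cis x' - cis x) \<le> 2 * norm (cis x' - cis y)"
      by (fastforce simp: norm_minus_commute)
    then show ?thesis
    proof cases
      case 1
      from mult_right_mono[OF far[OF h(1) this] nn(2)[of x' y]]
      show ?thesis using mult_nonneg_nonneg[OF nn(2)[of x' x] nn(1)[of x y]] by simp
    next
      case 2
      from mult_right_mono[OF far[OF h'(1) this] nn(1)[of x y]]
      show ?thesis using mult_nonneg_nonneg[OF nn(1)[of x x'] nn(2)[of x' y]] by (simp add: mult_ac)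
    qed
  qed
  have meas: "(\<lambda>y. ennreal (arc_kernel h x y)) \<in> borel_measurable circle_measure" if "0 < h" for h x
    using measurable_circle_measure[OF continuous_on_arc_kernel[OF that]] by measurable
  have "(\<integral>\<^sup>+y. ennreal (arc_kernel h x y) * ennreal (arc_kernel h' x' y) \<partial>circle_measure)
    \<le> (\<integral>\<^sup>+y. ennreal (4 * arc_kernel h x x') * ennreal (arc_kernel h' x' y)
        + ennreal (4 * arc_kernel h' x' x) * ennreal (arc_kernel h x y) \<partial>circle_measure)"
  proof (intro nn_integral_mono)
    fix y
    show "ennreal (arc_kernel h x y) * ennreal (arc_kernel h' x' y) \<le> ennreal (4 * arc_kernel h x x') * ennreal (arc_kernel h' x' y)
        + ennreal (4 * arc_kernel h' x' x) * ennreal (arc_kernel h x y)"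
      using pt[of y] arc_kernel_nonneg[OF h(1)] arc_kernel_nonneg[OF h'(1)]
      by (simp add: ennreal_mult[symmetric] ennreal_plus[symmetric] ennreal_leI del: ennreal_plus)
  qed
  also have "\<dots> = ennreal (4 * arc_kernel h x x') * (\<integral>\<^sup>+y. ennreal (arc_kernel h' x' y) \<partial>circle_measure)
     + ennreal (4 * arc_kernel h' x' x) * (\<integral>\<^sup>+y. ennreal (arc_kernel h x y) \<partial>circle_measure)"
    using meas[OF h(1)] meas[OF h'(1)] by (simp add: nn_integral_add nn_integral_cmult)
  also have "\<dots> \<le> ennreal (4 * arc_kernel h x x') * ennreal (4 * pi) + ennreal (4 * arc_kernel h' x' x) * ennreal (4 * pi)"
    by (intro add_mono mult_left_mono nn_integral_arc_kernel h h') auto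
  also have "\<dots> = ennreal (16 * pi) * (ennreal (arc_kernel h x x') + ennreal (arc_kernel h' x' x))"
    using arc_kernel_nonneg[OF h(1)] arc_kernel_nonneg[OF h'(1)]
    by (simp add: ennreal_mult[symmetric] ennreal_plus[symmetric] algebra_simps del: ennreal_plus)
  finally show ?thesis .
qed

text \<open>The mean \<open>v j\<close> of the overview, left unnormalised: its kernel has mass at
  most \<open>4 * pi\<close>.\<close>

definition dyadic_mean :: "(real \<Rightarrow> real) \<Rightarrow> nat \<Rightarrow> real \<Rightarrow> real" where
  "dyadic_mean u j x = integral {0..2*pi} (\<lambda>y. arc_kernel ((1/2)^j) x y * u y)"

context
  fixes u :: "real \<Rightarrow> real"
  assumes u: "continuous_on {0..2*pi} u" and u_nonneg: "\<And>x. 0 \<le> u x"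
begin

lemma nn_integral_dyadic_mean:
  "ennreal (dyadic_mean u j x) = (\<integral>\<^sup>+y. ennreal (arc_kernel ((1/2)^j) x y) * ennreal (u y) \<partial>circle_measure)"
proof -
  have "(\<integral>\<^sup>+y. ennreal (arc_kernel ((1/2)^j) x y * u y) \<partial>circle_measure) = ennreal (dyadic_mean u j x)"
    unfolding dyadic_mean_def
    by (intro nn_integral_circle_measure continuous_intros continuous_on_arc_kernel u
      mult_nonneg_nonneg arc_kernel_nonneg u_nonneg) auto
  then show ?thesis using arc_kernel_nonneg[of "(1/2)^j"] u_nonneg by (simp add: ennreal_mult)
qed

lemma integrable_dyadic_mean: "(\<lambda>y. arc_kernel ((1/2)^j) x y * u y) integrable_on {0..2*pi}"
  by (intro integrable_continuous_interval continuous_intros continuous_on_arc_kernel u) auto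

lemma dyadic_mean_nonneg: "0 \<le> dyadic_mean u j x"
  unfolding dyadic_mean_def
  by (intro integral_nonneg integrable_dyadic_mean mult_nonneg_nonneg arc_kernel_nonneg u_nonneg) auto

text \<open>Moving the centre by at most the scale \<open>h\<close> changes the denominator of the
  kernel by a factor of at most 3, by the quadratic triangle inequality
  \<open>norm_add_square_le\<close>.\<close>

lemma dyadic_mean_Harnack:
  assumes "norm (cis x - cis x') \<le> (1/2)^j"
  shows "dyadic_mean u j x \<le> 3 * dyadic_mean u j x'"
proof -
  have "arc_kernel ((1/2)^j) x y \<le> 3 * arc_kernel ((1/2)^j) x' y" for y
  proof (rule arc_kernel_compare)
    define h where "h = (1/2::real)^j"
    have "(norm (cis x' - cis x))\<^sup>2 \<le> h\<^sup>2"
      using assms by (intro power_mono) (auto simp: h_def norm_minus_commute)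
    moreover have "(norm (cis x' - cis y))\<^sup>2 \<le> 2 * (norm (cis x' - cis x))\<^sup>2 + 2 * (norm (cis x - cis y))\<^sup>2"
      using norm_add_square_le[of "cis x' - cis x" "cis x - cis y"] by simp
    ultimately have "(norm (cis x' - cis y))\<^sup>2 \<le> 2 * h\<^sup>2 + 3 * (norm (cis x - cis y))\<^sup>2"
      using zero_le_power2[of "norm (cis x - cis y)"] by linarith
    then have "h * (h\<^sup>2 + (norm (cis x' - cis y))\<^sup>2) \<le> h * (3 * h\<^sup>2 + 3 * (norm (cis x - cis y))\<^sup>2)"
      by (intro mult_left_mono) (auto simp: h_def)
    then show "(1/2)^j * (((1/2)^j)\<^sup>2 + (norm (cis x' - cis y))\<^sup>2) \<le> 3 * (1/2)^j * (((1/2)^j)\<^sup>2 + (norm (cis x - cis y))\<^sup>2)"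
      unfolding h_def[symmetric] by (simp add: algebra_simps)
  qed auto
  then have "dyadic_mean u j x \<le> integral {0..2*pi} (\<lambda>y. 3 * (arc_kernel ((1/2)^j) x' y * u y))"
    unfolding dyadic_mean_def
    by (intro integral_le integrable_dyadic_mean integrable_on_mult_right)
      (metis mult.assoc mult_right_mono u_nonneg)
  then show ?thesis by (simp add: dyadic_mean_def)
qed

lemma nn_integral_u_square: "(\<integral>\<^sup>+y. (ennreal (u y))\<^sup>2 \<partial>circle_measure) = ennreal (integral {0..2*pi} (\<lambda>y. (u y)\<^sup>2))"
  by (subst nn_integral_circle_measure[symmetric]) (auto intro!: continuous_intros u simp: ennreal_power u_nonneg)

text \<open>Cauchy-Schwarz: the kernel is at most \<open>2^j\<close> with mass at most
  \<open>4 * pi\<close>, so its square integrates to at most \<open>4 * pi * 2^j\<close>. This is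
  the growth bound that complements the maximal function.\<close>

lemma dyadic_mean_square_le:
  "(dyadic_mean u j x)\<^sup>2 \<le> 4 * pi * 2 ^ j * integral {0..2*pi} (\<lambda>y. (u y)\<^sup>2)"
proof -
  define h where "h = (1/2::real)^j"
  have h: "0 < h" "h \<le> 1" by (auto simp: h_def power_le_one)
  have [measurable]: "arc_kernel h x \<in> borel_measurable circle_measure" "u \<in> borel_measurable circle_measure"
    by (intro measurable_circle_measure continuous_on_arc_kernel u h)+
  have "ennreal ((dyadic_mean u j x)\<^sup>2) = (\<integral>\<^sup>+y. ennreal (arc_kernel h x y) * ennreal (u y) \<partial>circle_measure)\<^sup>2"
    unfolding h_def nn_integral_dyadic_mean[symmetric] by (simp add: ennreal_power dyadic_mean_nonneg)
  also have "\<dots> \<le> (\<integral>\<^sup>+y. (ennreal (arc_kernel h x y))\<^sup>2 \<partial>circle_measure) * (\<integral>\<^sup>+y. (ennreal (u y))\<^sup>2 \<partial>circle_measure)"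
    by (rule nn_integral_Cauchy_Schwarz) measurable
  also have "(\<integral>\<^sup>+y. (ennreal (arc_kernel h x y))\<^sup>2 \<partial>circle_measure) \<le> (\<integral>\<^sup>+y. ennreal (1 / h) * ennreal (arc_kernel h x y) \<partial>circle_measure)"
    unfolding power2_eq_square by (intro nn_integral_mono mult_right_mono ennreal_leI arc_kernel_le h) auto
  also have "\<dots> \<le> ennreal (1 / h) * ennreal (4 * pi)"
    by (subst nn_integral_cmult) (auto intro!: mult_left_mono nn_integral_arc_kernel h)
  finally have "ennreal ((dyadic_mean u j x)\<^sup>2) \<le> ennreal (1 / h) * ennreal (4 * pi) * ennreal (integral {0..2*pi} (\<lambda>y. (u y)\<^sup>2))"
    by (simp add: nn_integral_u_square mult_right_mono)
  also have "\<dots> = ennreal (1 / h * (4 * pi) * integral {0..2*pi} (\<lambda>y. (u y)\<^sup>2))"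
    using h ennreal_mult[of "1 / h" "4 * pi"]
    by (subst ennreal_mult) (auto intro!: integral_nonneg integrable_continuous_interval continuous_intros u)
  finally have "(dyadic_mean u j x)\<^sup>2 \<le> 1 / h * (4 * pi) * integral {0..2*pi} (\<lambda>y. (u y)\<^sup>2)"
    by (subst (asm) ennreal_le_iff)
      (use h in \<open>auto intro!: mult_nonneg_nonneg divide_nonneg_nonneg integral_nonneg integrable_continuous_interval continuous_intros u\<close>)
  then show ?thesis by (simp add: h_def power_divide mult_ac)
qed

text \<open>\<open>V\<close> is any function below the maximum of finitely many means, so the lemma
  covers both that maximum and the step function used for sums over scales. The constant is
  \<open>8 * (16 * pi)^2\<close> and does not involve \<open>J\<close>.\<close>

lemma maximal_dyadic_mean:
  assumes V: "\<And>x. x \<in> {0..2*pi} \<Longrightarrow> 0 \<le> V x \<and> (\<exists>i\<le>J. V x \<le> dyadic_mean u i x)"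
  shows "(\<integral>\<^sup>+x. ennreal ((V x)\<^sup>2) \<partial>circle_measure) \<le> ennreal (2048 * pi\<^sup>2 * integral {0..2*pi} (\<lambda>y. (u y)\<^sup>2))"
proof -
  have "(\<integral>\<^sup>+x. ennreal ((V x)\<^sup>2) \<partial>circle_measure) = (\<integral>\<^sup>+x. (ennreal (V x))\<^sup>2 \<partial>circle_measure)"
    using V by (intro nn_integral_cong) (simp add: ennreal_power)
  also have "\<dots> \<le> ennreal (8 * (16 * pi)\<^sup>2) * (\<integral>\<^sup>+y. (ennreal (u y))\<^sup>2 \<partial>circle_measure)"
  proof (rule maximal_kernel_bound[where J = J and B = "2 ^ J" and k = "\<lambda>i x y. ennreal (arc_kernel ((1/2)^i) x y)"])
    show "(\<integral>\<^sup>+y. ennreal (arc_kernel ((1/2)^i) x y) * ennreal (arc_kernel ((1/2)^j) x' y) \<partial>circle_measure)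
      \<le> ennreal (16 * pi) * (ennreal (arc_kernel ((1/2)^i) x x') + ennreal (arc_kernel ((1/2)^j) x' x))" for i j x x'
      by (intro nn_integral_arc_kernel_mult) (auto simp: power_le_one)
    show "ennreal (arc_kernel ((1/2)^i) x y) \<le> ennreal (2 ^ J)" if "i \<le> J" for i x y
    proof (rule ennreal_leI)
      have "arc_kernel ((1/2)^i) x y \<le> 1 / (1/2)^i" by (rule arc_kernel_le) auto
      also have "\<dots> = 2 ^ i" by (simp add: power_divide)
      also have "\<dots> \<le> 2 ^ J" using that by (intro power_increasing) auto
      finally show "arc_kernel ((1/2)^i) x y \<le> 2 ^ J" .
    qed
    show "(\<lambda>x. ennreal (u x)) \<in> borel_measurable circle_measure"
      using measurable_circle_measure[OF u] by measurable
    show "\<exists>i\<le>J. ennreal (V x) \<le> (\<integral>\<^sup>+y. ennreal (arc_kernel ((1/2)^i) x y) * ennreal (u y) \<partial>circle_measure)"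
      if "x \<in> space circle_measure" for x
      using V[of x] that unfolding nn_integral_dyadic_mean[symmetric] by (auto intro: ennreal_leI)
  qed (auto simp: finite_measure_circle_measure measurable_arc_kernel_circle)
  also have "\<dots> = ennreal (2048 * pi\<^sup>2 * integral {0..2*pi} (\<lambda>y. (u y)\<^sup>2))"
    by (simp add: nn_integral_u_square power_mult_distrib ennreal_mult')
  finally show ?thesis .
qed

end

section \<open>Geometric sums over dyadic scales\<close>

lemma sum_le_geometric:
  fixes q :: real
  assumes S: "finite S" and g: "inj_on g S" and le: "\<And>j. j \<in> S \<Longrightarrow> f j \<le> q ^ g j" and q: "0 \<le> q" "q < 1"
  shows "sum f S \<le> 1 / (1 - q)"
proof -
  have "sum f S \<le> (\<Sum>j\<in>S. q ^ g j)" by (intro sum_mono le)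
  also have "\<dots> = (\<Sum>i\<in>g ` S. q ^ i)" using g by (simp add: sum.reindex)
  also have "\<dots> \<le> (\<Sum>i. q ^ i)" using S q by (intro sum_le_suminf summable_geometric) auto
  also have "\<dots> = 1 / (1 - q)" using q by (intro suminf_geometric) auto
  finally show ?thesis .
qed

lemma half_power_powr:
  fixes a :: real
  shows "((1/2::real) ^ n) powr a = (2 powr (-a)) ^ n"
proof -
  have "((1/2::real) ^ n) powr a = (2 powr (- real n)) powr a"
    by (simp add: powr_minus powr_realpow power_divide divide_simps)
  also have "\<dots> = (2 powr (-a)) ^ n"
    by (simp add: powr_powr powr_power mult.commute)
  finally show ?thesis .
qed

text \<open>Counted from the first index with \<open>(1/2)^j < y\<close>, the terms are dominated by
  successive powers of \<open>2 powr (-a)\<close>; hence the bound is uniform in \<open>y\<close>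
  and \<open>J\<close>. In \<open>sum_dyadic_above\<close> the count runs downwards from the last
  index with \<open>y \<le> (1/2)^j\<close>.\<close>

lemma sum_dyadic_below:
  fixes a y :: real
  assumes a: "0 < a" and y: "0 < y"
  shows "(\<Sum>j | j \<le> J \<and> (1/2) ^ j < y. ((1/2) ^ j / y) powr a) \<le> 1 / (1 - 2 powr (-a))"
proof (cases "{j. j \<le> J \<and> (1/2) ^ j < y} = {}")
  case True
  then show ?thesis using a powr_less_mono[of "-a" 0 2] unfolding True by simp
next
  case False
  define S where "S = {j. j \<le> J \<and> (1/2) ^ j < y}"
  have S: "finite S" "S \<noteq> {}" using False by (auto simp: S_def)
  define m where "m = Min S"
  have m: "m \<in> S" "\<And>j. j \<in> S \<Longrightarrow> m \<le> j" using S by (auto simp: m_def)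
  have "(\<Sum>j\<in>S. ((1/2) ^ j / y) powr a) \<le> 1 / (1 - 2 powr (-a))"
  proof (rule sum_le_geometric[where g = "\<lambda>j. j - m"])
    show "inj_on (\<lambda>j. j - m) S"
    proof (rule inj_onI)
      fix i j assume "i \<in> S" "j \<in> S" "i - m = j - m"
      then show "i = j" using m(2)[of i] m(2)[of j] by linarith
    qed
    show "((1/2) ^ j / y) powr a \<le> (2 powr (-a)) ^ (j - m)" if j: "j \<in> S" for j
    proof -
      have "(1/2) ^ j = (1/2::real) ^ m * (1/2) ^ (j - m)"
        using m(2)[OF j] by (simp add: power_add[symmetric])
      also have "\<dots> \<le> y * (1/2) ^ (j - m)" using m(1) by (intro mult_right_mono) (auto simp: S_def)
      finally have "(1/2) ^ j / y \<le> (1/2) ^ (j - m)" using y by (simp add: divide_simps mult_ac)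
      then have "((1/2) ^ j / y) powr a \<le> ((1/2) ^ (j - m)) powr a"
        using a y by (intro powr_mono2) auto
      then show ?thesis by (simp only: half_power_powr)
    qed
    show "2 powr (-a) < 1" using a powr_less_mono[of "-a" 0 2] by simp
  qed (use S in auto)
  then show ?thesis by (simp add: S_def)
qed

lemma sum_dyadic_above:
  fixes a y :: real
  assumes a: "0 < a" and y: "0 < y"
  shows "(\<Sum>j | j \<le> J \<and> y \<le> (1/2) ^ j. (y / (1/2) ^ j) powr a) \<le> 1 / (1 - 2 powr (-a))"
proof (cases "{j. j \<le> J \<and> y \<le> (1/2) ^ j} = {}")
  case True
  then show ?thesis using a powr_less_mono[of "-a" 0 2] unfolding True by simp
next
  case False
  define S where "S = {j. j \<le> J \<and> y \<le> (1/2) ^ j}"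
  have S: "finite S" "S \<noteq> {}" using False by (auto simp: S_def)
  define m where "m = Max S"
  have m: "m \<in> S" "\<And>j. j \<in> S \<Longrightarrow> j \<le> m" using S by (auto simp: m_def)
  have "(\<Sum>j\<in>S. (y / (1/2) ^ j) powr a) \<le> 1 / (1 - 2 powr (-a))"
  proof (rule sum_le_geometric[where g = "\<lambda>j. m - j"])
    show "inj_on (\<lambda>j. m - j) S"
    proof (rule inj_onI)
      fix i j assume "i \<in> S" "j \<in> S" "m - i = m - j"
      then show "i = j" using m(2)[of i] m(2)[of j] by linarith
    qed
    show "(y / (1/2) ^ j) powr a \<le> (2 powr (-a)) ^ (m - j)" if j: "j \<in> S" for j
    proof -
      have "y \<le> (1/2) ^ m" using m(1) by (simp add: S_def)
      also have "\<dots> = (1/2::real) ^ j * (1/2) ^ (m - j)"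
        using m(2)[OF j] by (simp add: power_add[symmetric])
      finally have "y / (1/2) ^ j \<le> (1/2) ^ (m - j)" by (simp add: divide_simps mult_ac)
      then have "(y / (1/2) ^ j) powr a \<le> ((1/2) ^ (m - j)) powr a"
        using a y by (intro powr_mono2) auto
      then show ?thesis by (simp only: half_power_powr)
    qed
    show "2 powr (-a) < 1" using a powr_less_mono[of "-a" 0 2] by simp
  qed (use S in auto)
  then show ?thesis by (simp add: S_def)
qed

text \<open>The two terms in the minimum balance at \<open>2^(-j) = (B / W) powr (1 / (a + b))\<close>, and the
  sums on both sides of this index are geometric.\<close>

lemma sum_min_dyadic_le:
  fixes a b W B :: real
  assumes a: "0 < a" and b: "0 < b" and W: "0 \<le> W" and B: "0 \<le> B"
  shows "(\<Sum>j\<le>J. min (W * ((1/2) ^ j) powr a) (B * ((1/2) ^ j) powr (-b)))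
    \<le> (1 / (1 - 2 powr (-a)) + 1 / (1 - 2 powr (-b))) * (W powr (b / (a + b)) * B powr (a / (a + b)))"
proof (cases "W = 0 \<or> B = 0")
  case True
  have *: "2 powr (-c) < (1::real)" if "0 < c" for c :: real using powr_less_mono[of "-c" 0 2] that by simp
  have "(\<Sum>j\<le>J. min (W * ((1/2) ^ j) powr a) (B * ((1/2) ^ j) powr (-b))) = 0"
    using True W B by (intro sum.neutral) (auto simp: min_absorb1 min_absorb2)
  then show ?thesis using True *[OF a] *[OF b] by auto
next
  case False
  then have pos: "0 < W" "0 < B" using W B by auto
  define y where "y = (B / W) powr (1 / (a + b))"
  have y: "0 < y" using pos by (simp add: y_def)
  define E where "E = W powr (b / (a + b)) * B powr (a / (a + b))"
  have sab: "b / (a + b) = 1 - a / (a + b)" using a b by (simp add: field_simps)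
  have Wy: "W * y powr a = E"
    unfolding y_def E_def sab using pos by (simp add: powr_powr powr_divide powr_diff)
  have sab': "a / (a + b) = 1 - b / (a + b)" using a b by (simp add: field_simps)
  have By: "B * y powr (-b) = E"
    unfolding y_def E_def sab' using pos by (simp add: powr_powr powr_divide powr_diff powr_minus field_simps)
  have "(\<Sum>j\<le>J. min (W * ((1/2) ^ j) powr a) (B * ((1/2) ^ j) powr (-b)))
    \<le> (\<Sum>j | j \<le> J \<and> (1/2) ^ j < y. W * ((1/2) ^ j) powr a) + (\<Sum>j | j \<le> J \<and> y \<le> (1/2) ^ j. B * ((1/2) ^ j) powr (-b))"
  proof -
    have "{..J} = {j. j \<le> J \<and> (1/2) ^ j < y} \<union> {j. j \<le> J \<and> y \<le> (1/2) ^ j}" by auto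
    then have "(\<Sum>j\<le>J. min (W * ((1/2) ^ j) powr a) (B * ((1/2) ^ j) powr (-b)))
      = (\<Sum>j | j \<le> J \<and> (1/2) ^ j < y. min (W * ((1/2) ^ j) powr a) (B * ((1/2) ^ j) powr (-b)))
      + (\<Sum>j | j \<le> J \<and> y \<le> (1/2) ^ j. min (W * ((1/2) ^ j) powr a) (B * ((1/2) ^ j) powr (-b)))"
      by (simp only:) (rule sum.union_disjoint, auto)
    then show ?thesis by (simp only:) (intro add_mono sum_mono, auto)
  qed
  also have "(\<Sum>j | j \<le> J \<and> (1/2) ^ j < y. W * ((1/2) ^ j) powr a) = E * (\<Sum>j | j \<le> J \<and> (1/2) ^ j < y. ((1/2) ^ j / y) powr a)"
    unfolding Wy[symmetric] sum_distrib_left using y by (intro sum.cong) (simp_all add: powr_divide)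
  also have "(\<Sum>j | j \<le> J \<and> y \<le> (1/2) ^ j. B * ((1/2) ^ j) powr (-b)) = E * (\<Sum>j | j \<le> J \<and> y \<le> (1/2) ^ j. (y / (1/2) ^ j) powr b)"
    unfolding By[symmetric] sum_distrib_left using y by (intro sum.cong) (simp_all add: powr_divide powr_minus powr_mult field_simps)
  also have "E * (\<Sum>j | j \<le> J \<and> (1/2) ^ j < y. ((1/2) ^ j / y) powr a) + E * (\<Sum>j | j \<le> J \<and> y \<le> (1/2) ^ j. (y / (1/2) ^ j) powr b)
    \<le> E * (1 / (1 - 2 powr (-a))) + E * (1 / (1 - 2 powr (-b)))"
    using pos by (intro add_mono mult_left_mono sum_dyadic_below sum_dyadic_above a b y) (auto simp: E_def)
  also have "\<dots> = (1 / (1 - 2 powr (-a)) + 1 / (1 - 2 powr (-b))) * E" by (simp add: algebra_simps)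
  finally show ?thesis unfolding E_def .
qed

lemma norm_powr_le_dyadic_mean:
  assumes f: "f holomorphic_on ball 0 R" "1 < R" and p: "0 < p"
    and r: "0 \<le> r" "r < 1" and j: "(1/2) ^ Suc j \<le> 1 - r" "1 - r \<le> (1/2) ^ j"
  shows "norm (f (of_real r * cis x)) powr p \<le> 12 * dyadic_mean (\<lambda>t. norm (f (cis t)) powr p) j x"
proof -
  define u where "u t = norm (f (cis t)) powr p" for t
  have "continuous_on {0..2*pi} (\<lambda>t. f (cis t))"
    by (rule continuous_on_compose2[OF holomorphic_on_imp_continuous_on[OF f(1)]])
      (use f(2) in \<open>auto intro!: continuous_on_cis continuous_on_id\<close>)
  then have u: "continuous_on {0..2*pi} u"
    unfolding u_def using p by (intro continuous_on_powr' continuous_intros) auto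
  define z where "z = of_real r * cis x"
  have z: "norm z < 1" using r by (simp add: z_def norm_mult)
  have "2 * pi * norm (f z) powr p \<le> integral {0..2*pi} (\<lambda>t. poisson_kernel z t * u t)"
    using poisson_dominated_holomorphic[OF p f] z by (simp add: poisson_dominated_def u_def)
  also have "\<dots> \<le> integral {0..2*pi} (\<lambda>t. 64 * (arc_kernel ((1/2)^j) x t * u t))"
  proof (rule integral_le)
    show "(\<lambda>t. poisson_kernel z t * u t) integrable_on {0..2*pi}"
      by (intro integrable_continuous_interval continuous_intros continuous_on_poisson_kernel z u)
    show "(\<lambda>t. 64 * (arc_kernel ((1/2)^j) x t * u t)) integrable_on {0..2*pi}"
      by (intro integrable_continuous_interval continuous_intros continuous_on_arc_kernel u) auto
    fix t
    have "poisson_kernel z t \<le> 64 * arc_kernel ((1/2)^j) x t"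
      unfolding z_def using j r by (intro poisson_kernel_le_arc_kernel) auto
    from mult_right_mono[OF this, of "u t"]
    show "poisson_kernel z t * u t \<le> 64 * (arc_kernel ((1/2)^j) x t * u t)" by (simp add: u_def mult.assoc)
  qed
  also have "\<dots> = 64 * dyadic_mean u j x" by (simp add: dyadic_mean_def)
  finally have *: "2 * pi * norm (f z) powr p \<le> 64 * dyadic_mean u j x" .
  \<comment> \<open>Only \<open>pi > 3\<close> is used; the resulting constant \<open>64 / 6\<close>
    is rounded up to 12.\<close>
  have "6 * norm (f z) powr p \<le> 2 * pi * norm (f z) powr p"
    using pi_gt3 by (intro mult_right_mono) auto
  with * have "6 * norm (f z) powr p \<le> 64 * dyadic_mean u j x" by linarith
  moreover have "0 \<le> dyadic_mean u j x" by (rule dyadic_mean_nonneg[OF u]) (simp add: u_def)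
  ultimately show ?thesis unfolding z_def u_def[abs_def] by simp
qed

section \<open>Square sums of dyadic means over all scales\<close>

lemma norm_cis_diff_le: "norm (cis x - cis y) \<le> \<bar>x - y\<bar>"
proof -
  have "cis x - cis y = cis y * (cis (x - y) - 1)" by (simp add: algebra_simps cis_mult)
  then have "norm (cis x - cis y) = norm (exp (\<i> * of_real (x - y)) - 1)"
    by (simp add: norm_mult cis_conv_exp)
  also have "\<dots> = 2 * \<bar>sin ((x - y) / 2)\<bar>" by (rule dist_exp_i_1)
  also have "\<dots> \<le> \<bar>x - y\<bar>" using abs_sin_x_le_abs_x[of "(x - y) / 2"] by simp
  finally show ?thesis .
qed

text \<open>On the arc the kernel is at least \<open>1 / (2 * h)\<close>, so its mass bound
  \<open>4 * pi\<close> controls the length of the arc.\<close>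

lemma nn_integral_arc_le:
  assumes h: "0 < h" "h \<le> 1"
  shows "(\<integral>\<^sup>+t. (if norm (cis s - cis t) \<le> h then 1 else 0) \<partial>circle_measure) \<le> ennreal (8 * pi * h)"
proof -
  have [measurable]: "arc_kernel h s \<in> borel_measurable circle_measure"
    by (intro measurable_circle_measure continuous_on_arc_kernel h)
  have le: "1 \<le> 2 * h * arc_kernel h s t" if "norm (cis s - cis t) \<le> h" for t
  proof -
    have "(norm (cis s - cis t))\<^sup>2 \<le> h\<^sup>2" using that by (intro power_mono) auto
    then show ?thesis unfolding arc_kernel_def using arc_kernel_denominator_pos[OF h(1), of s t]
      by (simp add: divide_simps power2_eq_square)
  qed
  have "(\<integral>\<^sup>+t. (if norm (cis s - cis t) \<le> h then 1 else 0) \<partial>circle_measure)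
     \<le> (\<integral>\<^sup>+t. ennreal (2 * h) * ennreal (arc_kernel h s t) \<partial>circle_measure)"
  proof (intro nn_integral_mono)
    fix t show "(if norm (cis s - cis t) \<le> h then 1 else 0) \<le> ennreal (2 * h) * ennreal (arc_kernel h s t)"
      using le[of t] ennreal_leI[OF le, of t] h by (auto simp: ennreal_mult'[symmetric])
  qed
  also have "\<dots> = ennreal (2 * h) * (\<integral>\<^sup>+t. ennreal (arc_kernel h s t) \<partial>circle_measure)"
    by (intro nn_integral_cmult) measurable
  also have "\<dots> \<le> ennreal (2 * h) * ennreal (4 * pi)" by (intro mult_left_mono nn_integral_arc_kernel h) auto
  also have "\<dots> = ennreal (8 * pi * h)" using h by (simp add: ennreal_mult[symmetric] mult_ac)
  finally show ?thesis .
qed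

context
  fixes u :: "real \<Rightarrow> real"
  assumes u: "continuous_on {0..2*pi} u" and u_nonneg: "\<And>x. 0 \<le> u x"
begin

lemma measurable_dyadic_mean: "dyadic_mean u j \<in> borel_measurable circle_measure"
proof -
  interpret finite_measure circle_measure by (rule finite_measure_circle_measure)
  note measurable_arc_kernel_circle[measurable]
  have [measurable]: "u \<in> borel_measurable circle_measure" by (rule measurable_circle_measure[OF u])
  have "dyadic_mean u j x = enn2real (\<integral>\<^sup>+y. ennreal (arc_kernel ((1/2)^j) x y) * ennreal (u y) \<partial>circle_measure)" for x
    unfolding nn_integral_dyadic_mean[OF u u_nonneg, symmetric] using dyadic_mean_nonneg[OF u u_nonneg] by simp
  then have "dyadic_mean u j = (\<lambda>x. enn2real (\<integral>\<^sup>+y. ennreal (arc_kernel ((1/2)^j) x y) * ennreal (u y) \<partial>circle_measure))" ..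
  moreover have "\<dots> \<in> borel_measurable circle_measure" by measurable
  ultimately show ?thesis by simp
qed

text \<open>By Harnack's inequality the \<open>j\<close>-th mean at \<open>x\<close> is comparable with the maximal function on an
  interval of length \<open>2^(-j-1)\<close> near \<open>x\<close>, and these intervals are disjoint.\<close>

lemma sum_dyadic_mean_square_le:
  assumes x: "x \<in> {0..2*pi}"
  shows "(\<Sum>j\<le>J. (1/2) ^ j * (dyadic_mean u j x)\<^sup>2) \<le> 36864 * pi\<^sup>2 * integral {0..2*pi} (\<lambda>y. (u y)\<^sup>2)"
proof -
  \<comment> \<open>The intervals go to the side of \<open>x\<close> that has room for length 1
    inside \<open>{0..2*pi}\<close>; the half-open ends make consecutive ones disjoint.\<close>
  define I where "I j = (if x \<le> pi then {x + (1/2) ^ Suc j <.. x + (1/2) ^ j} else {x - (1/2) ^ j ..< x - (1/2) ^ Suc j})" for j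
  have h: "(1/2::real) ^ j \<le> 1" for j by (simp add: power_le_one)
  have I_sub: "I j \<subseteq> {0..2*pi}" for j
    using x h[of j] pi_gt3 zero_less_power[of "1/2::real" "Suc j"] unfolding I_def by (auto split: if_splits)
  have I_dist: "(1/2) ^ Suc j < \<bar>x - t\<bar>" "\<bar>x - t\<bar> \<le> (1/2) ^ j" if "t \<in> I j" for t j
    using that zero_less_power[of "1/2::real" "Suc j"] unfolding I_def by (auto split: if_splits simp: abs_if)
  have I_disj: "i = j" if "t \<in> I i" "t \<in> I j" for t i j
  proof -
    have "(1/2::real) ^ Suc i < (1/2) ^ j" "(1/2::real) ^ Suc j < (1/2) ^ i"
      using I_dist[OF that(1)] I_dist[OF that(2)] by linarith+
    moreover have "n < m" if "(1/2::real) ^ m < (1/2) ^ n" for m n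
      using that power_decreasing[of m n "1/2::real"] by (cases "n < m") auto
    ultimately have "j < Suc i" "i < Suc j" by blast+
    then show ?thesis by simp
  qed
  have I_sets: "I j \<in> sets circle_measure" for j
    unfolding circle_measure_def using I_sub[of j] by (subst sets_restrict_space_iff) (auto simp: I_def)
  have I_measure: "emeasure circle_measure (I j) = ennreal ((1/2) ^ Suc j)" for j
    unfolding circle_measure_def using I_sub[of j]
    by (subst emeasure_restrict_space) (auto simp: I_def)
  define W where "W t = (\<Sum>j\<le>J. indicator (I j) t * (dyadic_mean u j x / 3))" for t
  have W_in: "W t = dyadic_mean u i x / 3" if "i \<le> J" "t \<in> I i" for i t
  proof -
    have "W t = (\<Sum>j\<le>J. if j = i then dyadic_mean u j x / 3 else 0)"
      unfolding W_def using that I_disj by (intro sum.cong) (auto simp: indicator_def)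
    then show ?thesis using that by simp
  qed
  have W_out: "W t = 0" if "\<And>i. i \<le> J \<Longrightarrow> t \<notin> I i" for t
    unfolding W_def using that by (intro sum.neutral) auto
  note dn = dyadic_mean_nonneg[OF u u_nonneg]
  have W2: "ennreal ((W t)\<^sup>2) = (\<Sum>j\<le>J. ennreal ((dyadic_mean u j x / 3)\<^sup>2) * indicator (I j) t)" for t
  proof (cases "\<exists>i\<le>J. t \<in> I i")
    case True
    then obtain i where i: "i \<le> J" "t \<in> I i" by blast
    have "(\<Sum>j\<le>J. ennreal ((dyadic_mean u j x / 3)\<^sup>2) * indicator (I j) t) = (\<Sum>j\<le>J. if j = i then ennreal ((dyadic_mean u j x / 3)\<^sup>2) else 0)"
      using i I_disj by (intro sum.cong) (auto simp: indicator_def)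
    also have "\<dots> = ennreal ((W t)\<^sup>2)"
      using i(1) by (simp only: W_in[OF i] sum.delta finite_atMost atMost_iff if_True)
    finally show ?thesis ..
  next
    case False
    then show ?thesis using W_out[of t] by (auto intro!: sum.neutral[symmetric])
  qed
  \<comment> \<open>The square of the Harnack constant 3 and the interval length
    \<open>2^(-j-1)\<close> give the factor \<open>1/18\<close>, hence
    \<open>36864 = 18 * 2048\<close>.\<close>
  have "ennreal (1/18 * (\<Sum>j\<le>J. (1/2) ^ j * (dyadic_mean u j x)\<^sup>2)) = (\<Sum>j\<le>J. ennreal ((dyadic_mean u j x / 3)\<^sup>2) * ennreal ((1/2) ^ Suc j))"
    unfolding sum_distrib_left by (subst sum_ennreal[symmetric]) (auto simp: ennreal_mult'[symmetric] power2_eq_square field_simps intro!: sum.cong)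
  also have "\<dots> = (\<Sum>j\<le>J. \<integral>\<^sup>+t. ennreal ((dyadic_mean u j x / 3)\<^sup>2) * indicator (I j) t \<partial>circle_measure)"
    using I_sets I_measure by (simp add: nn_integral_cmult_indicator)
  also have "\<dots> = (\<integral>\<^sup>+t. ennreal ((W t)\<^sup>2) \<partial>circle_measure)"
    unfolding W2 using I_sets by (intro nn_integral_sum[symmetric]) auto
  also have "\<dots> \<le> ennreal (2048 * pi\<^sup>2 * integral {0..2*pi} (\<lambda>y. (u y)\<^sup>2))"
  proof (rule maximal_dyadic_mean[OF u u_nonneg, where J = J])
    fix t
    show "0 \<le> W t \<and> (\<exists>i\<le>J. W t \<le> dyadic_mean u i t)"
    proof (cases "\<exists>i\<le>J. t \<in> I i")
      case True
      then obtain i where i: "i \<le> J" "t \<in> I i" by blast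
      have "dyadic_mean u i x \<le> 3 * dyadic_mean u i t"
        using norm_cis_diff_le[of x t] I_dist[OF i(2)] by (intro dyadic_mean_Harnack[OF u u_nonneg]) simp
      then show ?thesis using W_in[OF i] dn[of i x] i by auto
    next
      case False
      then show ?thesis using W_out[of t] dn[of 0 t] by auto
    qed
  qed
  finally have "1/18 * (\<Sum>j\<le>J. (1/2) ^ j * (dyadic_mean u j x)\<^sup>2) \<le> 2048 * pi\<^sup>2 * integral {0..2*pi} (\<lambda>y. (u y)\<^sup>2)"
    by (subst (asm) ennreal_le_iff) (auto intro!: mult_nonneg_nonneg integral_nonneg integrable_continuous_interval continuous_intros u)
  then show ?thesis by simp
qed

text \<open>If \<open>norm (1 - cis t) \<le> 2^(-j)\<close>, Harnack's inequality moves the mean to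
  the point 0. The corresponding arc has length of order \<open>2^(-j)\<close>, and this is the
  weight in \<open>sum_dyadic_mean_square_le\<close> at 0. For the other \<open>j\<close> the means
  are replaced by their maximum \<open>V\<close>, and the weights form a geometric sum. This is the
  integral estimate behind the case \<open>p = q\<close>.\<close>

lemma nn_integral_weighted_dyadic_mean_le:
  assumes a: "0 < a"
  shows "(\<integral>\<^sup>+t. ennreal (\<Sum>j\<le>J. (if norm (1 - cis t) \<le> (1/2) ^ j then 1 else ((1/2) ^ j / norm (1 - cis t)) powr a) * (dyadic_mean u j t)\<^sup>2) \<partial>circle_measure)
    \<le> ennreal ((72 * pi * 36864 + 2048 / (1 - 2 powr (-a))) * pi\<^sup>2 * integral {0..2*pi} (\<lambda>y. (u y)\<^sup>2))"
proof -
  note dn = dyadic_mean_nonneg[OF u u_nonneg]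
  define d where "d t = norm (1 - cis t)" for t
  define V where "V t = Max ((\<lambda>j. dyadic_mean u j t) ` {..J})" for t
  have V: "dyadic_mean u j t \<le> V t" if "j \<le> J" for j t unfolding V_def using that by (intro Max_ge) auto
  have V0: "0 \<le> V t" for t using V[of 0 t] dn[of 0 t] by simp
  have V_ex: "\<exists>i\<le>J. V t \<le> dyadic_mean u i t" for t
  proof -
    have "V t \<in> (\<lambda>j. dyadic_mean u j t) ` {..J}" unfolding V_def by (intro Max_in) auto
    then obtain i where "V t = dyadic_mean u i t" "i \<in> {..J}" by (rule imageE)
    then show ?thesis by auto
  qed
  have [measurable]: "V \<in> borel_measurable circle_measure"
    unfolding V_def by (intro borel_measurable_Max measurable_dyadic_mean) auto
  define c where "c = 1 / (1 - 2 powr (-a))"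
  have c: "0 < c" unfolding c_def using a powr_less_mono[of "-a" 0 2] by simp
  have pt: "(\<Sum>j\<le>J. (if d t \<le> (1/2) ^ j then 1 else ((1/2) ^ j / d t) powr a) * (dyadic_mean u j t)\<^sup>2)
    \<le> (\<Sum>j\<le>J. 9 * (dyadic_mean u j 0)\<^sup>2 * (if d t \<le> (1/2) ^ j then 1 else 0)) + c * (V t)\<^sup>2" for t
  proof -
    let ?F = "{j. j \<le> J \<and> (1/2) ^ j < d t}"
    have "(\<Sum>j\<le>J. (if d t \<le> (1/2) ^ j then 1 else ((1/2) ^ j / d t) powr a) * (dyadic_mean u j t)\<^sup>2)
      \<le> (\<Sum>j\<le>J. 9 * (dyadic_mean u j 0)\<^sup>2 * (if d t \<le> (1/2) ^ j then 1 else 0)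
          + (if (1/2) ^ j < d t then ((1/2) ^ j / d t) powr a * (V t)\<^sup>2 else 0))"
    proof (intro sum_mono)
      fix j assume j: "j \<in> {..J}"
      show "(if d t \<le> (1/2) ^ j then 1 else ((1/2) ^ j / d t) powr a) * (dyadic_mean u j t)\<^sup>2
        \<le> 9 * (dyadic_mean u j 0)\<^sup>2 * (if d t \<le> (1/2) ^ j then 1 else 0)
          + (if (1/2) ^ j < d t then ((1/2) ^ j / d t) powr a * (V t)\<^sup>2 else 0)"
      proof (cases "d t \<le> (1/2) ^ j")
        case True
        then have "dyadic_mean u j t \<le> 3 * dyadic_mean u j 0"
          by (intro dyadic_mean_Harnack[OF u u_nonneg]) (simp add: d_def norm_minus_commute)
        then have "(dyadic_mean u j t)\<^sup>2 \<le> (3 * dyadic_mean u j 0)\<^sup>2" using dn by (intro power_mono)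
        then show ?thesis using True by (simp add: power_mult_distrib)
      next
        case False
        have "(dyadic_mean u j t)\<^sup>2 \<le> (V t)\<^sup>2" using dn V j by (intro power_mono) auto
        then show ?thesis using False by (auto intro!: mult_left_mono)
      qed
    qed
    also have "\<dots> = (\<Sum>j\<le>J. 9 * (dyadic_mean u j 0)\<^sup>2 * (if d t \<le> (1/2) ^ j then 1 else 0))
        + (\<Sum>j\<in>?F. ((1/2) ^ j / d t) powr a) * (V t)\<^sup>2"
    proof -
      have F: "?F = {j \<in> {..J}. (1/2) ^ j < d t}" by auto
      show ?thesis unfolding F sum.distrib sum_distrib_right by (subst sum.inter_filter) auto
    qed
    also have "\<dots> \<le> (\<Sum>j\<le>J. 9 * (dyadic_mean u j 0)\<^sup>2 * (if d t \<le> (1/2) ^ j then 1 else 0)) + c * (V t)\<^sup>2"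
    proof (intro add_left_mono mult_right_mono)
      show "(\<Sum>j\<in>?F. ((1/2) ^ j / d t) powr a) \<le> c"
      proof (cases "d t = 0")
        case True then show ?thesis using c by (simp add: not_less)
      next
        case False then show ?thesis unfolding c_def by (intro sum_dyadic_below a) (simp add: d_def)
      qed
    qed auto
    finally show ?thesis .
  qed
  have d_cont: "continuous_on S d" for S unfolding d_def by (intro continuous_intros)
  have [measurable]: "d \<in> borel_measurable circle_measure" by (intro measurable_circle_measure d_cont)
  let ?U = "integral {0..2*pi} (\<lambda>y. (u y)\<^sup>2)"
  have U: "0 \<le> ?U" by (intro integral_nonneg integrable_continuous_interval continuous_intros u) auto
  have "(\<integral>\<^sup>+t. ennreal (\<Sum>j\<le>J. (if d t \<le> (1/2) ^ j then 1 else ((1/2) ^ j / d t) powr a) * (dyadic_mean u j t)\<^sup>2) \<partial>circle_measure)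
    \<le> (\<integral>\<^sup>+t. (\<Sum>j\<le>J. ennreal (9 * (dyadic_mean u j 0)\<^sup>2) * (if d t \<le> (1/2) ^ j then 1 else 0)) + ennreal c * ennreal ((V t)\<^sup>2) \<partial>circle_measure)"
  proof (intro nn_integral_mono)
    fix t
    have "ennreal ((\<Sum>j\<le>J. 9 * (dyadic_mean u j 0)\<^sup>2 * (if d t \<le> (1/2) ^ j then 1 else 0)) + c * (V t)\<^sup>2)
      = (\<Sum>j\<le>J. ennreal (9 * (dyadic_mean u j 0)\<^sup>2) * (if d t \<le> (1/2) ^ j then 1 else 0)) + ennreal c * ennreal ((V t)\<^sup>2)"
      using c by (subst ennreal_plus) (auto simp: ennreal_mult sum_ennreal[symmetric] intro!: sum_nonneg sum.cong)
    then show "ennreal (\<Sum>j\<le>J. (if d t \<le> (1/2) ^ j then 1 else ((1/2) ^ j / d t) powr a) * (dyadic_mean u j t)\<^sup>2)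
      \<le> (\<Sum>j\<le>J. ennreal (9 * (dyadic_mean u j 0)\<^sup>2) * (if d t \<le> (1/2) ^ j then 1 else 0)) + ennreal c * ennreal ((V t)\<^sup>2)"
      using ennreal_leI[OF pt[of t]] by simp
  qed
  also have "\<dots> = (\<Sum>j\<le>J. ennreal (9 * (dyadic_mean u j 0)\<^sup>2) * (\<integral>\<^sup>+t. (if d t \<le> (1/2) ^ j then 1 else 0) \<partial>circle_measure))
     + (\<integral>\<^sup>+t. ennreal c * ennreal ((V t)\<^sup>2) \<partial>circle_measure)"
    using c by (subst nn_integral_add) (auto simp: nn_integral_sum nn_integral_cmult)
  also have "\<dots> \<le> (\<Sum>j\<le>J. ennreal (9 * (dyadic_mean u j 0)\<^sup>2) * ennreal (8 * pi * (1/2) ^ j)) + ennreal c * ennreal (2048 * pi\<^sup>2 * ?U)"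
  proof (intro add_mono sum_mono mult_left_mono)
    show "(\<integral>\<^sup>+t. (if d t \<le> (1/2) ^ j then 1 else 0) \<partial>circle_measure) \<le> ennreal (8 * pi * (1/2) ^ j)" for j
      using nn_integral_arc_le[of "(1/2) ^ j" 0] by (simp add: d_def power_le_one)
    have "(\<integral>\<^sup>+t. ennreal c * ennreal ((V t)\<^sup>2) \<partial>circle_measure) = ennreal c * (\<integral>\<^sup>+t. ennreal ((V t)\<^sup>2) \<partial>circle_measure)"
      by (rule nn_integral_cmult) measurable
    also have "\<dots> \<le> ennreal c * ennreal (2048 * pi\<^sup>2 * ?U)"
      using V0 V_ex by (intro mult_left_mono maximal_dyadic_mean[OF u u_nonneg, where J = J]) auto
    finally show "(\<integral>\<^sup>+t. ennreal c * ennreal ((V t)\<^sup>2) \<partial>circle_measure) \<le> ennreal c * ennreal (2048 * pi\<^sup>2 * ?U)" .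
  qed auto
  also have "\<dots> = ennreal (72 * pi * (\<Sum>j\<le>J. (1/2) ^ j * (dyadic_mean u j 0)\<^sup>2) + c * (2048 * pi\<^sup>2 * ?U))"
    unfolding sum_distrib_left using c U
    by (subst ennreal_plus) (auto simp: ennreal_mult[symmetric] sum_ennreal mult_ac intro!: sum_nonneg)
  also have "\<dots> \<le> ennreal (72 * pi * (36864 * pi\<^sup>2 * ?U) + c * (2048 * pi\<^sup>2 * ?U))"
    by (intro ennreal_leI add_right_mono mult_left_mono sum_dyadic_mean_square_le) auto
  also have "\<dots> = ennreal ((72 * pi * 36864 + 2048 / (1 - 2 powr (-a))) * pi\<^sup>2 * ?U)"
    by (simp add: c_def algebra_simps)
  finally show ?thesis unfolding d_def .
qed

end

section \<open>The integral representation and its dyadic decomposition\<close>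

text \<open>By the Cauchy product, the \<open>n\<close>-th Taylor coefficient of
  \<open>f z * (1 - z) powr (-\<gamma>)\<close>.\<close>

definition cesaro_coeff :: "real \<Rightarrow> (complex \<Rightarrow> complex) \<Rightarrow> nat \<Rightarrow> complex" where
  "cesaro_coeff \<gamma> f n =
     (\<Sum>k\<le>n. of_real (Gamma (real (n - k) + \<gamma>) / (Gamma \<gamma> * fact (n - k))) * taylor_coeff f k)"

lemma cesaro_op_eq_suminf:
  "cesaro_op \<mu> \<gamma> f z = (\<Sum>n. of_real (moment \<mu> n) * cesaro_coeff \<gamma> f n * z ^ n)"
  by (simp add: cesaro_op_def cesaro_coeff_def)

lemma norm_powser_summable_ball:
  fixes a :: "nat \<Rightarrow> complex"
  assumes "\<And>w. norm w < 1 \<Longrightarrow> summable (\<lambda>n. a n * w ^ n)" and z: "norm z < 1"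
  shows "summable (\<lambda>n. norm (a n * z ^ n))"
proof -
  obtain r where r: "norm z < r" "r < 1" using dense[OF z] by auto
  then have "0 < r" using norm_ge_zero[of z] by linarith
  then have "norm (of_real r :: complex) < 1" "norm z < norm (of_real r :: complex)" using r by auto
  then show ?thesis by (intro powser_insidea[OF assms(1)])
qed

text \<open>The binomial series with exponent \<open>-\<gamma>\<close> at \<open>-z\<close>: the two
  signs \<open>(-1)^n\<close> cancel, and the Pochhammer symbol is a quotient of Gamma
  values.\<close>

lemma negative_binomial_sums:
  fixes z :: complex
  assumes g: "0 < \<gamma>" and z: "norm z < 1"
  shows "(\<lambda>n. of_real (Gamma (real n + \<gamma>) / (Gamma \<gamma> * fact n)) * z ^ n) sums ((1 - z) powr (- of_real \<gamma>))"
proof -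
  have "((- of_real \<gamma> :: complex) gchoose n) * (-z) ^ n = of_real (Gamma (real n + \<gamma>) / (Gamma \<gamma> * fact n)) * z ^ n" for n
  proof -
    have "(- of_real \<gamma> :: complex) gchoose n = (- 1) ^ n * of_real (pochhammer \<gamma> n / fact n)"
      by (simp add: gbinomial_pochhammer pochhammer_of_real)
    also have "pochhammer \<gamma> n = Gamma (real n + \<gamma>) / Gamma \<gamma>"
      using g by (subst pochhammer_Gamma) (auto simp: add.commute)
    finally show ?thesis
      by (simp add: power_minus[of z] mult_ac)
  qed
  then show ?thesis using gen_binomial_complex[of "-z" "- of_real \<gamma>"] z by simp
qed

lemma cesaro_coeff_sums:
  assumes g: "0 < \<gamma>" and f: "f holomorphic_on ball 0 1" and z: "norm z < 1"
  shows "(\<lambda>n. cesaro_coeff \<gamma> f n * z ^ n) sums (f z * (1 - z) powr (- of_real \<gamma>))"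
proof -
  define b where "b n = complex_of_real (Gamma (real n + \<gamma>) / (Gamma \<gamma> * fact n))" for n
  have a_sums: "(\<lambda>n. taylor_coeff f n * w ^ n) sums f w" if "norm w < 1" for w
    using holomorphic_power_series[OF f, of w] that by (simp add: taylor_coeff_def)
  have b_sums: "(\<lambda>n. b n * w ^ n) sums ((1 - w) powr (- of_real \<gamma>))" if "norm w < 1" for w
    unfolding b_def by (rule negative_binomial_sums[OF g that])
  have "(\<lambda>n. \<Sum>i\<le>n. (taylor_coeff f i * z ^ i) * (b (n - i) * z ^ (n - i))) sums
      ((\<Sum>n. taylor_coeff f n * z ^ n) * (\<Sum>n. b n * z ^ n))"
    using a_sums b_sums by (intro Cauchy_product_sums norm_powser_summable_ball z sums_summable)
  moreover have "(\<Sum>i\<le>n. (taylor_coeff f i * z ^ i) * (b (n - i) * z ^ (n - i))) = cesaro_coeff \<gamma> f n * z ^ n" for n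
    unfolding cesaro_coeff_def b_def[symmetric] sum_distrib_right
    by (intro sum.cong) (auto simp: mult_ac power_add[symmetric])
  ultimately show ?thesis
    using sums_unique[OF a_sums[OF z]] sums_unique[OF b_sums[OF z]] by simp
qed

locale cesaro_measure =
  fixes \<mu> :: "real measure" and \<gamma> :: real
  assumes finite_measure_01: "finite_measure_01 \<mu>" and gamma_pos: "0 < \<gamma>"
begin

sublocale finite_measure \<mu>
  using finite_measure_01 by (simp add: finite_measure_01_def)

lemma sets_\<mu>: "sets \<mu> = sets (restrict_space borel {0..<1})"
  using finite_measure_01 by (simp add: finite_measure_01_def)

lemma space_\<mu>: "space \<mu> = {0..<1}"
  using sets_eq_imp_space_eq[OF sets_\<mu>] by (simp add: space_restrict_space)

lemma measurable_id_\<mu> [measurable]: "(\<lambda>t. t) \<in> borel_measurable \<mu>"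
  by (subst measurable_cong_sets[OF sets_\<mu> refl]) (intro measurable_restrict_space1, simp)

lemma interval_in_sets_\<mu>: "0 \<le> a \<Longrightarrow> {a..<1} \<in> sets \<mu>"
  unfolding sets_\<mu> by (subst sets_restrict_space_iff) auto

context
  fixes f :: "complex \<Rightarrow> complex" and z :: complex
  assumes f: "f holomorphic_on ball 0 1" and z: "norm z < 1"
begin

text \<open>For \<open>0 \<le> t < 1\<close> the expansion of the integrand in powers of
  \<open>t z\<close> is dominated termwise by the absolutely convergent one at \<open>z\<close>,
  uniformly in \<open>t\<close>. As \<open>\<mu>\<close> has finite mass, sum and integral can be
  exchanged.\<close>

lemma cesaro_integral:
  shows integrable_cesaro: "integrable \<mu> (\<lambda>t. f (of_real t * z) * (1 - of_real t * z) powr (- of_real \<gamma>))" (is "integrable _ ?g")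
    and cesaro_op_sums: "(\<lambda>n. of_real (moment \<mu> n) * cesaro_coeff \<gamma> f n * z ^ n) sums cesaro_op \<mu> \<gamma> f z"
    and cesaro_op_eq_integral: "cesaro_op \<mu> \<gamma> f z = (LINT t|\<mu>. f (of_real t * z) * (1 - of_real t * z) powr (- of_real \<gamma>))"
proof -
  define F where "F n t = cesaro_coeff \<gamma> f n * (of_real t * z) ^ n" for n and t :: real
  have [measurable]: "F n \<in> borel_measurable \<mu>" for n unfolding F_def by measurable
  have norm_F: "norm (F n t) \<le> norm (cesaro_coeff \<gamma> f n * z ^ n)" if "t \<in> space \<mu>" for n t
    using that unfolding F_def space_\<mu>
    by (auto simp: norm_mult norm_power power_mult_distrib intro!: mult_left_mono mult_left_le_one_le power_le_one)
  have abs: "summable (\<lambda>n. norm (cesaro_coeff \<gamma> f n * z ^ n))"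
    using cesaro_coeff_sums[OF gamma_pos f] by (intro norm_powser_summable_ball z sums_summable)
  have F_sums: "(\<lambda>n. F n t) sums ?g t" if "t \<in> space \<mu>" for t
  proof -
    have "norm (of_real t * z) < 1"
      using that z mult_left_le_one_le[of "norm z" t] by (auto simp: norm_mult space_\<mu>)
    then show ?thesis unfolding F_def by (auto intro: cesaro_coeff_sums[OF gamma_pos f])
  qed
  have intF: "integrable \<mu> (F n)" for n
    using norm_F by (intro integrable_const_bound[where B = "norm (cesaro_coeff \<gamma> f n * z ^ n)"] AE_I2) auto
  have summ: "AE t in \<mu>. summable (\<lambda>n. norm (F n t))"
    using norm_F by (intro AE_I2 summable_comparison_test[OF _ abs]) auto
  have sumint: "summable (\<lambda>n. LINT t|\<mu>. norm (F n t))"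
  proof (rule summable_comparison_test)
    show "summable (\<lambda>n. measure \<mu> (space \<mu>) * norm (cesaro_coeff \<gamma> f n * z ^ n))"
      using abs by (rule summable_mult)
    have "(LINT t|\<mu>. norm (F n t)) \<le> (LINT t|\<mu>. norm (cesaro_coeff \<gamma> f n * z ^ n))" for n
      using intF norm_F by (intro integral_mono) auto
    then show "\<exists>N. \<forall>n\<ge>N. norm (LINT t|\<mu>. norm (F n t)) \<le> measure \<mu> (space \<mu>) * norm (cesaro_coeff \<gamma> f n * z ^ n)"
      by (simp add: mult.commute)
  qed
  have suminf_F: "(\<Sum>n. F n t) = ?g t" if "t \<in> space \<mu>" for t
    using F_sums[OF that] by (simp add: sums_iff)
  have "integrable \<mu> (\<lambda>t. \<Sum>n. F n t)" by (rule integrable_suminf[OF intF summ sumint])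
  also have "integrable \<mu> (\<lambda>t. \<Sum>n. F n t) \<longleftrightarrow> integrable \<mu> ?g"
    using suminf_F by (intro Bochner_Integration.integrable_cong) auto
  finally show "integrable \<mu> ?g" .
  have "(\<lambda>n. integral\<^sup>L \<mu> (F n)) sums (LINT t|\<mu>. (\<Sum>n. F n t))" by (rule sums_integral[OF intF summ sumint])
  also have "(LINT t|\<mu>. (\<Sum>n. F n t)) = (LINT t|\<mu>. ?g t)"
    using suminf_F by (intro Bochner_Integration.integral_cong) auto
  also have "(\<lambda>n. integral\<^sup>L \<mu> (F n)) = (\<lambda>n. of_real (moment \<mu> n) * cesaro_coeff \<gamma> f n * z ^ n)"
  proof
    fix n
    have "F n = (\<lambda>t. (cesaro_coeff \<gamma> f n * z ^ n) * of_real (t ^ n))" by (auto simp: F_def power_mult_distrib)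
    then have "integral\<^sup>L \<mu> (F n) = (cesaro_coeff \<gamma> f n * z ^ n) * (LINT t|\<mu>. of_real (t ^ n))"
      by (simp only: integral_mult_right_zero)
    also have "(LINT t|\<mu>. of_real (t ^ n)) = complex_of_real (moment \<mu> n)"
      unfolding moment_def
      by (intro integral_of_real integrable_const_bound[where B = 1] AE_I2) (auto simp: space_\<mu> power_le_one)
    finally show "integral\<^sup>L \<mu> (F n) = of_real (moment \<mu> n) * cesaro_coeff \<gamma> f n * z ^ n" by (simp add: mult_ac)
  qed
  finally have *: "(\<lambda>n. of_real (moment \<mu> n) * cesaro_coeff \<gamma> f n * z ^ n) sums (LINT t|\<mu>. ?g t)" .
  then show "cesaro_op \<mu> \<gamma> f z = (LINT t|\<mu>. ?g t)"
    unfolding cesaro_op_eq_suminf by (rule sums_unique[symmetric])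
  with * show "(\<lambda>n. of_real (moment \<mu> n) * cesaro_coeff \<gamma> f n * z ^ n) sums cesaro_op \<mu> \<gamma> f z" by simp
qed

end

lemma holomorphic_cesaro_op:
  assumes "f holomorphic_on ball 0 1"
  shows "cesaro_op \<mu> \<gamma> f holomorphic_on ball 0 1"
  using cesaro_op_sums[OF assms] by (intro power_series_holomorphic) auto

text \<open>The measure is cut into the dyadic pieces \<open>E j\<close> on which \<open>1 - t r / R\<close> is comparable with
  \<open>2^(-j)\<close>. Working with the dilation \<open>f (R z)\<close>, \<open>r < R < 1\<close>, makes only finitely many of them
  relevant and keeps the boundary values continuous.\<close>

lemma norm_cesaro_op_le:
  assumes f: "f holomorphic_on ball 0 1" and p: "0 < p" and K: "0 \<le> K"
    and carleson: "\<And>t. t \<in> {0..<1} \<Longrightarrow> measure \<mu> {t..<1} \<le> K * (1 - t) powr s"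
    and r: "0 \<le> r" "r < 1"
    and A: "\<And>r. 0 \<le> r \<Longrightarrow> r < 1 \<Longrightarrow> integral {0..2*pi} (\<lambda>t. norm (f (of_real r * cis t)) powr p) \<le> A"
  obtains u J where "continuous_on {0..2*pi} u" "\<And>x. 0 \<le> u x" "integral {0..2*pi} (\<lambda>t. (u t)\<^sup>2) \<le> A"
    "\<And>x. norm (cesaro_op \<mu> \<gamma> f (of_real r * cis x)) \<le> 2 powr \<gamma> * 12 powr (2 / p) * K *
      (\<Sum>j\<le>J. ((1/2) ^ j) powr s * (if norm (1 - cis x) \<le> (1/2) ^ j then ((1/2) ^ j) powr (-\<gamma>) else norm (1 - cis x) powr (-\<gamma>))
        * dyadic_mean u j x powr (2 / p))"
proof -
  define R where "R = (1 + r) / 2"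
  have R: "0 < R" "R < 1" "r < R" using r by (auto simp: R_def)
  \<comment> \<open>\<open>t z\<close> is \<open>R\<close> times a point of radius
    \<open>t * \<sigma>\<close>, so \<open>\<sigma>\<close> bounds the radii that occur after the
    dilation.\<close>
  define \<sigma> where "\<sigma> = r / R"
  have \<sigma>: "0 \<le> \<sigma>" "\<sigma> < 1" "\<sigma> * R = r" "r \<le> \<sigma>" using r R by (auto simp: \<sigma>_def divide_simps mult_left_le)
  define u where "u t = norm (f (of_real R * cis t)) powr (p / 2)" for t
  have cont: "continuous_on {0..2*pi} (\<lambda>t. f (of_real R * cis t))"
    by (rule continuous_on_compose2[OF holomorphic_on_imp_continuous_on[OF f]])
      (use R in \<open>auto simp: norm_mult intro!: continuous_on_mult continuous_on_const continuous_on_cis continuous_on_id\<close>)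
  have u: "continuous_on {0..2*pi} u"
    unfolding u_def using p by (intro continuous_on_powr' continuous_on_norm cont continuous_on_const) auto
  have u0: "0 \<le> u x" for x by (simp add: u_def)
  have u2: "(u t)\<^sup>2 = norm (f (of_real R * cis t)) powr p" for t
    unfolding u_def by (simp add: power2_eq_square powr_add[symmetric])
  have uA: "integral {0..2*pi} (\<lambda>t. (u t)\<^sup>2) \<le> A"
    unfolding u2 using R by (intro A) auto
  have F: "(\<lambda>w. f (of_real R * w)) holomorphic_on ball 0 (1 / R)"
    by (rule holomorphic_on_compose_gen[OF _ f, unfolded o_def])
      (use R in \<open>auto simp: norm_mult field_simps intro!: holomorphic_intros\<close>)
  have "(\<lambda>n. (1/2::real) ^ n) \<longlonglongrightarrow> 0" by (rule LIMSEQ_realpow_zero) auto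
  from order_tendstoD(2)[OF this, of "1 - \<sigma>"] \<sigma> obtain J where J: "(1/2) ^ J < 1 - \<sigma>"
    by (auto simp: eventually_sequentially)
  define E where "E j = {t \<in> space \<mu>. (1/2) ^ Suc j < 1 - t * \<sigma> \<and> 1 - t * \<sigma> \<le> (1/2) ^ j}" for j :: nat
  have E_sets[measurable]: "E j \<in> sets \<mu>" for j unfolding E_def by measurable
  \<comment> \<open>From \<open>\<sigma> < 1\<close> one gets
    \<open>1 - t \<le> 1 - t * \<sigma> \<le> 2^(-j)\<close>, so \<open>E j\<close> lies in the
    Carleson interval of length \<open>2^(-j)\<close> despite the dilation.\<close>
  have E_measure: "measure \<mu> (E j) \<le> K * ((1/2) ^ j) powr s" for j
  proof -
    have h1: "(1/2::real) ^ j \<le> 1" by (simp add: power_le_one)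
    have "E j \<subseteq> {1 - (1/2) ^ j..<1}"
    proof
      fix t assume t: "t \<in> E j"
      then have "t * \<sigma> \<le> t" using \<sigma> by (auto simp: E_def space_\<mu> intro!: mult_left_le)
      then show "t \<in> {1 - (1/2) ^ j..<1}" using t by (auto simp: E_def space_\<mu>)
    qed
    then have "measure \<mu> (E j) \<le> measure \<mu> {1 - (1/2) ^ j..<1}"
      using h1 by (intro finite_measure_mono interval_in_sets_\<mu>) auto
    also have "\<dots> \<le> K * (1 - (1 - (1/2) ^ j)) powr s"
      using h1 by (intro carleson) auto
    finally show ?thesis by simp
  qed
  have E_cover: "\<exists>j\<le>J. t \<in> E j" if t: "t \<in> space \<mu>" for t
  proof -
    define h where "h = 1 - t * \<sigma>"
    have "0 \<le> t" "t \<le> 1" using t by (auto simp: space_\<mu>)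
    then have "t * \<sigma> \<le> \<sigma>" "0 \<le> t * \<sigma>" using \<sigma> by (auto intro: mult_left_le_one_le)
    then have h: "1 - \<sigma> \<le> h" "h \<le> 1" by (auto simp: h_def)
    \<comment> \<open>\<open>n\<close> is positive because \<open>h \<le> 1\<close>; its predecessor
      \<open>j\<close> satisfies \<open>2^(-j-1) < h \<le> 2^(-j)\<close>.\<close>
    define n where "n = (LEAST n. (1/2) ^ n < h)"
    have "(1/2) ^ J < h" using J h by linarith
    then have n: "(1/2) ^ n < h" "n \<le> J" unfolding n_def by (auto intro: LeastI Least_le)
    with h have "n \<noteq> 0" by (intro notI) simp
    then obtain j where j: "n = Suc j" using not0_implies_Suc by blast
    then have "\<not> (1/2) ^ j < h" unfolding n_def by (metis lessI not_less_Least)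
    then show ?thesis using n t j by (intro exI[of _ j]) (auto simp: E_def h_def)
  qed
  have main: "norm (cesaro_op \<mu> \<gamma> f (of_real r * cis x)) \<le> 2 powr \<gamma> * 12 powr (2 / p) * K *
      (\<Sum>j\<le>J. ((1/2) ^ j) powr s * (if norm (1 - cis x) \<le> (1/2) ^ j then ((1/2) ^ j) powr (-\<gamma>) else norm (1 - cis x) powr (-\<gamma>))
        * dyadic_mean u j x powr (2 / p))" for x
  proof -
    define z where "z = of_real r * cis x"
    have z: "norm z < 1" using r by (simp add: z_def norm_mult)
    define G where "G j = (if norm (1 - cis x) \<le> (1/2) ^ j then ((1/2) ^ j) powr (-\<gamma>) else norm (1 - cis x) powr (-\<gamma>))" for j :: nat
    define c where "c j = 2 powr \<gamma> * G j * (12 powr (2 / p) * dyadic_mean u j x powr (2 / p))" for j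
    have c0: "0 \<le> c j" for j by (simp add: c_def G_def)
    define g where "g t = f (of_real t * z) * (1 - of_real t * z) powr (- of_real \<gamma>)" for t :: real
    have g_le: "norm (g t) \<le> c j" if j: "t \<in> E j" for t j
    proof -
      have t: "0 \<le> t" "t < 1" "(1/2) ^ Suc j < 1 - t * \<sigma>" "1 - t * \<sigma> \<le> (1/2) ^ j"
        using j by (auto simp: E_def space_\<mu>)
      have eq: "of_real t * z = of_real R * (of_real (t * \<sigma>) * cis x)"
        unfolding z_def \<sigma>(3)[symmetric] by (simp add: mult_ac)
      have "norm (f (of_real t * z)) powr (p / 2) \<le> 12 * dyadic_mean u j x"
        unfolding eq u_def
      proof (rule norm_powr_le_dyadic_mean[OF F])
        show "1 < 1 / R" using R by simp
        show "0 \<le> t * \<sigma>" using t \<sigma> by simp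
        show "t * \<sigma> < 1" using t(3) zero_less_power[of "1/2::real" "Suc j"] by linarith
      qed (use p t in auto)
      then have "(norm (f (of_real t * z)) powr (p / 2)) powr (2 / p) \<le> (12 * dyadic_mean u j x) powr (2 / p)"
        using p by (intro powr_mono2) auto
      then have fle: "norm (f (of_real t * z)) \<le> 12 powr (2 / p) * dyadic_mean u j x powr (2 / p)"
        using p dyadic_mean_nonneg[OF u u0, of j x] by (simp add: powr_powr powr_mult)
      \<comment> \<open>\<open>D\<close> has two lower bounds: \<open>2^(-j-1)\<close>, from the
        distance to the circle, and half the distance from \<open>cis x\<close> to 1. Each loses a
        factor 2, hence \<open>2 powr \<gamma>\<close>.\<close>
      define D where "D = norm (1 - of_real t * z)"
      have tr: "t * r \<le> t * \<sigma>" using t \<sigma> by (intro mult_left_mono) auto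
      have "norm (of_real t * z) = t * r" using t r by (simp add: z_def norm_mult)
      then have D1: "1 - t * r \<le> D" using norm_triangle_ineq2[of 1 "of_real t * z"] by (simp add: D_def)
      then have D2: "(1/2) ^ Suc j \<le> D" using t tr by linarith
      have D3: "norm (1 - cis x) / 2 \<le> D"
      proof -
        have "norm (of_real t * z - cis x) = norm (of_real (t * r - 1) * cis x)"
          by (simp add: z_def algebra_simps)
        also have "\<dots> = \<bar>t * r - 1\<bar>" by (simp only: norm_mult norm_of_real norm_cis mult_1_right)
        also have "\<bar>t * r - 1\<bar> = 1 - t * r" using tr t(3) zero_less_power[of "1/2::real" "Suc j"] by linarith
        finally have "norm (of_real t * z - cis x) \<le> D" using D1 by simp
        moreover have "norm (1 - cis x) \<le> norm (1 - of_real t * z) + norm (of_real t * z - cis x)"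
          using norm_triangle_ineq[of "1 - of_real t * z" "of_real t * z - cis x"] by simp
        ultimately show ?thesis by (simp add: D_def)
      qed
      have "D powr (-\<gamma>) \<le> 2 powr \<gamma> * G j"
      proof (cases "norm (1 - cis x) \<le> (1/2) ^ j")
        case True
        have "D powr (-\<gamma>) \<le> ((1/2) ^ Suc j) powr (-\<gamma>)"
          using gamma_pos D2 by (intro powr_mono2') auto
        also have "\<dots> = 2 powr \<gamma> * ((1/2) ^ j) powr (-\<gamma>)"
          by (simp add: powr_mult powr_minus powr_divide divide_simps)
        finally show ?thesis using True by (simp add: G_def)
      next
        case False
        then have "0 < norm (1 - cis x)" by (rule_tac less_trans[OF zero_less_power[of "1/2" j]]) auto
        then have "D powr (-\<gamma>) \<le> (norm (1 - cis x) / 2) powr (-\<gamma>)"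
          using gamma_pos D3 by (intro powr_mono2') auto
        also have "\<dots> = 2 powr \<gamma> * norm (1 - cis x) powr (-\<gamma>)"
          by (simp add: powr_minus powr_divide divide_simps)
        finally show ?thesis using False by (simp add: G_def)
      qed
      moreover have "norm (g t) = norm (f (of_real t * z)) * D powr (-\<gamma>)"
        by (simp add: g_def norm_mult D_def norm_powr_real_powr')
      ultimately show ?thesis
        unfolding c_def using mult_mono[OF _ fle, of "D powr (-\<gamma>)" "2 powr \<gamma> * G j"]
        by (simp add: mult_ac G_def)
    qed
    have int_g: "integrable \<mu> g" unfolding g_def by (rule integrable_cesaro[OF f z])
    have int_E: "integrable \<mu> (\<lambda>t. indicator (E j) t * c j)" for j
      by (intro integrable_mult_left integrable_real_indicator) (auto simp: emeasure_eq_measure)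
    have "norm (cesaro_op \<mu> \<gamma> f z) = norm (LINT t|\<mu>. g t)"
      unfolding g_def by (simp only: cesaro_op_eq_integral[OF f z])
    also have "\<dots> \<le> (LINT t|\<mu>. norm (g t))" by (rule integral_norm_bound)
    also have "\<dots> \<le> (LINT t|\<mu>. (\<Sum>j\<le>J. indicator (E j) t * c j))"
    proof (rule integral_mono)
      fix t assume t: "t \<in> space \<mu>"
      obtain j where j: "j \<le> J" "t \<in> E j" using E_cover[OF t] by blast
      have "norm (g t) \<le> indicator (E j) t * c j" using g_le[OF j(2)] j by simp
      also have "\<dots> \<le> (\<Sum>j\<le>J. indicator (E j) t * c j)"
        using j c0 by (intro member_le_sum) auto
      finally show "norm (g t) \<le> (\<Sum>j\<le>J. indicator (E j) t * c j)" .
    qed (intro integrable_norm int_g Bochner_Integration.integrable_sum int_E)+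
    also have "\<dots> = (\<Sum>j\<le>J. measure \<mu> (E j) * c j)"
      using int_E by (subst Bochner_Integration.integral_sum) auto
    also have "\<dots> \<le> (\<Sum>j\<le>J. (K * ((1/2) ^ j) powr s) * c j)"
      by (intro sum_mono mult_right_mono E_measure c0)
    also have "\<dots> = 2 powr \<gamma> * 12 powr (2 / p) * K * (\<Sum>j\<le>J. ((1/2) ^ j) powr s * G j * dyadic_mean u j x powr (2 / p))"
      unfolding c_def sum_distrib_left by (intro sum.cong) (auto simp: mult_ac)
    finally show ?thesis unfolding z_def G_def .
  qed
  show ?thesis by (rule that[OF u u0 uA main])
qed

end

section \<open>Upper bounds\<close>

lemma sum_powr_le_powr_sum:
  fixes y :: "'a \<Rightarrow> real"
  assumes S: "finite S" and y: "\<And>j. j \<in> S \<Longrightarrow> 0 \<le> y j" and r: "1 \<le> r"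
  shows "(\<Sum>j\<in>S. y j powr r) \<le> (\<Sum>j\<in>S. y j) powr r"
proof -
  define T where "T = (\<Sum>j\<in>S. y j)"
  have T: "0 \<le> T" unfolding T_def by (intro sum_nonneg y)
  have "(\<Sum>j\<in>S. y j powr r) \<le> (\<Sum>j\<in>S. y j * T powr (r - 1))"
  proof (intro sum_mono)
    fix j assume j: "j \<in> S"
    have "y j powr r = y j * y j powr (r - 1)"
      using y[OF j] by (cases "y j = 0") (auto simp: powr_diff)
    also have "y j \<le> T" unfolding T_def by (rule member_le_sum[OF j]) (use y S in auto)
    then have "y j * y j powr (r - 1) \<le> y j * T powr (r - 1)"
      using y[OF j] r by (intro mult_left_mono powr_mono2) auto
    finally show "y j powr r \<le> y j * T powr (r - 1)" .
  qed
  also have "\<dots> = T * T powr (r - 1)" by (simp add: T_def sum_distrib_right)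
  also have "\<dots> = T powr r" using T by (cases "T = 0") (auto simp: powr_diff)
  finally show ?thesis by (simp add: T_def)
qed

lemma powr_sum_le_sum_powr:
  fixes a :: "'a \<Rightarrow> real"
  assumes S: "finite S" and a: "\<And>j. j \<in> S \<Longrightarrow> 0 \<le> a j" and p: "0 < p" "p \<le> 1"
  shows "(\<Sum>j\<in>S. a j) powr p \<le> (\<Sum>j\<in>S. a j powr p)"
proof -
  have "(\<Sum>j\<in>S. a j) = (\<Sum>j\<in>S. (a j powr p) powr (1 / p))"
    using a p by (intro sum.cong) (auto simp: powr_powr)
  also have "\<dots> \<le> (\<Sum>j\<in>S. a j powr p) powr (1 / p)"
    using p by (intro sum_powr_le_powr_sum S) auto
  finally have "(\<Sum>j\<in>S. a j) powr p \<le> ((\<Sum>j\<in>S. a j powr p) powr (1 / p)) powr p"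
    using p a by (intro powr_mono2 sum_nonneg) auto
  also have "\<dots> = (\<Sum>j\<in>S. a j powr p)" using p by (simp add: powr_powr sum_nonneg)
  finally show ?thesis .
qed

text \<open>Transfers estimates over \<open>circle_measure\<close>, where maxima and sums are
  handled, to the real integrals in \<open>hardy_norm\<close>.\<close>

lemma integral_le_of_nn_integral_le:
  assumes g: "continuous_on {0..2*pi} g" "\<And>t. 0 \<le> g t" and c: "0 \<le> c"
    and le: "\<And>t. t \<in> {0..2*pi} \<Longrightarrow> g t \<le> c * S t"
    and S: "(\<integral>\<^sup>+t. ennreal (S t) \<partial>circle_measure) \<le> ennreal B" and B: "0 \<le> B"
  shows "integral {0..2*pi} g \<le> c * B"
proof (cases "c = 0")
  case True
  have "integral {0..2*pi} g \<le> integral {0..2*pi} (\<lambda>_. 0)"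
    using le True by (intro integral_le integrable_continuous_interval g) auto
  then show ?thesis using True by simp
next
  case False
  then have c: "0 < c" using c by simp
  have "ennreal (integral {0..2*pi} (\<lambda>t. g t / c)) = (\<integral>\<^sup>+t. ennreal (g t / c) \<partial>circle_measure)"
    using c g by (intro nn_integral_circle_measure[symmetric] continuous_intros) auto
  also have "\<dots> \<le> (\<integral>\<^sup>+t. ennreal (S t) \<partial>circle_measure)"
    using le c by (intro nn_integral_mono ennreal_leI) (auto simp: divide_simps mult.commute)
  also have "\<dots> \<le> ennreal B" by (rule S)
  finally have "integral {0..2*pi} (\<lambda>t. g t / c) \<le> B" using B by (simp add: ennreal_le_iff)
  then show ?thesis using c by (simp add: divide_simps mult.commute)
qed

context cesaro_measure
begin

context
  fixes f :: "complex \<Rightarrow> complex" and p K s A :: real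
  assumes f: "f holomorphic_on ball 0 1" and p: "0 < p" and K: "0 \<le> K"
    and carleson: "\<And>t. t \<in> {0..<1} \<Longrightarrow> measure \<mu> {t..<1} \<le> K * (1 - t) powr s"
    and A0: "0 \<le> A"
    and A: "\<And>r. 0 \<le> r \<Longrightarrow> r < 1 \<Longrightarrow> integral {0..2*pi} (\<lambda>t. norm (f (of_real r * cis t)) powr p) \<le> 2 * pi * A powr p"
begin

text \<open>The weaker weight \<open>2^(j \<gamma>)\<close>, valid at every \<open>x\<close>,
  suffices for \<open>p < q\<close> and for \<open>q = \<infinity>\<close>.\<close>

lemma norm_cesaro_op_le':
  assumes "0 \<le> r" "r < 1"
  obtains u J where "continuous_on {0..2*pi} u" "\<And>x. 0 \<le> u x" "integral {0..2*pi} (\<lambda>t. (u t)\<^sup>2) \<le> 2 * pi * A powr p"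
    "\<And>x. norm (cesaro_op \<mu> \<gamma> f (of_real r * cis x)) \<le> 2 powr \<gamma> * 12 powr (2 / p) * K *
      (\<Sum>j\<le>J. ((1/2) ^ j) powr (s - \<gamma>) * dyadic_mean u j x powr (2 / p))"
proof -
  obtain u J where u: "continuous_on {0..2*pi} u" "\<And>x. 0 \<le> u x" "integral {0..2*pi} (\<lambda>t. (u t)\<^sup>2) \<le> 2 * pi * A powr p"
    "\<And>x. norm (cesaro_op \<mu> \<gamma> f (of_real r * cis x)) \<le> 2 powr \<gamma> * 12 powr (2 / p) * K *
      (\<Sum>j\<le>J. ((1/2) ^ j) powr s * (if norm (1 - cis x) \<le> (1/2) ^ j then ((1/2) ^ j) powr (-\<gamma>) else norm (1 - cis x) powr (-\<gamma>))
        * dyadic_mean u j x powr (2 / p))"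
    using norm_cesaro_op_le[OF f p K carleson assms A] by blast
  show ?thesis
  proof (rule that[OF u(1-3)])
    fix x
    have "((1/2) ^ j) powr s * (if norm (1 - cis x) \<le> (1/2) ^ j then ((1/2) ^ j) powr (-\<gamma>) else norm (1 - cis x) powr (-\<gamma>))
      \<le> ((1/2) ^ j) powr (s - \<gamma>)" for j :: nat
    proof -
      have "(if norm (1 - cis x) \<le> (1/2) ^ j then ((1/2) ^ j) powr (-\<gamma>) else norm (1 - cis x) powr (-\<gamma>)) \<le> ((1/2) ^ j) powr (-\<gamma>)"
        using gamma_pos by (auto intro!: powr_mono2')
      then have "((1/2) ^ j) powr s * (if norm (1 - cis x) \<le> (1/2) ^ j then ((1/2) ^ j) powr (-\<gamma>) else norm (1 - cis x) powr (-\<gamma>))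
        \<le> ((1/2) ^ j) powr s * ((1/2) ^ j) powr (-\<gamma>)" by (intro mult_left_mono) auto
      also have "\<dots> = ((1/2) ^ j) powr (s - \<gamma>)" by (simp add: powr_add[symmetric])
      finally show ?thesis .
    qed
    then have "(\<Sum>j\<le>J. ((1/2) ^ j) powr s * (if norm (1 - cis x) \<le> (1/2) ^ j then ((1/2) ^ j) powr (-\<gamma>) else norm (1 - cis x) powr (-\<gamma>))
        * dyadic_mean u j x powr (2 / p)) \<le> (\<Sum>j\<le>J. ((1/2) ^ j) powr (s - \<gamma>) * dyadic_mean u j x powr (2 / p))"
      by (intro sum_mono mult_right_mono) auto
    then show "norm (cesaro_op \<mu> \<gamma> f (of_real r * cis x)) \<le> 2 powr \<gamma> * 12 powr (2 / p) * K *
      (\<Sum>j\<le>J. ((1/2) ^ j) powr (s - \<gamma>) * dyadic_mean u j x powr (2 / p))"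
      using K by (intro order_trans[OF u(4)] mult_left_mono) auto
  qed
qed

lemma continuous_on_cesaro_circle:
  assumes "0 \<le> r" "r < 1"
  shows "continuous_on {0..2*pi} (\<lambda>t. cesaro_op \<mu> \<gamma> f (of_real r * cis t))"
  by (rule continuous_on_compose2[OF holomorphic_on_imp_continuous_on[OF holomorphic_cesaro_op[OF f]]])
    (use assms in \<open>auto simp: norm_mult intro!: continuous_on_mult continuous_on_const continuous_on_cis continuous_on_id\<close>)

text \<open>As \<open>s - \<gamma> = 1 / p\<close>, each summand is the power \<open>1 / p\<close>
  of \<open>2^(-j) * (v j)^2\<close>. Because \<open>1 / p \<ge> 1\<close>, the sum of the powers is
  at most the power of the sum. The constant \<open>73728 * pi^3\<close> is
  \<open>36864 * pi^2\<close> times the \<open>2 * pi\<close> from the norm.\<close>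

lemma cesaro_op_bound_sup:
  assumes p1: "p \<le> 1" and s: "s = \<gamma> + 1 / p" and z: "norm z < 1"
  shows "norm (cesaro_op \<mu> \<gamma> f z) \<le> 2 powr \<gamma> * 12 powr (2 / p) * (73728 * pi ^ 3) powr (1 / p) * K * A"
proof -
  define r where "r = norm z"
  have r: "0 \<le> r" "r < 1" using z by (auto simp: r_def)
  define x where "x = Arg2pi z"
  have x: "x \<in> {0..2*pi}" using Arg2pi[of z] by (auto simp: x_def)
  have zrx: "z = of_real r * cis x" using Arg2pi[of z] by (simp add: r_def x_def cis_conv_exp is_Arg_def)
  obtain u J where u: "continuous_on {0..2*pi} u" "\<And>x. 0 \<le> u x" "integral {0..2*pi} (\<lambda>t. (u t)\<^sup>2) \<le> 2 * pi * A powr p"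
    "\<And>x. norm (cesaro_op \<mu> \<gamma> f (of_real r * cis x)) \<le> 2 powr \<gamma> * 12 powr (2 / p) * K *
      (\<Sum>j\<le>J. ((1/2) ^ j) powr (s - \<gamma>) * dyadic_mean u j x powr (2 / p))"
    using norm_cesaro_op_le'[OF r] by blast
  have "(\<Sum>j\<le>J. ((1/2) ^ j) powr (s - \<gamma>) * dyadic_mean u j x powr (2 / p)) = (\<Sum>j\<le>J. ((1/2) ^ j * (dyadic_mean u j x)\<^sup>2) powr (1 / p))"
  proof (intro sum.cong refl)
    fix j
    have "dyadic_mean u j x powr (2 / p) = ((dyadic_mean u j x)\<^sup>2) powr (1 / p)"
      using dyadic_mean_nonneg[OF u(1,2), of j x] by (simp add: powr_powr flip: powr_numeral)
    then show "((1/2) ^ j) powr (s - \<gamma>) * dyadic_mean u j x powr (2 / p) = ((1/2) ^ j * (dyadic_mean u j x)\<^sup>2) powr (1 / p)"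
      by (simp add: s powr_mult)
  qed
  also have "\<dots> \<le> (\<Sum>j\<le>J. (1/2) ^ j * (dyadic_mean u j x)\<^sup>2) powr (1 / p)"
    using p p1 by (intro sum_powr_le_powr_sum) auto
  also have "\<dots> \<le> (73728 * pi ^ 3 * A powr p) powr (1 / p)"
  proof (intro powr_mono2)
    have "(\<Sum>j\<le>J. (1/2) ^ j * (dyadic_mean u j x)\<^sup>2) \<le> 36864 * pi\<^sup>2 * integral {0..2*pi} (\<lambda>y. (u y)\<^sup>2)"
      by (rule sum_dyadic_mean_square_le[OF u(1,2) x])
    also have "\<dots> \<le> 36864 * pi\<^sup>2 * (2 * pi * A powr p)" by (intro mult_left_mono u(3)) auto
    also have "\<dots> = 73728 * pi ^ 3 * A powr p" by (simp add: power2_eq_square power3_eq_cube)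
    finally show "(\<Sum>j\<le>J. (1/2) ^ j * (dyadic_mean u j x)\<^sup>2) \<le> 73728 * pi ^ 3 * A powr p" .
  qed (use p in \<open>auto intro!: sum_nonneg\<close>)
  also have "\<dots> = (73728 * pi ^ 3) powr (1 / p) * A"
    using p A0 by (simp add: powr_mult powr_powr)
  finally have "2 powr \<gamma> * 12 powr (2 / p) * K * (\<Sum>j\<le>J. ((1/2) ^ j) powr (s - \<gamma>) * dyadic_mean u j x powr (2 / p))
    \<le> 2 powr \<gamma> * 12 powr (2 / p) * K * ((73728 * pi ^ 3) powr (1 / p) * A)"
    using K by (intro mult_left_mono) auto
  with u(4)[of x] show ?thesis unfolding zrx by (simp add: mult_ac)
qed

text \<open>With \<open>a = 1/p - 1/q\<close>, positive since \<open>p < q\<close>, and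
  \<open>b = 1/q\<close>, each summand is bounded through the maximal function by
  \<open>V powr (2 / p) * 2^(-j a)\<close> and through the growth bound by
  \<open>B * 2^(j b)\<close>. The sum of the minima is of order
  \<open>V powr (2 / q) * B powr (1 - p / q)\<close>, whose \<open>q\<close>-th power contains
  exactly \<open>V^2\<close>.\<close>

lemma cesaro_op_bound_gt:
  assumes q: "p < q" and s: "s = \<gamma> + 1 / p - 1 / q" and r: "0 \<le> r" "r < 1"
  defines "c \<equiv> 1 / (1 - 2 powr (- (1 / p - 1 / q))) + 1 / (1 - 2 powr (- (1 / q)))"
  shows "integral {0..2*pi} (\<lambda>t. norm (cesaro_op \<mu> \<gamma> f (of_real r * cis t)) powr q)
    \<le> 2 * pi * ((2 powr \<gamma> * 12 powr (2 / p) * c * ((8 * pi\<^sup>2) powr ((q - p) / p) * (2048 * pi\<^sup>2)) powr (1 / q)) * K * A) powr q"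
proof -
  obtain u J where u: "continuous_on {0..2*pi} u" "\<And>x. 0 \<le> u x" "integral {0..2*pi} (\<lambda>t. (u t)\<^sup>2) \<le> 2 * pi * A powr p"
    "\<And>x. norm (cesaro_op \<mu> \<gamma> f (of_real r * cis x)) \<le> 2 powr \<gamma> * 12 powr (2 / p) * K *
      (\<Sum>j\<le>J. ((1/2) ^ j) powr (s - \<gamma>) * dyadic_mean u j x powr (2 / p))"
    using norm_cesaro_op_le'[OF r] by blast
  note dn = dyadic_mean_nonneg[OF u(1,2)]
  define a where "a = 1 / p - 1 / q"
  define b where "b = 1 / q"
  have a: "0 < a" using p q by (simp add: a_def divide_simps)
  have b: "0 < b" using p q by (simp add: b_def)
  have ab: "a + b = 1 / p" by (simp add: a_def b_def)
  have bab: "b / (a + b) = p / q" unfolding ab by (simp add: b_def)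
  have aab: "a / (a + b) = 1 - p / q" unfolding ab using p by (simp add: a_def algebra_simps)
  have pos: "2 powr (-e) < (1::real)" if "0 < e" for e :: real using powr_less_mono[of "-e" 0 2] that by simp
  have c_eq: "c = 1 / (1 - 2 powr (-a)) + 1 / (1 - 2 powr (-b))" by (simp only: c_def a_def b_def)
  have c: "0 \<le> c" using pos[OF a] pos[OF b] by (simp add: c_eq)
  \<comment> \<open>\<open>4 * pi\<close> from \<open>dyadic_mean_square_le\<close> times
    \<open>2 * pi\<close> from the norm gives \<open>8 * pi^2\<close>.\<close>
  define B where "B = (8 * pi\<^sup>2) powr (1 / p) * A"
  have B: "0 \<le> B" using A0 by (simp add: B_def)
  define V where "V t = Max ((\<lambda>j. dyadic_mean u j t) ` {..J})" for t
  have V: "dyadic_mean u j t \<le> V t" if "j \<le> J" for j t unfolding V_def using that by (intro Max_ge) auto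
  have V0: "0 \<le> V t" for t using V[of 0 t] dn[of 0 t] by simp
  have V_ex: "\<exists>i\<le>J. V t \<le> dyadic_mean u i t" for t
  proof -
    have "V t \<in> (\<lambda>j. dyadic_mean u j t) ` {..J}" unfolding V_def by (intro Max_in) auto
    then obtain i where "V t = dyadic_mean u i t" "i \<in> {..J}" by (rule imageE)
    then show ?thesis by auto
  qed
  have V_int: "(\<integral>\<^sup>+t. ennreal ((V t)\<^sup>2) \<partial>circle_measure) \<le> ennreal (2048 * pi\<^sup>2 * (2 * pi * A powr p))"
    using V0 V_ex u(3) by (intro order_trans[OF maximal_dyadic_mean[OF u(1,2), where J = J]] ennreal_leI mult_left_mono) auto
  define E where "E = 2 powr \<gamma> * 12 powr (2 / p) * K * c"
  have E: "0 \<le> E" using K c by (simp add: E_def)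
  have pt: "norm (cesaro_op \<mu> \<gamma> f (of_real r * cis x)) powr q \<le> (E powr q * B powr (q - p)) * (V x)\<^sup>2" for x
  proof -
    have "(\<Sum>j\<le>J. ((1/2) ^ j) powr (s - \<gamma>) * dyadic_mean u j x powr (2 / p))
      \<le> (\<Sum>j\<le>J. min (V x powr (2 / p) * ((1/2) ^ j) powr a) (B * ((1/2) ^ j) powr (-b)))"
    proof (intro sum_mono min.boundedI)
      fix j assume j: "j \<in> {..J}"
      have sa: "s - \<gamma> = a" by (simp add: s a_def)
      have "dyadic_mean u j x powr (2 / p) \<le> V x powr (2 / p)"
        using V j dn p by (intro powr_mono2) auto
      then show "((1/2) ^ j) powr (s - \<gamma>) * dyadic_mean u j x powr (2 / p) \<le> V x powr (2 / p) * ((1/2) ^ j) powr a"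
        unfolding sa by (subst mult.commute) (intro mult_right_mono, auto)
      have "dyadic_mean u j x powr (2 / p) = ((dyadic_mean u j x)\<^sup>2) powr (1 / p)"
        using dn[of j x] by (simp add: powr_powr flip: powr_numeral)
      also have "\<dots> \<le> (8 * pi\<^sup>2 * A powr p * 2 ^ j) powr (1 / p)"
      proof (intro powr_mono2)
        have "(dyadic_mean u j x)\<^sup>2 \<le> 4 * pi * 2 ^ j * integral {0..2*pi} (\<lambda>y. (u y)\<^sup>2)"
          by (rule dyadic_mean_square_le[OF u(1,2)])
        also have "\<dots> \<le> 4 * pi * 2 ^ j * (2 * pi * A powr p)" by (intro mult_left_mono u(3)) auto
        finally show "(dyadic_mean u j x)\<^sup>2 \<le> 8 * pi\<^sup>2 * A powr p * 2 ^ j" by (simp add: power2_eq_square mult_ac)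
      qed (use p in auto)
      also have "\<dots> = B * ((1/2) ^ j) powr (- (1 / p))"
        using p A0 by (simp add: B_def powr_mult powr_powr powr_minus powr_divide power_divide)
      finally have "((1/2) ^ j) powr a * dyadic_mean u j x powr (2 / p) \<le> ((1/2) ^ j) powr a * (B * ((1/2) ^ j) powr (- (1 / p)))"
        by (intro mult_left_mono) auto
      also have "\<dots> = B * ((1/2) ^ j) powr (a + - (1 / p))" by (simp only: powr_add mult_ac)
      also have "a + - (1 / p) = -b" using ab by simp
      finally show "((1/2) ^ j) powr (s - \<gamma>) * dyadic_mean u j x powr (2 / p) \<le> B * ((1/2) ^ j) powr (-b)"
        unfolding sa .
    qed
    also have "\<dots> \<le> c * ((V x powr (2 / p)) powr (p / q) * B powr (1 - p / q))"
      using sum_min_dyadic_le[OF a b powr_ge_zero B] unfolding aab bab c_eq .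
    also have "(V x powr (2 / p)) powr (p / q) = V x powr (2 / q)" using p by (simp add: powr_powr)
    finally have "norm (cesaro_op \<mu> \<gamma> f (of_real r * cis x)) \<le> 2 powr \<gamma> * 12 powr (2 / p) * K * (c * (V x powr (2 / q) * B powr (1 - p / q)))"
      using K by (intro order_trans[OF u(4)] mult_left_mono) auto
    also have "\<dots> = E * (V x powr (2 / q) * B powr (1 - p / q))" by (simp add: E_def)
    finally have "norm (cesaro_op \<mu> \<gamma> f (of_real r * cis x)) powr q \<le> (E * (V x powr (2 / q) * B powr (1 - p / q))) powr q"
      using p q by (intro powr_mono2) auto
    also have "\<dots> = E powr q * (V x powr 2 * B powr (q - p))"
    proof -
      have "(1 - p / q) * q = q - p" using p q by (simp add: field_simps)
      then show ?thesis using p q E B by (simp add: powr_mult powr_powr)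
    qed
    also have "\<dots> = (E powr q * B powr (q - p)) * (V x)\<^sup>2" using V0[of x] by (simp add: mult_ac)
    finally show ?thesis .
  qed
  have "integral {0..2*pi} (\<lambda>t. norm (cesaro_op \<mu> \<gamma> f (of_real r * cis t)) powr q)
    \<le> (E powr q * B powr (q - p)) * (2048 * pi\<^sup>2 * (2 * pi * A powr p))"
    using p q by (intro integral_le_of_nn_integral_le[OF _ _ _ pt V_int] continuous_on_powr' continuous_on_norm
      continuous_on_cesaro_circle r continuous_on_const) auto
  also have "\<dots> = 2 * pi * ((2 powr \<gamma> * 12 powr (2 / p) * c * ((8 * pi\<^sup>2) powr ((q - p) / p) * (2048 * pi\<^sup>2)) powr (1 / q)) * K * A) powr q"
  proof -
    have Aq: "A powr q = A powr (q - p) * A powr p" by (simp add: powr_add[symmetric])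
    have "((2 powr \<gamma> * 12 powr (2 / p) * c * ((8 * pi\<^sup>2) powr ((q - p) / p) * (2048 * pi\<^sup>2)) powr (1 / q)) * K * A) powr q
      = (E * ((8 * pi\<^sup>2) powr ((q - p) / p) * (2048 * pi\<^sup>2)) powr (1 / q) * A) powr q"
      by (simp add: E_def mult_ac)
    also have "\<dots> = E powr q * ((8 * pi\<^sup>2) powr ((q - p) / p) * (2048 * pi\<^sup>2)) * A powr q"
    proof -
      have "(((8 * pi\<^sup>2) powr ((q - p) / p) * (2048 * pi\<^sup>2)) powr (1 / q)) powr q = (8 * pi\<^sup>2) powr ((q - p) / p) * (2048 * pi\<^sup>2)"
        using p q unfolding powr_powr by (simp add: powr_one)
      then show ?thesis using E A0 by (simp only: powr_mult)
    qed
    finally have 1: "((2 powr \<gamma> * 12 powr (2 / p) * c * ((8 * pi\<^sup>2) powr ((q - p) / p) * (2048 * pi\<^sup>2)) powr (1 / q)) * K * A) powr q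
      = E powr q * ((8 * pi\<^sup>2) powr ((q - p) / p) * (2048 * pi\<^sup>2)) * A powr q" .
    have "B powr (q - p) = (8 * pi\<^sup>2) powr ((q - p) / p) * A powr (q - p)"
      unfolding B_def using A0 by (simp add: powr_mult powr_powr)
    then show ?thesis unfolding 1 Aq by (simp add: mult_ac)
  qed
  finally show ?thesis .
qed

text \<open>Here \<open>2^(-j s)\<close> exactly cancels \<open>2^(j \<gamma>)\<close>, so the
  sharper weight away from the point 1 is kept. Subadditivity of the \<open>p\<close>-th power moves
  it inside the sum, turns \<open>v j powr (2 / p)\<close> into \<open>(v j)^2\<close> and leaves
  the weight exponent \<open>\<gamma> * p\<close>.\<close>

lemma cesaro_op_bound_eq:
  assumes p1: "p < 1" and s: "s = \<gamma>" and r: "0 \<le> r" "r < 1"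
  defines "c \<equiv> (72 * pi * 36864 + 2048 / (1 - 2 powr (- (\<gamma> * p)))) * pi\<^sup>2"
  shows "integral {0..2*pi} (\<lambda>t. norm (cesaro_op \<mu> \<gamma> f (of_real r * cis t)) powr p)
    \<le> 2 * pi * ((2 powr \<gamma> * 12 powr (2 / p) * c powr (1 / p)) * K * A) powr p"
proof -
  have a: "0 < \<gamma> * p" using gamma_pos p by simp
  have "2 powr (- (\<gamma> * p)) < 1" using powr_less_mono[of "- (\<gamma> * p)" 0 2] a by simp
  then have c: "0 \<le> c" by (simp add: c_def)
  obtain u J where u: "continuous_on {0..2*pi} u" "\<And>x. 0 \<le> u x" "integral {0..2*pi} (\<lambda>t. (u t)\<^sup>2) \<le> 2 * pi * A powr p"
    "\<And>x. norm (cesaro_op \<mu> \<gamma> f (of_real r * cis x)) \<le> 2 powr \<gamma> * 12 powr (2 / p) * K *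
      (\<Sum>j\<le>J. ((1/2) ^ j) powr s * (if norm (1 - cis x) \<le> (1/2) ^ j then ((1/2) ^ j) powr (-\<gamma>) else norm (1 - cis x) powr (-\<gamma>))
        * dyadic_mean u j x powr (2 / p))"
    using norm_cesaro_op_le[OF f p K carleson r A] by blast
  note dn = dyadic_mean_nonneg[OF u(1,2)]
  define E where "E = 2 powr \<gamma> * 12 powr (2 / p) * K"
  have E: "0 \<le> E" using K by (simp add: E_def)
  define S where "S t = (\<Sum>j\<le>J. (if norm (1 - cis t) \<le> (1/2) ^ j then 1 else ((1/2) ^ j / norm (1 - cis t)) powr (\<gamma> * p)) * (dyadic_mean u j t)\<^sup>2)" for t
  have pt: "norm (cesaro_op \<mu> \<gamma> f (of_real r * cis x)) powr p \<le> E powr p * S x" for x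
  proof -
    define T where "T j = ((1/2) ^ j) powr s * (if norm (1 - cis x) \<le> (1/2) ^ j then ((1/2) ^ j) powr (-\<gamma>) else norm (1 - cis x) powr (-\<gamma>))
        * dyadic_mean u j x powr (2 / p)" for j :: nat
    have T0: "0 \<le> T j" for j by (simp add: T_def)
    have "norm (cesaro_op \<mu> \<gamma> f (of_real r * cis x)) powr p \<le> (E * (\<Sum>j\<le>J. T j)) powr p"
      using u(4)[of x] p by (intro powr_mono2) (auto simp: E_def T_def)
    also have "\<dots> = E powr p * (\<Sum>j\<le>J. T j) powr p"
      using E T0 by (simp add: powr_mult sum_nonneg)
    also have "\<dots> \<le> E powr p * (\<Sum>j\<le>J. T j powr p)"
      using p p1 T0 by (intro mult_left_mono powr_sum_le_sum_powr) auto
    also have "(\<Sum>j\<le>J. T j powr p) = S x"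
      unfolding S_def
    proof (intro sum.cong refl)
      fix j
      have "(dyadic_mean u j x powr (2 / p)) powr p = (dyadic_mean u j x)\<^sup>2"
        using p dn[of j x] by (simp add: powr_powr)
      moreover have "(((1/2) ^ j) powr s * (if norm (1 - cis x) \<le> (1/2) ^ j then ((1/2) ^ j) powr (-\<gamma>) else norm (1 - cis x) powr (-\<gamma>))) powr p
         = (if norm (1 - cis x) \<le> (1/2) ^ j then 1 else ((1/2) ^ j / norm (1 - cis x)) powr (\<gamma> * p))"
        by (auto simp: s powr_mult powr_powr powr_divide powr_minus divide_simps powr_add[symmetric])
      ultimately show "T j powr p = (if norm (1 - cis x) \<le> (1/2) ^ j then 1 else ((1/2) ^ j / norm (1 - cis x)) powr (\<gamma> * p)) * (dyadic_mean u j x)\<^sup>2"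
        unfolding T_def by (subst powr_mult) simp
    qed
    finally show ?thesis .
  qed
  have "(\<integral>\<^sup>+t. ennreal (S t) \<partial>circle_measure) \<le> ennreal (c * integral {0..2*pi} (\<lambda>y. (u y)\<^sup>2))"
    unfolding S_def c_def by (rule nn_integral_weighted_dyadic_mean_le[OF u(1,2) a])
  also have "\<dots> \<le> ennreal (c * (2 * pi * A powr p))" by (intro ennreal_leI mult_left_mono u(3) c)
  finally have S_int: "(\<integral>\<^sup>+t. ennreal (S t) \<partial>circle_measure) \<le> ennreal (c * (2 * pi * A powr p))" .
  have "integral {0..2*pi} (\<lambda>t. norm (cesaro_op \<mu> \<gamma> f (of_real r * cis t)) powr p) \<le> E powr p * (c * (2 * pi * A powr p))"
    using p c by (intro integral_le_of_nn_integral_le[OF _ _ _ pt S_int] continuous_on_powr' continuous_on_norm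
      continuous_on_cesaro_circle r continuous_on_const) auto
  also have "\<dots> = 2 * pi * ((2 powr \<gamma> * 12 powr (2 / p) * c powr (1 / p)) * K * A) powr p"
  proof -
    have "((2 powr \<gamma> * 12 powr (2 / p) * c powr (1 / p)) * K * A) powr p = (E * c powr (1 / p) * A) powr p"
      by (simp add: E_def mult_ac)
    also have "\<dots> = E powr p * c * A powr p"
      using E A0 c p by (simp add: powr_mult powr_powr)
    finally show ?thesis by simp
  qed
  finally show ?thesis .
qed

end

end

section \<open>Lower bounds and the theorem\<close>

lemma hardy_norm_le_iff:
  assumes p: "0 < p" and A: "0 \<le> A"
  shows "hardy_norm (ennreal p) f \<le> ennreal A \<longleftrightarrow>
    (\<forall>r\<in>{0..<1}. integral {0..2*pi} (\<lambda>t. norm (f (of_real r * cis t)) powr p) \<le> 2 * pi * A powr p)"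
proof -
  have "ennreal ((1 / (2 * pi) * integral {0..2*pi} (\<lambda>t. norm (f (of_real r * cis t)) powr p)) powr (1 / p)) \<le> ennreal A
    \<longleftrightarrow> integral {0..2*pi} (\<lambda>t. norm (f (of_real r * cis t)) powr p) \<le> 2 * pi * A powr p" for r
  proof -
    define I where "I = integral {0..2*pi} (\<lambda>t. norm (f (of_real r * cis t)) powr p)"
    \<comment> \<open>A non-integrable integrand has \<open>integral\<close> 0 by convention, so the
      mean is nonnegative in either case.\<close>
    have I: "0 \<le> I"
    proof (cases "(\<lambda>t. norm (f (of_real r * cis t)) powr p) integrable_on {0..2*pi}")
      case True
      then show ?thesis unfolding I_def by (rule integral_nonneg) auto
    qed (simp add: I_def not_integrable_integral)
    define m where "m = 1 / (2 * pi) * I"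
    have m: "0 \<le> m" using I by (simp add: m_def)
    have "m powr (1 / p) \<le> A \<longleftrightarrow> m \<le> A powr p"
    proof
      assume "m powr (1 / p) \<le> A"
      then have "(m powr (1 / p)) powr p \<le> A powr p" using p by (intro powr_mono2) auto
      then show "m \<le> A powr p" using p m by (simp add: powr_powr)
    next
      assume "m \<le> A powr p"
      then have "m powr (1 / p) \<le> (A powr p) powr (1 / p)" using p m by (intro powr_mono2) auto
      then show "m powr (1 / p) \<le> A" using p A by (simp add: powr_powr)
    qed
    also have "m \<le> A powr p \<longleftrightarrow> I \<le> 2 * pi * A powr p" by (simp add: m_def field_simps)
    finally show ?thesis using A unfolding I_def[symmetric] m_def by (simp add: ennreal_le_iff)
  qed
  then show ?thesis using p by (simp add: hardy_norm_def SUP_le_iff)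
qed

lemma hardy_norm_infinity_le_iff:
  assumes "0 \<le> A"
  shows "hardy_norm \<infinity> f \<le> ennreal A \<longleftrightarrow> (\<forall>z\<in>ball 0 1. norm (f z) \<le> A)"
  using assms by (simp add: hardy_norm_def SUP_le_iff ennreal_le_iff)

text \<open>Poisson domination for the dilation by the midpoint radius \<open>R\<close>, at
  \<open>w = z / R\<close>: the kernel is at most \<open>(1 + |w|) / (1 - |w|)\<close>, and
  \<open>1 - |w| \<ge> (1 - |z|) / 2\<close>.\<close>

lemma norm_powr_growth:
  assumes g: "g holomorphic_on ball 0 1" and q: "0 < q" and z: "norm z < 1"
    and N: "\<And>r. r \<in> {0..<1} \<Longrightarrow> integral {0..2*pi} (\<lambda>t. norm (g (of_real r * cis t)) powr q) \<le> 2 * pi * N"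
  shows "norm (g z) powr q \<le> 4 / (1 - norm z) * N"
proof -
  define R where "R = (1 + norm z) / 2"
  have R: "0 < R" "R < 1" "norm z < R" using z by (auto simp: R_def add_pos_nonneg)
  define w where "w = z / of_real R"
  have w: "norm w = norm z / R" using R by (simp add: w_def norm_divide)
  then have w1: "norm w < 1" using R by simp
  have zw: "z = of_real R * w" using R by (simp add: w_def)
  have F: "(\<lambda>v. g (of_real R * v)) holomorphic_on ball 0 (1 / R)"
    by (rule holomorphic_on_compose_gen[OF _ g, unfolded o_def])
      (use R in \<open>auto simp: norm_mult field_simps intro!: holomorphic_intros\<close>)
  have cont: "continuous_on {0..2*pi} (\<lambda>t. g (of_real R * cis t))"
    by (rule continuous_on_compose2[OF holomorphic_on_imp_continuous_on[OF g]])
      (use R in \<open>auto simp: norm_mult intro!: continuous_on_mult continuous_on_const continuous_on_cis continuous_on_id\<close>)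
  then have cont': "continuous_on {0..2*pi} (\<lambda>t. norm (g (of_real R * cis t)) powr q)"
    using q by (intro continuous_on_powr' continuous_on_norm continuous_on_const) auto
  have P: "poisson_kernel w t \<le> 4 / (1 - norm z)" for t
  proof -
    have "1 - norm w \<le> norm (cis t - w)" using norm_triangle_ineq2[of "cis t" w] by simp
    then have "(1 - norm w)\<^sup>2 \<le> (norm (cis t - w))\<^sup>2" using w1 by (intro power_mono) auto
    then have "poisson_kernel w t \<le> (1 - (norm w)\<^sup>2) / (1 - norm w)\<^sup>2"
      unfolding poisson_kernel_def using w1 by (intro divide_left_mono mult_pos_pos) (auto simp: power_le_one cis_neq_of_norm_less)
    also have "\<dots> = (1 + norm w) / (1 - norm w)"
      using w1 by (simp add: divide_simps power2_eq_square) (simp add: algebra_simps)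
    also have "\<dots> \<le> 2 / ((1 - norm z) / 2)"
    proof (rule frac_le)
      have "(1 - norm z) / 2 = R - norm z" by (simp add: R_def field_simps)
      also have "\<dots> \<le> (R - norm z) / R" using R by (simp add: divide_simps mult_left_le)
      also have "\<dots> = 1 - norm w" using R by (simp add: w divide_simps)
      finally show "(1 - norm z) / 2 \<le> 1 - norm w" .
    qed (use w1 z in auto)
    finally show ?thesis by simp
  qed
  have "2 * pi * norm (g z) powr q \<le> integral {0..2*pi} (\<lambda>t. poisson_kernel w t * norm (g (of_real R * cis t)) powr q)"
    using poisson_dominated_holomorphic[OF q F] R w1 by (simp add: poisson_dominated_def zw)
  also have "\<dots> \<le> integral {0..2*pi} (\<lambda>t. 4 / (1 - norm z) * norm (g (of_real R * cis t)) powr q)"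
    by (intro integral_le integrable_continuous_interval continuous_on_mult continuous_on_const cont' continuous_on_poisson_kernel w1 mult_right_mono P) auto
  also have "\<dots> = 4 / (1 - norm z) * integral {0..2*pi} (\<lambda>t. norm (g (of_real R * cis t)) powr q)" by simp
  also have "\<dots> \<le> 4 / (1 - norm z) * (2 * pi * N)"
    using R z by (intro mult_left_mono N) auto
  finally have "2 * pi * norm (g z) powr q \<le> 2 * pi * (4 / (1 - norm z) * N)" by (simp add: mult_ac)
  then show ?thesis by (subst (asm) mult_le_cancel_left_pos) auto
qed

section \<open>Test functions concentrated near the point 1\<close>

definition test_function :: "real \<Rightarrow> real \<Rightarrow> complex \<Rightarrow> complex" where
  "test_function p a z = (1 - of_real a * z) powr (- of_real (2 / p))"

context
  fixes p a :: real
  assumes p: "0 < p" and a: "0 \<le> a" "a < 1"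
begin

lemma Re_one_minus_pos: "norm z \<le> 1 \<Longrightarrow> 0 < Re (1 - of_real a * z)"
proof -
  assume "norm z \<le> 1"
  then have "norm (of_real a * z) \<le> a" using a by (simp add: norm_mult mult_left_le)
  then show ?thesis using a complex_Re_le_cmod[of "of_real a * z"] by simp
qed

lemma holomorphic_test_function: "test_function p a holomorphic_on ball 0 1"
proof -
  have "1 - of_real a * z \<notin> \<real>\<^sub>\<le>\<^sub>0" if "z \<in> ball 0 1" for z :: complex
    using Re_one_minus_pos[of z] that unfolding complex_nonpos_Reals_iff by auto
  then show ?thesis unfolding test_function_def by (intro holomorphic_intros) auto
qed

text \<open>With the exponent \<open>2 / p\<close>, the function \<open>|f|\<^sup>p\<close> is a multiple of the Poisson kernel on each
  circle.\<close>

lemma hardy_norm_test_function: "hardy_norm (ennreal p) (test_function p a) \<le> ennreal ((1 - a) powr (- (1 / p)))"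
proof (subst hardy_norm_le_iff, safe)
  fix r :: real assume r: "r \<in> {0..<1}"
  define w where "w = complex_of_real (a * r)"
  have ar: "0 \<le> a * r" "a * r \<le> a" using a r by (auto intro: mult_left_le)
  then have w: "norm w < 1" "norm w = a * r" using a unfolding w_def norm_of_real by auto
  have "norm (test_function p a (of_real r * cis t)) powr p = 1 / (1 - (a * r)\<^sup>2) * poisson_kernel w t" for t
  proof -
    have "norm (1 - of_real a * (of_real r * cis t)) = norm (cis t * (cis (-t) - w))"
      by (simp add: w_def right_diff_distrib cis_mult mult_ac)
    also have "\<dots> = norm (cnj (cis t - w))" by (simp add: norm_mult w_def cis_cnj)
    also have "\<dots> = norm (cis t - w)" by (rule complex_mod_cnj)
    finally have n: "norm (1 - of_real a * (of_real r * cis t)) = norm (cis t - w)" .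
    have "norm (test_function p a (of_real r * cis t)) powr p = (norm (cis t - w) powr (- (2 / p))) powr p"
      unfolding test_function_def n[symmetric] by (subst norm_powr_real_powr') auto
    also have "\<dots> = norm (cis t - w) powr (- 2)" using p by (simp add: powr_powr)
    also have "\<dots> = 1 / (norm (cis t - w))\<^sup>2" by (simp add: powr_minus divide_inverse)
    also have "\<dots> = 1 / (1 - (a * r)\<^sup>2) * poisson_kernel w t"
    proof -
      have "(a * r)\<^sup>2 \<noteq> 1" using ar a by (auto simp: power2_eq_1_iff)
      then show ?thesis unfolding poisson_kernel_def w(2) by simp
    qed
    finally show ?thesis .
  qed
  then have "integral {0..2*pi} (\<lambda>t. norm (test_function p a (of_real r * cis t)) powr p)
    = 1 / (1 - (a * r)\<^sup>2) * (2 * pi)"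
    by (simp add: integral_poisson_kernel[OF w(1)])
  also have "\<dots> \<le> 1 / (1 - a) * (2 * pi)"
  proof (intro mult_right_mono divide_left_mono mult_pos_pos)
    have "(a * r)\<^sup>2 \<le> a * 1" unfolding power2_eq_square using ar a by (intro mult_mono) auto
    then show "1 - a \<le> 1 - (a * r)\<^sup>2" "0 < 1 - (a * r)\<^sup>2" using a by auto
  qed (use a in auto)
  also have "\<dots> = 2 * pi * ((1 - a) powr (- (1 / p))) powr p"
  proof -
    have "((1 - a) powr (- (1 / p))) powr p = (1 - a) powr (- 1)" using p by (simp add: powr_powr)
    then show ?thesis using a by (simp add: powr_minus divide_inverse)
  qed
  finally show "integral {0..2*pi} (\<lambda>t. norm (test_function p a (of_real r * cis t)) powr p)
    \<le> 2 * pi * ((1 - a) powr (- (1 / p))) powr p" .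
qed (use p in auto)

lemma test_function_in_hardy_space: "test_function p a \<in> hardy_space (ennreal p)"
  using holomorphic_test_function le_less_trans[OF hardy_norm_test_function] by (simp add: hardy_space_def)

text \<open>At \<open>z = a\<close> the integrand is positive, so its integral over
  \<open>[a, 1)\<close> bounds the value from below. There \<open>1 - t a \<le> 2 (1 - a)\<close>
  and \<open>1 - a^2 t \<le> 3 (1 - a)\<close>, which is where 2 and 3 come from.\<close>

lemma measure_le_cesaro_test_function:
  assumes "cesaro_measure \<mu> \<gamma>"
  shows "measure \<mu> {a..<1} \<le> 3 powr (2 / p) * 2 powr \<gamma> * (1 - a) powr (2 / p + \<gamma>) * norm (cesaro_op \<mu> \<gamma> (test_function p a) (of_real a))"
proof -
  interpret cesaro_measure \<mu> \<gamma> by fact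
  define g where "g t = (1 - a * (t * a)) powr (- (2 / p)) * (1 - t * a) powr (-\<gamma>)" for t
  have pos: "0 < 1 - t * a" "0 < 1 - a * (t * a)" if "t \<in> space \<mu>" for t
  proof -
    have "t * a \<le> a" "0 \<le> t * a" using that a by (auto simp: space_\<mu> intro: mult_left_le_one_le)
    moreover have "a * (t * a) \<le> a * 1" using calculation a by (intro mult_left_mono) auto
    ultimately show "0 < 1 - t * a" "0 < 1 - a * (t * a)" using a by auto
  qed
  have g_eq: "test_function p a (of_real t * of_real a) * (1 - of_real t * of_real a) powr (- of_real \<gamma>) = of_real (g t)" if t: "t \<in> space \<mu>" for t
    using powr_of_real[of "1 - a * (t * a)" "- (2 / p)"] powr_of_real[of "1 - t * a" "-\<gamma>"] pos[OF t]
    by (simp add: test_function_def g_def)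
  have na: "norm (complex_of_real a) < 1" using a by simp
  have "integrable \<mu> (\<lambda>t. complex_of_real (g t))"
    using integrable_cesaro[OF holomorphic_test_function na] g_eq by (simp cong: Bochner_Integration.integrable_cong)
  then have int_g: "integrable \<mu> g" by (simp only: complex_of_real_integrable_eq)
  have "cesaro_op \<mu> \<gamma> (test_function p a) (of_real a) = (LINT t|\<mu>. complex_of_real (g t))"
    unfolding cesaro_op_eq_integral[OF holomorphic_test_function na] using g_eq by (intro Bochner_Integration.integral_cong) auto
  also have "\<dots> = of_real (LINT t|\<mu>. g t)" by (rule integral_of_real[OF int_g])
  finally have T: "cesaro_op \<mu> \<gamma> (test_function p a) (of_real a) = of_real (LINT t|\<mu>. g t)" .
  define c where "c = (3 * (1 - a)) powr (- (2 / p)) * (2 * (1 - a)) powr (-\<gamma>)"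
  have "c * measure \<mu> {a..<1} = (LINT t|\<mu>. indicator {a..<1} t * c)"
    using interval_in_sets_\<mu>[OF a(1)] a by (simp add: space_\<mu> max_absorb1 mult.commute)
  also have "\<dots> \<le> (LINT t|\<mu>. g t)"
  proof (rule integral_mono[OF _ int_g])
    show "integrable \<mu> (\<lambda>t. indicator {a..<1} t * c)"
      using interval_in_sets_\<mu>[OF a(1)] by (intro integrable_mult_left integrable_real_indicator) (auto simp: emeasure_eq_measure)
    fix t assume t: "t \<in> space \<mu>"
    show "indicator {a..<1} t * c \<le> g t"
    proof (cases "a \<le> t")
      case True
      then have "a * a \<le> t * a" using a by (intro mult_right_mono)
      moreover have aa: "(1 - a) * (1 - a) \<ge> 0" by simp
      ultimately have 1: "1 - t * a \<le> 2 * (1 - a)" by (simp add: algebra_simps)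
      have "a * (1 - t * a) \<le> 1 * (1 - t * a)" using a pos[OF t] by (intro mult_right_mono) auto
      then have 2: "1 - a * (t * a) \<le> 3 * (1 - a)" using 1 by (simp add: algebra_simps)
      have "c \<le> g t" unfolding c_def g_def
        using pos[OF t] 1 2 p gamma_pos by (intro mult_mono powr_mono2') auto
      then show ?thesis by (simp add: indicator_def g_def)
    qed (simp add: indicator_def g_def)
  qed
  also have "\<dots> \<le> norm (cesaro_op \<mu> \<gamma> (test_function p a) (of_real a))" unfolding T by simp
  finally have le: "c * measure \<mu> {a..<1} \<le> norm (cesaro_op \<mu> \<gamma> (test_function p a) (of_real a))" .
  define d where "d = 3 powr (2 / p) * 2 powr \<gamma> * (1 - a) powr (2 / p + \<gamma>)"
  have "d * c = 1"
  proof -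
    define x where "x = 1 - a"
    have "0 < x" using a by (simp add: x_def)
    then show ?thesis unfolding c_def d_def x_def[symmetric] by (simp add: powr_mult powr_minus powr_add field_simps)
  qed
  then have "measure \<mu> {a..<1} = d * (c * measure \<mu> {a..<1})" by (simp add: mult.assoc[symmetric])
  also have "\<dots> \<le> d * norm (cesaro_op \<mu> \<gamma> (test_function p a) (of_real a))"
    by (intro mult_left_mono le) (simp add: d_def)
  finally show ?thesis unfolding d_def .
qed

end

section \<open>Norm bounds against Carleson bounds\<close>

lemma cesaro_measureI: "finite_measure_01 \<mu> \<Longrightarrow> 0 < \<gamma> \<Longrightarrow> cesaro_measure \<mu> \<gamma>"
  by (simp add: cesaro_measure_def)

lemma hardy_bound_test_function:
  assumes p: "0 < p" and a: "0 \<le> a" "a < 1" and B: "hardy_bound T (ennreal p) q B"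
  shows "T (test_function p a) \<in> hardy_space q" "hardy_norm q (T (test_function p a)) \<le> ennreal (B * (1 - a) powr (- (1 / p)))"
proof -
  have B0: "0 \<le> B" using B by (simp add: hardy_bound_def)
  have in_space: "test_function p a \<in> hardy_space (ennreal p)" by (rule test_function_in_hardy_space[OF p a])
  then show "T (test_function p a) \<in> hardy_space q" using B by (simp add: hardy_bound_def)
  have "hardy_norm q (T (test_function p a)) \<le> ennreal B * hardy_norm (ennreal p) (test_function p a)"
    using B in_space by (simp add: hardy_bound_def)
  also have "\<dots> \<le> ennreal B * ennreal ((1 - a) powr (- (1 / p)))"
    by (intro mult_left_mono hardy_norm_test_function p a) auto
  finally show "hardy_norm q (T (test_function p a)) \<le> ennreal (B * (1 - a) powr (- (1 / p)))"
    using B0 by (simp add: ennreal_mult)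
qed

text \<open>Of the exponent \<open>2 / p + \<gamma>\<close> gained at the point \<open>a\<close>,
  the norm of the test function takes \<open>1 / p\<close> and the growth of \<open>H^q\<close>
  functions at \<open>a\<close> takes \<open>1 / q\<close>.\<close>

lemma carleson_of_hardy_bound_finite:
  assumes p: "0 < p" and q: "0 < q" and g: "0 < \<gamma>" and \<mu>: "finite_measure_01 \<mu>"
    and B: "hardy_bound (cesaro_op \<mu> \<gamma>) (ennreal p) (ennreal q) B" and a: "0 \<le> a" "a < 1"
  shows "measure \<mu> {a..<1} \<le> (3 powr (2 / p) * 2 powr \<gamma> * 4 powr (1 / q)) * B * (1 - a) powr (\<gamma> + 1 / p - 1 / q)"
proof -
  have B0: "0 \<le> B" using B by (simp add: hardy_bound_def)
  define A where "A = B * (1 - a) powr (- (1 / p))"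
  have A: "0 \<le> A" using B0 by (simp add: A_def)
  define h where "h = cesaro_op \<mu> \<gamma> (test_function p a)"
  have h: "h \<in> hardy_space (ennreal q)" "hardy_norm (ennreal q) h \<le> ennreal A"
    using hardy_bound_test_function[OF p a B] by (simp_all add: h_def A_def)
  have "norm (h (of_real a)) powr q \<le> 4 / (1 - norm (complex_of_real a)) * A powr q"
    using h(2)[unfolded hardy_norm_le_iff[OF q A]] h(1) a by (intro norm_powr_growth q) (auto simp: hardy_space_def)
  then have "(norm (h (of_real a)) powr q) powr (1 / q) \<le> (4 / (1 - a) * A powr q) powr (1 / q)"
    using a q by (intro powr_mono2) auto
  also have "\<dots> = 4 powr (1 / q) * (1 - a) powr (- (1 / q)) * A"
  proof -
    have "4 / (1 - a) = 4 * (1 - a) powr (- 1)" using a by (simp add: powr_minus divide_inverse)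
    then show ?thesis unfolding powr_mult powr_powr using a q A by (simp only: powr_mult powr_powr) simp
  qed
  finally have "norm (h (of_real a)) \<le> 4 powr (1 / q) * (1 - a) powr (- (1 / q)) * A" using q by (simp add: powr_powr)
  then have "measure \<mu> {a..<1} \<le> 3 powr (2 / p) * 2 powr \<gamma> * (1 - a) powr (2 / p + \<gamma>) * (4 powr (1 / q) * (1 - a) powr (- (1 / q)) * A)"
    unfolding h_def by (intro order_trans[OF measure_le_cesaro_test_function[OF p a cesaro_measureI[OF \<mu> g]]] mult_left_mono) auto
  also have "\<dots> = 3 powr (2 / p) * 2 powr \<gamma> * 4 powr (1 / q) * B * ((1 - a) powr (2 / p + \<gamma>) * (1 - a) powr (- (1 / q)) * (1 - a) powr (- (1 / p)))"
    by (simp add: A_def mult_ac)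
  also have "(1 - a) powr (2 / p + \<gamma>) * (1 - a) powr (- (1 / q)) * (1 - a) powr (- (1 / p)) = (1 - a) powr (\<gamma> + 1 / p - 1 / q)"
    by (simp add: powr_add[symmetric] add_divide_distrib[symmetric] diff_divide_distrib[symmetric])
      (simp add: field_simps)
  finally show ?thesis .
qed

lemma carleson_of_hardy_bound_infinity:
  assumes p: "0 < p" and g: "0 < \<gamma>" and \<mu>: "finite_measure_01 \<mu>"
    and B: "hardy_bound (cesaro_op \<mu> \<gamma>) (ennreal p) \<infinity> B" and a: "0 \<le> a" "a < 1"
  shows "measure \<mu> {a..<1} \<le> (3 powr (2 / p) * 2 powr \<gamma>) * B * (1 - a) powr (\<gamma> + 1 / p)"
proof -
  have B0: "0 \<le> B" using B by (simp add: hardy_bound_def)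
  define A where "A = B * (1 - a) powr (- (1 / p))"
  have A: "0 \<le> A" using B0 by (simp add: A_def)
  have "norm (cesaro_op \<mu> \<gamma> (test_function p a) (of_real a)) \<le> A"
    using hardy_bound_test_function(2)[OF p a B, folded A_def] a unfolding hardy_norm_infinity_le_iff[OF A] by simp
  then have "measure \<mu> {a..<1} \<le> 3 powr (2 / p) * 2 powr \<gamma> * (1 - a) powr (2 / p + \<gamma>) * A"
    by (intro order_trans[OF measure_le_cesaro_test_function[OF p a cesaro_measureI[OF \<mu> g]]] mult_left_mono) auto
  also have "\<dots> = 3 powr (2 / p) * 2 powr \<gamma> * B * ((1 - a) powr (2 / p + \<gamma>) * (1 - a) powr (- (1 / p)))"
    by (simp add: A_def mult_ac)
  also have "(1 - a) powr (2 / p + \<gamma>) * (1 - a) powr (- (1 / p)) = (1 - a) powr (\<gamma> + 1 / p)"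
    by (simp add: powr_add[symmetric] add_divide_distrib[symmetric] diff_divide_distrib[symmetric])
      (simp add: field_simps)
  finally show ?thesis .
qed

text \<open>\<open>A\<close> carries the norm of \<open>f\<close> in terms of integral means, the
  form in which the three upper bounds accept it. \<open>C + 1\<close> replaces \<open>C\<close>
  because the final constants have to be positive while \<open>C\<close> is only known to be
  nonnegative.\<close>

lemma hardy_boundI:
  assumes p: "0 < p" and C: "0 \<le> C" and K: "0 \<le> K"
    and hol: "\<And>f. f holomorphic_on ball 0 1 \<Longrightarrow> T f holomorphic_on ball 0 1"
    and bound: "\<And>f A. f holomorphic_on ball 0 1 \<Longrightarrow> 0 \<le> A \<Longrightarrow>
      (\<And>r. 0 \<le> r \<Longrightarrow> r < 1 \<Longrightarrow> integral {0..2*pi} (\<lambda>t. norm (f (of_real r * cis t)) powr p) \<le> 2 * pi * A powr p) \<Longrightarrow>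
      hardy_norm q (T f) \<le> ennreal (C * K * A)"
  shows "hardy_bound T (ennreal p) q ((C + 1) * K)"
  unfolding hardy_bound_def
proof (intro conjI ballI)
  show "0 \<le> (C + 1) * K" using C K by simp
  fix f assume f: "f \<in> hardy_space (ennreal p)"
  define A where "A = enn2real (hardy_norm (ennreal p) f)"
  have A: "hardy_norm (ennreal p) f = ennreal A" "0 \<le> A" using f by (auto simp: A_def hardy_space_def less_top)
  have hf: "f holomorphic_on ball 0 1" using f by (simp add: hardy_space_def)
  have "hardy_norm (ennreal p) f \<le> ennreal A" using A by simp
  then have "hardy_norm q (T f) \<le> ennreal (C * K * A)"
    unfolding hardy_norm_le_iff[OF p A(2)] by (intro bound hf A(2)) auto
  also have "\<dots> \<le> ennreal ((C + 1) * K * A)" using A K by (intro ennreal_leI mult_right_mono) auto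
  also have "\<dots> = ennreal ((C + 1) * K) * ennreal A" using C K A by (intro ennreal_mult) auto
  finally have le: "hardy_norm q (T f) \<le> ennreal ((C + 1) * K) * ennreal A" .
  then show "hardy_norm q (T f) \<le> ennreal ((C + 1) * K) * hardy_norm (ennreal p) f" by (simp add: A(1))
  have "hardy_norm q (T f) < \<infinity>" using le_less_trans[OF le] by (simp add: ennreal_mult_less_top)
  then show "T f \<in> hardy_space q" using hol[OF hf] by (simp add: hardy_space_def)
qed

lemma two_powr_neg_less_1: "0 < e \<Longrightarrow> 2 powr (-e) < (1::real)"
  using powr_less_mono[of "-e" 0 2] by simp

lemma hardy_bound_of_carleson_gt:
  assumes p: "0 < p" and pq: "p < q" and g: "0 < \<gamma>"
  shows "\<exists>C>0. \<forall>\<mu> K. finite_measure_01 \<mu> \<longrightarrow> 0 \<le> K \<longrightarrow>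
    (\<forall>t\<in>{0..<1}. measure \<mu> {t..<1} \<le> K * (1 - t) powr (\<gamma> + 1 / p - 1 / q)) \<longrightarrow>
    hardy_bound (cesaro_op \<mu> \<gamma>) (ennreal p) (ennreal q) (C * K)"
proof -
  define c where "c = 1 / (1 - 2 powr (- (1 / p - 1 / q))) + 1 / (1 - 2 powr (- (1 / q)))"
  define C where "C = 2 powr \<gamma> * 12 powr (2 / p) * c * ((8 * pi\<^sup>2) powr ((q - p) / p) * (2048 * pi\<^sup>2)) powr (1 / q)"
  have "0 < 1 / p - 1 / q" "0 < 1 / q" using p pq by (auto simp: divide_simps)
  from two_powr_neg_less_1[OF this(1)] two_powr_neg_less_1[OF this(2)]
  have "0 \<le> c" unfolding c_def by (intro add_nonneg_nonneg divide_nonneg_nonneg) auto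
  then have C: "0 \<le> C" by (simp add: C_def)
  show ?thesis
  proof (intro exI[of _ "C + 1"] conjI allI impI)
    show "0 < C + 1" using C by simp
    fix \<mu> K assume \<mu>: "finite_measure_01 \<mu>" and K: "0 \<le> K"
      and car: "\<forall>t\<in>{0..<1}. measure \<mu> {t..<1} \<le> K * (1 - t) powr (\<gamma> + 1 / p - 1 / q)"
    interpret cesaro_measure \<mu> \<gamma> by (rule cesaro_measureI[OF \<mu> g])
    show "hardy_bound (cesaro_op \<mu> \<gamma>) (ennreal p) (ennreal q) ((C + 1) * K)"
    proof (rule hardy_boundI[OF p C K holomorphic_cesaro_op])
      fix f A assume f: "f holomorphic_on ball 0 1" and A: "0 \<le> A"
        "\<And>r. 0 \<le> r \<Longrightarrow> r < 1 \<Longrightarrow> integral {0..2*pi} (\<lambda>t. norm (f (of_real r * cis t)) powr p) \<le> 2 * pi * A powr p"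
      have "0 \<le> C * K * A" using C K A by simp
      then show "hardy_norm (ennreal q) (cesaro_op \<mu> \<gamma> f) \<le> ennreal (C * K * A)"
        using cesaro_op_bound_gt[OF f p K _ A pq refl] car p pq
        by (subst hardy_norm_le_iff) (auto simp: C_def c_def)
    qed
  qed
qed

lemma hardy_bound_of_carleson_eq:
  assumes p: "0 < p" and p1: "p < 1" and g: "0 < \<gamma>"
  shows "\<exists>C>0. \<forall>\<mu> K. finite_measure_01 \<mu> \<longrightarrow> 0 \<le> K \<longrightarrow>
    (\<forall>t\<in>{0..<1}. measure \<mu> {t..<1} \<le> K * (1 - t) powr \<gamma>) \<longrightarrow>
    hardy_bound (cesaro_op \<mu> \<gamma>) (ennreal p) (ennreal p) (C * K)"
proof -
  define c where "c = (72 * pi * 36864 + 2048 / (1 - 2 powr (- (\<gamma> * p)))) * pi\<^sup>2"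
  define C where "C = 2 powr \<gamma> * 12 powr (2 / p) * c powr (1 / p)"
  have C: "0 \<le> C" by (simp add: C_def)
  show ?thesis
  proof (intro exI[of _ "C + 1"] conjI allI impI)
    show "0 < C + 1" using C by simp
    fix \<mu> K assume \<mu>: "finite_measure_01 \<mu>" and K: "0 \<le> K"
      and car: "\<forall>t\<in>{0..<1}. measure \<mu> {t..<1} \<le> K * (1 - t) powr \<gamma>"
    interpret cesaro_measure \<mu> \<gamma> by (rule cesaro_measureI[OF \<mu> g])
    show "hardy_bound (cesaro_op \<mu> \<gamma>) (ennreal p) (ennreal p) ((C + 1) * K)"
    proof (rule hardy_boundI[OF p C K holomorphic_cesaro_op])
      fix f A assume f: "f holomorphic_on ball 0 1" and A: "0 \<le> A"
        "\<And>r. 0 \<le> r \<Longrightarrow> r < 1 \<Longrightarrow> integral {0..2*pi} (\<lambda>t. norm (f (of_real r * cis t)) powr p) \<le> 2 * pi * A powr p"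
      have "0 \<le> C * K * A" using C K A by simp
      then show "hardy_norm (ennreal p) (cesaro_op \<mu> \<gamma> f) \<le> ennreal (C * K * A)"
        using cesaro_op_bound_eq[OF f p K _ A p1 refl] car p
        by (subst hardy_norm_le_iff) (auto simp: C_def c_def)
    qed
  qed
qed

lemma hardy_bound_of_carleson_infinity:
  assumes p: "0 < p" and p1: "p \<le> 1" and g: "0 < \<gamma>"
  shows "\<exists>C>0. \<forall>\<mu> K. finite_measure_01 \<mu> \<longrightarrow> 0 \<le> K \<longrightarrow>
    (\<forall>t\<in>{0..<1}. measure \<mu> {t..<1} \<le> K * (1 - t) powr (\<gamma> + 1 / p)) \<longrightarrow>
    hardy_bound (cesaro_op \<mu> \<gamma>) (ennreal p) \<infinity> (C * K)"
proof -
  define C where "C = 2 powr \<gamma> * 12 powr (2 / p) * (73728 * pi ^ 3) powr (1 / p)"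
  have C: "0 \<le> C" by (simp add: C_def)
  show ?thesis
  proof (intro exI[of _ "C + 1"] conjI allI impI)
    show "0 < C + 1" using C by simp
    fix \<mu> K assume \<mu>: "finite_measure_01 \<mu>" and K: "0 \<le> K"
      and car: "\<forall>t\<in>{0..<1}. measure \<mu> {t..<1} \<le> K * (1 - t) powr (\<gamma> + 1 / p)"
    interpret cesaro_measure \<mu> \<gamma> by (rule cesaro_measureI[OF \<mu> g])
    show "hardy_bound (cesaro_op \<mu> \<gamma>) (ennreal p) \<infinity> ((C + 1) * K)"
    proof (rule hardy_boundI[OF p C K holomorphic_cesaro_op])
      fix f A assume f: "f holomorphic_on ball 0 1" and A: "0 \<le> A"
        "\<And>r. 0 \<le> r \<Longrightarrow> r < 1 \<Longrightarrow> integral {0..2*pi} (\<lambda>t. norm (f (of_real r * cis t)) powr p) \<le> 2 * pi * A powr p"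
      have "0 \<le> C * K * A" using C K A by simp
      then show "hardy_norm \<infinity> (cesaro_op \<mu> \<gamma> f) \<le> ennreal (C * K * A)"
        using cesaro_op_bound_sup[OF f p K _ A p1 refl] car
        by (subst hardy_norm_infinity_le_iff) (auto simp: C_def)
    qed
  qed
qed

text \<open>Both constants are chosen before the measure, which is the uniformity that the
  comparison of norms demands. The extended exponents become real numbers here; for
  \<open>q = \<infinity>\<close> the term \<open>enn2real (1 / q)\<close> is 0.\<close>

lemma cesaro_op_two_sided_bounds:
  fixes \<gamma> s :: real and p q :: ennreal
  assumes g: "\<gamma> > 0"
    and pq: "(0 < p \<and> p < q \<and> q < \<infinity>) \<or> (0 < p \<and> p = q \<and> q < 1) \<or> (0 < p \<and> p \<le> 1 \<and> q = \<infinity>)"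
    and s: "s = \<gamma> + enn2real (1 / p) - enn2real (1 / q)"
  shows "\<exists>C>0. \<forall>\<mu> K. finite_measure_01 \<mu> \<longrightarrow> 0 \<le> K \<longrightarrow>
    (\<forall>t\<in>{0..<1}. measure \<mu> {t..<1} \<le> K * (1 - t) powr s) \<longrightarrow> hardy_bound (cesaro_op \<mu> \<gamma>) p q (C * K)"
    and "\<exists>C>0. \<forall>\<mu> B. finite_measure_01 \<mu> \<longrightarrow> hardy_bound (cesaro_op \<mu> \<gamma>) p q B \<longrightarrow>
    (\<forall>t\<in>{0..<1}. measure \<mu> {t..<1} \<le> C * B * (1 - t) powr s)"
proof -
  have real_exponent: "\<exists>x'>0. x = ennreal x' \<and> enn2real (1 / x) = 1 / x'" if "0 < x" "x < \<infinity>" for x :: ennreal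
  proof -
    obtain x' where x': "x = ennreal x'" "0 \<le> x'" using \<open>x < \<infinity>\<close> by (cases x) auto
    then have "0 < x'" using that by auto
    moreover have "1 / x = ennreal (1 / x')" using divide_ennreal[of 1 x'] x' calculation by simp
    ultimately show ?thesis using x' by auto
  qed
  have "p < \<infinity>" using pq by (auto simp: less_top[symmetric] top_unique dest: order.strict_trans)
  then obtain p' where p': "0 < p'" "p = ennreal p'" "enn2real (1 / p) = 1 / p'" using real_exponent[of p] pq by auto
  consider q' where "0 < q'" "p' < q'" "q = ennreal q'" "enn2real (1 / q) = 1 / q'"
    | "q = p" "p' < 1" | "q = \<infinity>" "p' \<le> 1"
    using pq
  proof (elim disjE conjE)
    assume "0 < p" "p < q" "q < \<infinity>"
    then have "0 < q" by (intro order.strict_trans[of 0 p q])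
    from real_exponent[OF this \<open>q < \<infinity>\<close>] obtain q' where q': "0 < q'" "q = ennreal q'" "enn2real (1 / q) = 1 / q'"
      by blast
    then show ?thesis using \<open>p < q\<close> p' by (intro that(1)[of q']) (auto simp: ennreal_less_iff)
  next
    assume "p = q" "q < 1"
    then show ?thesis using p' by (intro that(2)) (auto simp: ennreal_less_one_iff)
  next
    assume "p \<le> 1" "q = \<infinity>"
    then show ?thesis using p' by (intro that(3)) (auto simp: ennreal_le_1)
  qed
  then have "(\<exists>C>0. \<forall>\<mu> K. finite_measure_01 \<mu> \<longrightarrow> 0 \<le> K \<longrightarrow>
      (\<forall>t\<in>{0..<1}. measure \<mu> {t..<1} \<le> K * (1 - t) powr s) \<longrightarrow> hardy_bound (cesaro_op \<mu> \<gamma>) p q (C * K)) \<and>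
    (\<exists>C>0. \<forall>\<mu> B. finite_measure_01 \<mu> \<longrightarrow> hardy_bound (cesaro_op \<mu> \<gamma>) p q B \<longrightarrow>
      (\<forall>t\<in>{0..<1}. measure \<mu> {t..<1} \<le> C * B * (1 - t) powr s))"
  proof cases
    case (1 q')
    have s': "s = \<gamma> + 1 / p' - 1 / q'" using s p' 1 by simp
    show ?thesis unfolding s' 1(3) p'(2)
      using carleson_of_hardy_bound_finite[OF p'(1) 1(1) g]
      by (intro conjI[OF hardy_bound_of_carleson_gt[OF p'(1) 1(2) g]] exI[of _ "3 powr (2 / p') * 2 powr \<gamma> * 4 powr (1 / q')"] conjI) auto
  next
    case 2
    have s': "s = \<gamma>" using s 2 by simp
    show ?thesis unfolding s' 2(1) p'(2)
      using carleson_of_hardy_bound_finite[OF p'(1) p'(1) g]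
      by (intro conjI[OF hardy_bound_of_carleson_eq[OF p'(1) 2(2) g]] exI[of _ "3 powr (2 / p') * 2 powr \<gamma> * 4 powr (1 / p')"] conjI) auto
  next
    case 3
    have s': "s = \<gamma> + 1 / p'" using s p' 3 by simp
    show ?thesis unfolding s' 3(1) p'(2)
      using carleson_of_hardy_bound_infinity[OF p'(1) g]
      by (intro conjI[OF hardy_bound_of_carleson_infinity[OF p'(1) 3(2) g]] exI[of _ "3 powr (2 / p') * 2 powr \<gamma>"] conjI) auto
  qed
  then show "\<exists>C>0. \<forall>\<mu> K. finite_measure_01 \<mu> \<longrightarrow> 0 \<le> K \<longrightarrow>
      (\<forall>t\<in>{0..<1}. measure \<mu> {t..<1} \<le> K * (1 - t) powr s) \<longrightarrow> hardy_bound (cesaro_op \<mu> \<gamma>) p q (C * K)"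
    "\<exists>C>0. \<forall>\<mu> B. finite_measure_01 \<mu> \<longrightarrow> hardy_bound (cesaro_op \<mu> \<gamma>) p q B \<longrightarrow>
      (\<forall>t\<in>{0..<1}. measure \<mu> {t..<1} \<le> C * B * (1 - t) powr s)" by blast+
qed

theorem theorem1p1:
  fixes \<gamma> s :: real and p q :: ennreal
  assumes "\<gamma> > 0"
    and "(0 < p \<and> p < q \<and> q < \<infinity>) \<or> (0 < p \<and> p = q \<and> q < 1) \<or> (0 < p \<and> p \<le> 1 \<and> q = \<infinity>)"
    and "s = \<gamma> + enn2real (1 / p) - enn2real (1 / q)"
  shows "(\<forall>\<mu>. finite_measure_01 \<mu> \<longrightarrow>
            (hardy_bounded (cesaro_op \<mu> \<gamma>) p q \<longleftrightarrow> carleson_measure s \<mu>)) \<and>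
         (\<exists>C>0. \<forall>\<mu>. finite_measure_01 \<mu> \<longrightarrow>
            ennreal (1 / C) * carleson_const s \<mu> \<le> hardy_opnorm (cesaro_op \<mu> \<gamma>) p q \<and>
            hardy_opnorm (cesaro_op \<mu> \<gamma>) p q \<le> ennreal C * carleson_const s \<mu>)"
proof -
  obtain Cu where Cu: "0 < Cu" and upper: "\<And>\<mu> K. finite_measure_01 \<mu> \<Longrightarrow> 0 \<le> K \<Longrightarrow>
      (\<forall>t\<in>{0..<1}. measure \<mu> {t..<1} \<le> K * (1 - t) powr s) \<Longrightarrow> hardy_bound (cesaro_op \<mu> \<gamma>) p q (Cu * K)"
    using cesaro_op_two_sided_bounds(1)[OF assms] by blast
  obtain Cl where Cl: "0 < Cl" and lower: "\<And>\<mu> B t. finite_measure_01 \<mu> \<Longrightarrow> hardy_bound (cesaro_op \<mu> \<gamma>) p q B \<Longrightarrow>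
      t \<in> {0..<1} \<Longrightarrow> measure \<mu> {t..<1} \<le> Cl * B * (1 - t) powr s"
    using cesaro_op_two_sided_bounds(2)[OF assms] by blast
  have "hardy_bounded (cesaro_op \<mu> \<gamma>) p q \<longleftrightarrow> carleson_measure s \<mu>" if \<mu>: "finite_measure_01 \<mu>" for \<mu>
  proof
    assume "hardy_bounded (cesaro_op \<mu> \<gamma>) p q"
    then show "carleson_measure s \<mu>" unfolding hardy_bounded_def carleson_measure_def using lower[OF \<mu>] by blast
  next
    assume "carleson_measure s \<mu>"
    then obtain K where K: "\<And>t. t \<in> {0..<1} \<Longrightarrow> measure \<mu> {t..<1} \<le> K * (1 - t) powr s"
      unfolding carleson_measure_def by blast
    \<comment> \<open>\<open>upper\<close> asks for a nonnegative constant, and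
      \<open>carleson_measure\<close> does not state the sign of its own.\<close>
    have "measure \<mu> {t..<1} \<le> max K 0 * (1 - t) powr s" if "t \<in> {0..<1}" for t
      using K[OF that] mult_right_mono[of K "max K 0" "(1 - t) powr s"] by simp
    then show "hardy_bounded (cesaro_op \<mu> \<gamma>) p q" unfolding hardy_bounded_def using upper[OF \<mu>, of "max K 0"] by auto
  qed
  moreover have "\<exists>C>0. \<forall>\<mu>. finite_measure_01 \<mu> \<longrightarrow>
            ennreal (1 / C) * carleson_const s \<mu> \<le> hardy_opnorm (cesaro_op \<mu> \<gamma>) p q \<and>
            hardy_opnorm (cesaro_op \<mu> \<gamma>) p q \<le> ennreal C * carleson_const s \<mu>"
  proof (intro exI[of _ "max Cu Cl"] conjI allI impI)
    define C where "C = max Cu Cl"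
    have C: "0 < C" "Cu \<le> C" "Cl \<le> C" using Cu by (auto simp: C_def)
    then show "0 < max Cu Cl" by (simp add: C_def)
    fix \<mu> assume \<mu>: "finite_measure_01 \<mu>"
    show "ennreal (1 / max Cu Cl) * carleson_const s \<mu> \<le> hardy_opnorm (cesaro_op \<mu> \<gamma>) p q"
      unfolding hardy_opnorm_def C_def[symmetric]
    proof (rule Inf_greatest, safe)
      fix B assume B: "hardy_bound (cesaro_op \<mu> \<gamma>) p q B"
      have B0: "0 \<le> B" using B by (simp add: hardy_bound_def)
      have "carleson_const s \<mu> \<le> ennreal (Cl * B)"
        unfolding carleson_const_def
      proof (rule SUP_least, rule ennreal_leI)
        fix t :: real assume t: "t \<in> {0..<1}"
        then show "measure \<mu> {t..<1} / (1 - t) powr s \<le> Cl * B"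
          using lower[OF \<mu> B t] by (simp add: divide_le_eq)
      qed
      then have "ennreal (1 / C) * carleson_const s \<mu> \<le> ennreal (1 / C) * ennreal (Cl * B)" by (intro mult_left_mono) auto
      also have "\<dots> = ennreal (Cl / C * B)" using C Cl B0 by (simp add: ennreal_mult[symmetric])
      also have "\<dots> \<le> ennreal (1 * B)" using C Cl B0 by (intro ennreal_leI mult_right_mono) auto
      finally show "ennreal (1 / C) * carleson_const s \<mu> \<le> ennreal B" by simp
    qed
    show "hardy_opnorm (cesaro_op \<mu> \<gamma>) p q \<le> ennreal (max Cu Cl) * carleson_const s \<mu>"
      unfolding C_def[symmetric]
    \<comment> \<open>An infinite supremum makes the right side infinite as \<open>C > 0\<close>; a
      finite one is itself an admissible Carleson constant.\<close>
    proof (cases "carleson_const s \<mu> = \<infinity>")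
      case True
      then show "hardy_opnorm (cesaro_op \<mu> \<gamma>) p q \<le> ennreal C * carleson_const s \<mu>" using C by (simp add: ennreal_mult_top)
    next
      case False
      then obtain K where K: "carleson_const s \<mu> = ennreal K" "0 \<le> K" by (cases "carleson_const s \<mu>") auto
      have "measure \<mu> {t..<1} \<le> K * (1 - t) powr s" if t: "t \<in> {0..<1}" for t
      proof -
        have "ennreal (measure \<mu> {t..<1} / (1 - t) powr s) \<le> ennreal K"
          unfolding K(1)[symmetric] carleson_const_def by (rule SUP_upper[OF t])
        then show ?thesis using t K(2) by (simp add: ennreal_le_iff divide_le_eq)
      qed
      then have "hardy_bound (cesaro_op \<mu> \<gamma>) p q (Cu * K)" by (intro upper \<mu> K(2)) auto
      then have "hardy_opnorm (cesaro_op \<mu> \<gamma>) p q \<le> ennreal (Cu * K)" unfolding hardy_opnorm_def by (intro Inf_lower) auto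
      also have "\<dots> = ennreal Cu * carleson_const s \<mu>" using Cu K by (simp add: ennreal_mult)
      also have "\<dots> \<le> ennreal C * carleson_const s \<mu>" using C by (intro mult_right_mono ennreal_leI) auto
      finally show "hardy_opnorm (cesaro_op \<mu> \<gamma>) p q \<le> ennreal C * carleson_const s \<mu>" .
    qed
  qed
  ultimately show ?thesis by blast
qed

end
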